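(* Let $\mathfrak{g}$ be a finite-dimensional Lie algebra over $\mathbb{C}$, let $\mathfrak{r}$ be its solvable radical, and suppose that $\mathfrak{g}$ admits a semisimple automorphism $\alpha$ with exactly $n$ distinct eigenvalues and with fixed-point subalgebra $\{x\in\mathfrak{g} : \alpha(x)=x\}$ of dimension $m$. Then $$\operatorname{dl}(\mathfrak{r}) \leq (m+1)\,2^{n} + m$$ and $$\dim(\mathfrak{g}/\mathfrak{r}) \leq 16\,(mn)^3 + 4\,(mn)^2 + 224\,(mn).$$
   Context: A semisimple automorphism is one that is diagonalizable as a linear map over $\mathbb{C}$. $\operatorname{dl}$ denotes the derived length of a solvable Lie algebra. *)

theory Defs
  imports Complex_Main
begin

locale lie_algebra = vector_space scale
  for scale :: "'k::field \<Rightarrow> 'a::ab_group_add \<Rightarrow> 'a" +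
  fixes bracket :: "'a \<Rightarrow> 'a \<Rightarrow> 'a"
  assumes bracket_add_left: "bracket (x + y) z = bracket x z + bracket y z"
    and bracket_add_right: "bracket x (y + z) = bracket x y + bracket x z"
    and bracket_scale_left: "bracket (scale c x) y = scale c (bracket x y)"
    and bracket_scale_right: "bracket x (scale c y) = scale c (bracket x y)"
    and bracket_self: "bracket x x = 0"
    and jacobi: "bracket x (bracket y z) + bracket y (bracket z x) + bracket z (bracket x y) = 0"
begin

subsection \<open>The underlying vector space\<close>

definition finite_dim :: bool where
  "finite_dim \<longleftrightarrow> (\<exists>B. finite B \<and> span B = UNIV)"

definition eigenvalues :: "('a \<Rightarrow> 'a) \<Rightarrow> 'k set" where
  "eigenvalues f = {c. \<exists>v. v \<noteq> 0 \<and> f v = scale c v}"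

definition diagonalizable :: "('a \<Rightarrow> 'a) \<Rightarrow> bool" where
  "diagonalizable f \<longleftrightarrow>
     (\<exists>B. independent B \<and> span B = UNIV \<and> (\<forall>b\<in>B. \<exists>c. f b = scale c b))"

definition coset :: "'a set \<Rightarrow> 'a \<Rightarrow> 'a set" where
  "coset U x = {x + u | u. u \<in> U}"

text \<open>
  The vectors of the quotient by a subspace \<open>U\<close> are the cosets of \<open>U\<close>; its zero is \<open>U\<close>, and
  \<open>{scale c x + y | x y. x \<in> C \<and> y \<in> D}\<close> is the coset \<open>c C + D\<close> (also if \<open>c = 0\<close>).
  So \<open>quotient_span U B\<close> is the linear span, in the quotient, of a set \<open>B\<close> of cosets.
\<close>

definition quotient_space :: "'a set \<Rightarrow> 'a set set" where
  "quotient_space U = range (coset U)"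

inductive_set quotient_span :: "'a set \<Rightarrow> 'a set set \<Rightarrow> 'a set set"
  for U :: "'a set" and B :: "'a set set" where
  zero: "U \<in> quotient_span U B"
| step: "C \<in> B \<Longrightarrow> D \<in> quotient_span U B \<Longrightarrow>
           {scale c x + y | x y. x \<in> C \<and> y \<in> D} \<in> quotient_span U B"

definition quotient_basis :: "'a set \<Rightarrow> 'a set set \<Rightarrow> bool" where
  "quotient_basis U B \<longleftrightarrow> B \<subseteq> quotient_space U \<and>
     (\<forall>C\<in>B. C \<notin> quotient_span U (B - {C})) \<and> quotient_span U B = quotient_space U"

definition quotient_dim :: "'a set \<Rightarrow> nat" where
  "quotient_dim U = card (SOME B. quotient_basis U B)"

lemma coset_eq_iff: "subspace U \<Longrightarrow> coset U x = coset U y \<longleftrightarrow> x - y \<in> U"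
proof -
  assume U: "subspace U"
  have *: "coset U z = {w. w - z \<in> U}" for z
  proof -
    have "w \<in> coset U z" if "w - z \<in> U" for w
    proof -
      have "w = z + (w - z)" by simp
      with that show ?thesis unfolding coset_def by blast
    qed
    then show ?thesis by (auto simp: coset_def)
  qed
  show ?thesis
  proof
    assume "coset U x = coset U y"
    moreover have "x \<in> coset U x" using U by (simp add: * subspace_0)
    ultimately show "x - y \<in> U" by (simp add: *)
  next
    assume d: "x - y \<in> U"
    have "w - x \<in> U \<longleftrightarrow> w - y \<in> U" for w
    proof
      assume "w - x \<in> U"
      from subspace_add[OF U this d] show "w - y \<in> U" by simp
    next
      assume "w - y \<in> U"
      from subspace_diff[OF U this d] show "w - x \<in> U" by simp
    qed
    then show "coset U x = coset U y" by (simp add: *)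
  qed
qed

lemma coset_zero: "coset U 0 = U"
  by (auto simp: coset_def)

lemma coset_lincomb:
  assumes U: "subspace U"
  shows "{scale c x' + y' | x' y'. x' \<in> coset U x \<and> y' \<in> coset U y} = coset U (scale c x + y)"
    (is "?L = ?R")
proof
  show "?L \<subseteq> ?R"
  proof
    fix z assume "z \<in> ?L"
    then obtain u v where "u \<in> U" "v \<in> U" and z: "z = scale c (x + u) + (y + v)"
      by (auto simp: coset_def)
    then have "scale c u + v \<in> U" using U by (simp add: subspace_add subspace_scale)
    moreover have "z = (scale c x + y) + (scale c u + v)"
      by (simp add: z scale_right_distrib algebra_simps)
    ultimately show "z \<in> ?R" unfolding coset_def by blast
  qed
  show "?R \<subseteq> ?L"
  proof
    fix z assume "z \<in> ?R"
    then obtain u where u: "u \<in> U" and z: "z = scale c x + (y + u)"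
      by (auto simp: coset_def add.assoc)
    have "x \<in> coset U x" using subspace_0[OF U] by (force simp: coset_def)
    moreover have "y + u \<in> coset U y" using u by (auto simp: coset_def)
    ultimately show "z \<in> ?L" using z by blast
  qed
qed

lemma quotient_span_image:
  assumes U: "subspace U"
  shows "quotient_span U (coset U ` R) = coset U ` span (R \<union> U)"
proof
  show "quotient_span U (coset U ` R) \<subseteq> coset U ` span (R \<union> U)"
  proof
    fix C assume "C \<in> quotient_span U (coset U ` R)"
    then show "C \<in> coset U ` span (R \<union> U)"
    proof induction
      case zero
      show ?case by (rule image_eqI[of _ _ 0]) (simp_all add: coset_zero span_zero)
    next
      case (step C D c)
      then obtain r y where "r \<in> R" "C = coset U r" "y \<in> span (R \<union> U)" "D = coset U y" by auto
      moreover from this have "scale c r + y \<in> span (R \<union> U)"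
        by (intro span_add span_scale) (simp_all add: span_base)
      ultimately show ?case by (simp add: coset_lincomb[OF U])
    qed
  qed
  show "coset U ` span (R \<union> U) \<subseteq> quotient_span U (coset U ` R)"
  proof clarify
    fix x assume "x \<in> span (R \<union> U)"
    then show "coset U x \<in> quotient_span U (coset U ` R)"
    proof (induction rule: span_induct_alt)
      case base
      show ?case by (simp add: coset_zero quotient_span.zero)
    next
      case (step c x y)
      show ?case
      proof (cases "x \<in> R")
        case True
        from quotient_span.step[of "coset U x" "coset U ` R" "coset U y" U c] True step
        show ?thesis by (simp add: coset_lincomb[OF U])
      next
        case False
        with step have "x \<in> U" by simp
        then have "coset U (scale c x + y) = coset U y"
          using U by (simp add: coset_eq_iff subspace_scale)
        with step show ?thesis by simp
      qed
    qed
  qed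
qed

lemma coset_mem_image_span:
  assumes U: "subspace U"
  shows "coset U x \<in> coset U ` span (R \<union> U) \<longleftrightarrow> x \<in> span (R \<union> U)"
proof
  assume "coset U x \<in> coset U ` span (R \<union> U)"
  then obtain y where y: "y \<in> span (R \<union> U)" "x - y \<in> U" using coset_eq_iff[OF U] by auto
  then have "(x - y) + y \<in> span (R \<union> U)" by (intro span_add) (simp_all add: span_base)
  then show "x \<in> span (R \<union> U)" by simp
qed auto

lemma quotient_basis_image:
  assumes U: "subspace U" and inj: "inj_on (coset U) R"
  shows "quotient_basis U (coset U ` R) \<longleftrightarrow>
    (\<forall>r\<in>R. r \<notin> span (R - {r} \<union> U)) \<and> span (R \<union> U) = UNIV"
proof -
  have diff: "coset U ` R - {coset U r} = coset U ` (R - {r})" if "r \<in> R" for r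
    using inj that by (auto simp: inj_on_def)
  have "(\<forall>C\<in>coset U ` R. C \<notin> quotient_span U (coset U ` R - {C})) \<longleftrightarrow>
      (\<forall>r\<in>R. coset U r \<notin> quotient_span U (coset U ` R - {coset U r}))"
    by blast
  also have "\<dots> \<longleftrightarrow> (\<forall>r\<in>R. r \<notin> span (R - {r} \<union> U))"
    by (intro ball_cong refl)
      (simp only: diff quotient_span_image[OF U] coset_mem_image_span[OF U])
  finally have ind: "(\<forall>C\<in>coset U ` R. C \<notin> quotient_span U (coset U ` R - {C})) \<longleftrightarrow>
      (\<forall>r\<in>R. r \<notin> span (R - {r} \<union> U))" .
  have "span (R \<union> U) = UNIV" if "coset U ` span (R \<union> U) = range (coset U)"
  proof -
    have "x \<in> span (R \<union> U)" for x
      using coset_mem_image_span[OF U, of x R] that by simp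
    then show ?thesis by blast
  qed
  then have gen: "quotient_span U (coset U ` R) = range (coset U) \<longleftrightarrow> span (R \<union> U) = UNIV"
    by (metis quotient_span_image[OF U])
  show ?thesis
    unfolding quotient_basis_def quotient_space_def ind gen by blast
qed

lemma independent_Un_modulo:
  assumes S: "independent S" "span S = U" and R: "\<And>r. r \<in> R \<Longrightarrow> r \<notin> span (R - {r} \<union> U)"
    and fin: "finite R"
  shows "independent (R \<union> S)"
  using fin R
proof (induction R)
  case empty
  then show ?case using S by simp
next
  case (insert a F)
  have SU: "S \<subseteq> U" using S span_superset by blast
  have "r \<notin> span (F - {r} \<union> U)" if "r \<in> F" for r
    using insert.prems[of r] that span_mono[of "F - {r} \<union> U" "insert a F - {r} \<union> U"] by blast
  then have "independent (F \<union> S)" by (rule insert.IH)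
  moreover have "a \<notin> span (F \<union> S)"
    using insert.prems[of a] insert.hyps span_mono[of "F \<union> S" "insert a F - {a} \<union> U"] SU by blast
  ultimately show ?case by (simp add: independent_insertI)
qed

lemma quotient_dim_eq:
  assumes fd: finite_dim and U: "subspace U"
  shows "\<exists>B. quotient_basis U B"
    and "\<And>B. quotient_basis U B \<Longrightarrow> finite B \<and> card B + dim U = dim UNIV"
    and "quotient_dim U + dim U = dim UNIV"
proof -
  obtain B0 where B0: "finite B0" "span B0 = UNIV" using fd unfolding finite_dim_def by blast
  have finind: "finite I \<and> card I \<le> card B0" if "independent I" for I
    using independent_span_bound[OF B0(1) that] B0(2) by simp
  obtain S where S: "S \<subseteq> U" "independent S" "U \<subseteq> span S"
    using maximal_independent_subset by blast
  have sS: "span S = U" using S span_minimal[OF S(1) U] by blast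
  have dU: "dim U = card S" using sS S dim_span_eq_card_independent by blast
  show ex: "\<exists>B. quotient_basis U B"
  proof -
    obtain T where T: "S \<subseteq> T" "independent T" "UNIV \<subseteq> span T"
      using maximal_independent_subset_extend[OF subset_UNIV S(2)] by metis
    define R where "R = T - S"
    have sp: "span (R' \<union> U) = span (R' \<union> S)" for R'
      unfolding sS[symmetric] by (simp only: span_Un span_span)
    have ni: "r \<notin> span (R - {r} \<union> U)" if "r \<in> R" for r
    proof -
      have "R - {r} \<union> S = T - {r}" using that T by (auto simp: R_def)
      moreover have "r \<notin> span (T - {r})" using that T by (auto simp: R_def dependent_def)
      ultimately show ?thesis by (simp add: sp)
    qed
    have "inj_on (coset U) R"
    proof (rule inj_onI, rule ccontr)
      fix x y assume xy: "x \<in> R" "y \<in> R" "coset U x = coset U y" "x \<noteq> y"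
      then have "x - y \<in> U" by (simp add: coset_eq_iff[OF U])
      then have "(x - y) + y \<in> span (R - {x} \<union> U)"
        using xy by (intro span_add) (simp_all add: span_base)
      then show False using ni xy by simp
    qed
    moreover have "span (R \<union> U) = UNIV"
    proof -
      have "R \<union> S = T" using T by (auto simp: R_def)
      then show ?thesis using T sp by auto
    qed
    ultimately have "quotient_basis U (coset U ` R)"
      using ni by (simp add: quotient_basis_image[OF U])
    then show ?thesis by blast
  qed
  show all: "finite B \<and> card B + dim U = dim UNIV" if B: "quotient_basis U B" for B
  proof -
    have "B \<subseteq> range (coset U)" using B by (simp add: quotient_basis_def quotient_space_def)
    then obtain R where R: "inj_on (coset U) R" "B = coset U ` R"
      by (meson subset_image_inj)
    have ni: "\<And>r. r \<in> R \<Longrightarrow> r \<notin> span (R - {r} \<union> U)" and sp: "span (R \<union> U) = UNIV"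
      using B R quotient_basis_image[OF U R(1)] by auto
    have sub: "independent (F \<union> S)" if "finite F" "F \<subseteq> R" for F
    proof (rule independent_Un_modulo[OF S(2) sS _ that(1)])
      fix r assume "r \<in> F"
      then show "r \<notin> span (F - {r} \<union> U)"
        using ni[of r] that span_mono[of "F - {r} \<union> U" "R - {r} \<union> U"] by blast
    qed
    have finR: "finite R"
    proof (rule ccontr)
      assume "infinite R"
      then obtain F where F: "finite F" "card F = Suc (card B0)" "F \<subseteq> R"
        using infinite_arbitrarily_large by blast
      have "card F \<le> card (F \<union> S)"
        using finind[OF sub[OF F(1) F(3)]] by (intro card_mono) auto
      then show False using finind[OF sub[OF F(1) F(3)]] F by simp
    qed
    have ind: "independent (R \<union> S)" using sub finR by blast
    have "R \<inter> S = {}"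
    proof (rule ccontr)
      assume "R \<inter> S \<noteq> {}"
      then obtain r where "r \<in> R" "r \<in> U" using S by blast
      then show False using ni[of r] by (simp add: span_base)
    qed
    then have "card (R \<union> S) = card R + card S"
      using finR finind[OF S(2)] by (simp add: card_Un_disjoint)
    moreover have "span (R \<union> S) = UNIV" using sp unfolding sS[symmetric] by (simp only: span_Un span_span)
    then have "dim UNIV = card (R \<union> S)" using ind dim_span_eq_card_independent by metis
    moreover have "card B = card R" using R by (simp add: card_image)
    ultimately show ?thesis using dU R finR by simp
  qed
  show "quotient_dim U + dim U = dim UNIV"
    unfolding quotient_dim_def using all[OF someI_ex[OF ex]] by simp
qed

subsection \<open>Ideals, derived series and the radical\<close>

definition automorphism :: "('a \<Rightarrow> 'a) \<Rightarrow> bool" where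
  "automorphism f \<longleftrightarrow> Vector_Spaces.linear scale scale f \<and> bij f \<and>
     (\<forall>x y. f (bracket x y) = bracket (f x) (f y))"

definition ideal :: "'a set \<Rightarrow> bool" where
  "ideal I \<longleftrightarrow> subspace I \<and> (\<forall>x. \<forall>y\<in>I. bracket x y \<in> I)"

definition bracket_span :: "'a set \<Rightarrow> 'a set \<Rightarrow> 'a set" where
  "bracket_span A B = span {bracket a b | a b. a \<in> A \<and> b \<in> B}"

primrec derived_series :: "'a set \<Rightarrow> nat \<Rightarrow> 'a set" where
  "derived_series A 0 = A"
| "derived_series A (Suc k) = bracket_span (derived_series A k) (derived_series A k)"

definition solvable :: "'a set \<Rightarrow> bool" where
  "solvable A \<longleftrightarrow> (\<exists>k. derived_series A k = {0})"

definition derived_length :: "'a set \<Rightarrow> nat" where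
  "derived_length A = (LEAST k. derived_series A k = {0})"

text \<open>
  The radical is defined as the sum of all solvable ideals; \<open>solvable_radical_greatest\<close> below
  shows that in finite dimension it is the largest solvable ideal.
\<close>

definition solvable_radical :: "'a set" where
  "solvable_radical = span (\<Union>{I. ideal I \<and> solvable I})"

lemma bracket_zero_left: "bracket 0 x = 0"
  using bracket_add_left[of 0 0 x] by simp

lemma bracket_zero_right: "bracket x 0 = 0"
  using bracket_add_right[of x 0 0] by simp

lemma bracket_antisym: "bracket x y = - bracket y x"
proof -
  have "bracket x y + bracket y x = bracket x (x + y) + bracket y (x + y)"
    by (simp add: bracket_add_right bracket_self)
  also have "\<dots> = bracket (x + y) (x + y)" by (simp only: bracket_add_left)
  finally have "bracket x y + bracket y x = 0" by (simp only: bracket_self)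
  then show ?thesis by (simp add: eq_neg_iff_add_eq_0)
qed

lemma ideal_bracket_left: "ideal I \<Longrightarrow> x \<in> I \<Longrightarrow> bracket x y \<in> I"
  using bracket_antisym[of x y] subspace_neg unfolding ideal_def by metis

lemma ideal_zero: "ideal {0}"
  by (simp add: ideal_def bracket_zero_right)

lemma solvable_zero: "solvable {0}"
  unfolding solvable_def by (rule exI[of _ 0]) simp

lemma subspace_derived_series: "subspace A \<Longrightarrow> subspace (derived_series A k)"
  by (cases k) (auto simp: bracket_span_def subspace_span)

lemma bracket_span_mono: "A \<subseteq> A' \<Longrightarrow> B \<subseteq> B' \<Longrightarrow> bracket_span A B \<subseteq> bracket_span A' B'"
  unfolding bracket_span_def by (intro span_mono) blast

lemma derived_series_mono: "A \<subseteq> B \<Longrightarrow> derived_series A k \<subseteq> derived_series B k"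
  by (induction k) (auto dest: bracket_span_mono)

lemma derived_series_add: "derived_series A (k + l) = derived_series (derived_series A k) l"
  by (induction l) auto

lemma ideal_sum:
  assumes "ideal I" "ideal J"
  shows "ideal {x + y | x y. x \<in> I \<and> y \<in> J}"
proof -
  have "bracket z (x + y) \<in> {x + y | x y. x \<in> I \<and> y \<in> J}" if "x \<in> I" "y \<in> J" for x y z
    unfolding bracket_add_right using assms that unfolding ideal_def by blast
  moreover have "subspace {x + y | x y. x \<in> I \<and> y \<in> J}"
    using assms by (intro subspace_sums) (simp_all add: ideal_def)
  ultimately show ?thesis unfolding ideal_def by blast
qed

lemma derived_series_sum:
  assumes I: "ideal I" and J: "ideal J"
  shows "derived_series {x + y | x y. x \<in> I \<and> y \<in> J} k \<subseteq>
    {x + y | x y. x \<in> derived_series I k \<and> y \<in> J}"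
proof (induction k)
  case (Suc k)
  let ?S = "{x + y | x y. x \<in> derived_series I (Suc k) \<and> y \<in> J}"
  have sI: "subspace I" and sJ: "subspace J" using I J by (simp_all add: ideal_def)
  have "subspace ?S"
    by (rule subspace_sums[OF subspace_derived_series[OF sI] sJ])
  moreover have "bracket p q \<in> ?S"
    if "p \<in> {x + y | x y. x \<in> derived_series I k \<and> y \<in> J}"
      "q \<in> {x + y | x y. x \<in> derived_series I k \<and> y \<in> J}" for p q
  proof -
    from that obtain a j b l where *: "a \<in> derived_series I k" "j \<in> J" "p = a + j"
      "b \<in> derived_series I k" "l \<in> J" "q = b + l" by blast
    have "bracket p q = bracket a b + (bracket a l + bracket j q)"
      by (simp add: * bracket_add_left bracket_add_right algebra_simps)
    moreover have "bracket a b \<in> derived_series I (Suc k)"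
      using * by (auto simp: bracket_span_def intro!: span_base)
    moreover have "bracket a l + bracket j q \<in> J"
      using * J ideal_bracket_left[OF J] by (auto simp: ideal_def intro!: subspace_add)
    ultimately show ?thesis by blast
  qed
  ultimately have "bracket_span {x + y | x y. x \<in> derived_series I k \<and> y \<in> J}
      {x + y | x y. x \<in> derived_series I k \<and> y \<in> J} \<subseteq> ?S"
    unfolding bracket_span_def by (intro span_minimal) blast+
  then show ?case
    using bracket_span_mono[OF Suc Suc] by simp
qed auto

lemma solvable_sum:
  assumes I: "ideal I" "solvable I" and J: "ideal J" "solvable J"
  shows "solvable {x + y | x y. x \<in> I \<and> y \<in> J}" (is "solvable ?S")
proof -
  obtain k l where kl: "derived_series I k = {0}" "derived_series J l = {0}"
    using I J unfolding solvable_def by blast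
  have "derived_series ?S k \<subseteq> J" using derived_series_sum[OF I(1) J(1), of k] kl by auto
  then have "derived_series ?S (k + l) \<subseteq> {0}"
    using derived_series_mono[of _ J l] kl by (simp add: derived_series_add)
  moreover have "subspace (derived_series ?S (k + l))"
    using I J by (intro subspace_derived_series subspace_sums) (auto simp: ideal_def)
  ultimately have "derived_series ?S (k + l) = {0}" using subspace_0 by blast
  then show ?thesis unfolding solvable_def by blast
qed

lemma solvable_radical_greatest:
  assumes fd: finite_dim
  shows "ideal solvable_radical" and "solvable solvable_radical"
    and "\<And>I. ideal I \<Longrightarrow> solvable I \<Longrightarrow> I \<subseteq> solvable_radical"
proof -
  obtain B0 where B0: "finite B0" "span B0 = UNIV" using fd unfolding finite_dim_def by blast
  obtain B where B: "B \<subseteq> B0" "independent B" "B0 \<subseteq> span B"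
    using maximal_independent_subset by blast
  interpret finite_dimensional_vector_space scale B
  proof
    show "finite B" using B B0 finite_subset by blast
    show "independent B" by (rule B)
    show "span B = UNIV" using B B0 by (metis span_mono span_span top.extremum_unique)
  qed
  let ?P = "\<lambda>I. ideal I \<and> solvable I"
  have "\<exists>R. ?P R \<and> (\<forall>I. ?P I \<longrightarrow> dim I \<le> dim R)"
    by (rule ex_has_greatest_nat[of ?P "{0}" dim "Suc dimension"])
      (auto simp: ideal_zero solvable_zero less_Suc_eq_le dim_subset_UNIV)
  then obtain R where R: "ideal R" "solvable R" and
    max: "\<And>I. ideal I \<Longrightarrow> solvable I \<Longrightarrow> dim I \<le> dim R" by blast
  have sub: "I \<subseteq> R" if I: "ideal I" "solvable I" for I
  proof -
    let ?S = "{x + y | x y. x \<in> R \<and> y \<in> I}"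
    have 0: "0 \<in> R" "0 \<in> I" using R I subspace_0 by (auto simp: ideal_def)
    have "R \<subseteq> ?S" "I \<subseteq> ?S" using 0 by force+
    moreover have "dim ?S \<le> dim R"
      by (intro max ideal_sum solvable_sum R I)
    ultimately have "R = ?S"
      using ideal_sum[OF R(1) I(1)] R(1) unfolding ideal_def
      by (intro subspace_dim_equal) auto
    then show ?thesis using \<open>I \<subseteq> ?S\<close> by blast
  qed
  have "\<Union>{I. ?P I} = R" using sub R by blast
  then have "solvable_radical = R"
    unfolding solvable_radical_def using R by (simp add: ideal_def span_eq_iff)
  then show "ideal solvable_radical" "solvable solvable_radical"
    "\<And>I. ideal I \<Longrightarrow> solvable I \<Longrightarrow> I \<subseteq> solvable_radical"
    using R sub by auto
qed

end

end

(* Grade g by the eigenvalues of alpha. A circular order on the multiplicative group of the complex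
   numbers makes Kreknin's argument work for this grading: if the fixed points of a graded
   subalgebra H lie in an ideal J, then so does the 2^n-th derived algebra of H. Hence along the
   derived series of the radical the dimension of the fixed points drops at least every 2^n + 1
   steps, until the series is {0}.

   For the quotient no classification is needed. The radical has an alpha-invariant complement W,
   which becomes a semisimple algebra isomorphic to g/r. Refine the grading by semisimple parts of
   ad h, h fixed, until every fixed h in W has a single eigenvalue on each component. Then the fixed
   points A of the refined grading form a torus, dim A <= m, and the components have weights in the
   dual of A. If two roots of the same alpha-degree have a positive inner product, lowering by one
   maps the root space of the other injectively into the alpha-fixed points, so a root has
   neighbours of total dimension at most m; and a system of pairwise obtuse roots has at most
   2 dim A members. Hence each alpha-degree contributes at most 2 m^2 dimensions of nonzero weight.
   The sum of the nonzero weight spaces and of the commutators of opposite ones is an ideal that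
   contains A, so by Kreknin's theorem it is all of W, which bounds the zero weight space as well. *)

theory Submission
  imports Defs "HOL-Analysis.Complex_Transcendental"
    "HOL-Computational_Algebra.Fundamental_Theorem_Algebra"
begin

text \<open>The eigenvalues of \<open>\<alpha>\<close> need not be roots of unity, so degrees cannot
  be ordered as residues; what Kreknin's argument really uses is that a product of two nontrivial
  degrees lies above both factors or below both. The stride N + 1, N = 2^n, comes from comparing two
  terms that far apart: equal fixed points make the series stationary after N steps. At most m drops
  cost m(N + 1) steps and a last application costs N, in all (m + 1)N + m. For the quotient, fixed
  elements are not known to be ad-semisimple, nor their weights to be real. Hence weights are
  normalized traces on generalized eigenspaces, and a string argument makes all weights of a bracket
  of opposite degrees real multiples of one of them; this gives positivity and also Cartan's
  criterion. The quotient is modelled on the whole space by a projected bracket that vanishes on the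
  radical, so \<open>\<alpha>\<close>, m and n stay the same. The count is 2m^2 n for the nonzero
  weights (n degrees, 2m obtuse roots, m per neighbourhood) and 2m^3 n^2 for the
  commutators.\<close>

locale complex_fd_space = finite_dimensional_vector_space scale Basis
  for scale :: "complex \<Rightarrow> 'a::ab_group_add \<Rightarrow> 'a" and Basis :: "'a set"
begin

section \<open>Linear maps on a finite-dimensional complex vector space\<close>

abbreviation lin :: "('a \<Rightarrow> 'a) \<Rightarrow> bool"
  where "lin \<equiv> Vector_Spaces.linear scale scale"

lemma linI: "(\<And>x y. f (x + y) = f x + f y) \<Longrightarrow> (\<And>c x. f (scale c x) = scale c (f x)) \<Longrightarrow> lin f"
  by (simp add: Vector_Spaces.linear_iff vector_space_axioms)

lemma lin_add: "lin f \<Longrightarrow> f (x + y) = f x + f y"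
  and lin_scale: "lin f \<Longrightarrow> f (scale c x) = scale c (f x)"
  by (simp_all add: Vector_Spaces.linear_iff)

lemma lin_0: "lin f \<Longrightarrow> f 0 = 0"
  using lin_add[of f 0 0] by simp

lemma lin_diff: "lin f \<Longrightarrow> f (x - y) = f x - f y"
  using lin_add[of f "x - y" y] by simp

lemma lin_sum: "lin f \<Longrightarrow> f (sum g A) = (\<Sum>a\<in>A. f (g a))"
  by (induction A rule: infinite_finite_induct) (simp_all add: lin_0 lin_add)

lemma lin_id: "lin (\<lambda>x. x)" "lin id"
  by (simp_all add: linI)

lemma lin_comp: "lin f \<Longrightarrow> lin g \<Longrightarrow> lin (\<lambda>x. f (g x))"
  by (intro linI) (simp_all add: lin_add lin_scale)

lemma lin_plus: "lin f \<Longrightarrow> lin g \<Longrightarrow> lin (\<lambda>x. f x + g x)"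
  by (intro linI) (simp_all add: lin_add lin_scale scale_right_distrib algebra_simps)

lemma lin_minus: "lin f \<Longrightarrow> lin g \<Longrightarrow> lin (\<lambda>x. f x - g x)"
  by (intro linI) (simp_all add: lin_add lin_scale scale_right_diff_distrib algebra_simps)

lemma lin_scaled: "lin f \<Longrightarrow> lin (\<lambda>x. scale c (f x))"
  by (intro linI) (simp_all add: lin_add lin_scale scale_right_distrib mult.commute)

lemma lin_zero: "lin (\<lambda>x. 0)"
  by (intro linI) simp_all

lemma lin_setsum: "(\<And>i. i \<in> I \<Longrightarrow> lin (f i)) \<Longrightarrow> lin (\<lambda>x. \<Sum>i\<in>I. f i x)"
  by (induction I rule: infinite_finite_induct) (simp_all add: lin_zero lin_plus)

lemma lin_funpow: "lin f \<Longrightarrow> lin (f ^^ k)"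
  by (induction k) (simp_all add: lin_id lin_comp o_def)

lemma lin_image_subspace: assumes f: "lin f" and U: "subspace U" shows "subspace (f ` U)"
proof (rule subspaceI)
  show "0 \<in> f ` U" using subspace_0[OF U] lin_0[OF f] by (metis imageI)
  show "x + y \<in> f ` U" if "x \<in> f ` U" "y \<in> f ` U" for x y
    using that subspace_add[OF U] by (auto simp flip: lin_add[OF f])
  show "scale c x \<in> f ` U" if "x \<in> f ` U" for c x
    using that subspace_scale[OF U] by (auto simp flip: lin_scale[OF f])
qed

lemma subspace_kernel: "lin f \<Longrightarrow> subspace {x. f x = 0}"
  by (intro subspaceI) (simp_all add: lin_0 lin_add lin_scale)

lemma lin_image_span: "lin f \<Longrightarrow> (\<And>x. x \<in> S \<Longrightarrow> f x \<in> U) \<Longrightarrow> subspace U \<Longrightarrow> x \<in> span S \<Longrightarrow> f x \<in> U"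
  by (rotate_tac -1, induction rule: span_induct_alt)
    (auto simp: lin_0 lin_add lin_scale subspace_0 subspace_add subspace_scale)

lemma lin_ext_span: "lin f \<Longrightarrow> lin g \<Longrightarrow> (\<And>x. x \<in> S \<Longrightarrow> f x = g x) \<Longrightarrow> x \<in> span S \<Longrightarrow> f x = g x"
  by (rotate_tac -1, induction rule: span_induct_alt) (auto simp: lin_0 lin_add lin_scale)

lemma lin_extend:
  assumes "independent B"
  obtains f where "lin f" "\<And>b. b \<in> B \<Longrightarrow> f b = g b"
proof -
  interpret p: vector_space_pair scale scale by unfold_locales
  show ?thesis using p.linear_independent_extend[OF assms, of g] that by blast
qed

lemma dim_image_le: "lin f \<Longrightarrow> dim (f ` S) \<le> dim S"
proof -
  interpret p: finite_dimensional_vector_space_pair_1 scale Basis scale by unfold_locales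
  assume "lin f" then show ?thesis by (rule p.dim_image_le)
qed

lemma dim_image_eq: "lin f \<Longrightarrow> inj_on f (span S) \<Longrightarrow> dim (f ` S) = dim S"
proof -
  interpret p: finite_dimensional_vector_space_pair_1 scale Basis scale by unfold_locales
  assume "lin f" "inj_on f (span S)" then show ?thesis by (rule p.dim_image_eq)
qed

lemma lin_kernel_nonzero:
  assumes "lin f" "subspace W" "dim (f ` W) < dim W"
  obtains x where "x \<in> W" "x \<noteq> 0" "f x = 0"
proof -
  have "span W = W" using assms by simp
  then have "\<not> inj_on f W" using dim_image_eq[OF assms(1), of W] assms(3) by (metis less_irrefl)
  then obtain x y where "x \<in> W" "y \<in> W" "x \<noteq> y" "f x = f y" unfolding inj_on_def by blast
  then show ?thesis using that[of "x - y"] assms by (simp add: subspace_diff lin_diff)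
qed

lemma dim_sum_le:
  assumes "finite I" shows "dim (span (\<Union>i\<in>I. U i)) \<le> (\<Sum>i\<in>I. dim (U i))"
  using assms
proof (induction I)
  case (insert i I)
  have ex: "\<exists>B. B \<subseteq> U j \<and> finite B \<and> U j \<subseteq> span B \<and> card B = dim (U j)" for j
    using basis_exists[of "U j"] finiteI_independent by metis
  obtain B where B: "finite B" "U i \<subseteq> span B" "card B = dim (U i)" using ex by blast
  obtain C where C: "finite C" "(\<Union>i\<in>I. U i) \<subseteq> span C" "card C = dim (\<Union>i\<in>I. U i)"
    using basis_exists[of "\<Union>i\<in>I. U i"] finiteI_independent by metis
  have "(\<Union>i\<in>insert i I. U i) \<subseteq> span (B \<union> C)"
    using B(2) C(2) span_mono[of B "B \<union> C"] span_mono[of C "B \<union> C"]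
    unfolding UN_insert by (meson Un_least Un_upper1 Un_upper2 subset_trans)
  then have "dim (\<Union>i\<in>insert i I. U i) \<le> card (B \<union> C)" using B C by (intro dim_le_card) auto
  also have "\<dots> \<le> dim (U i) + dim (\<Union>i\<in>I. U i)" using B C card_Un_le[of B C] by simp
  finally show ?case using insert by simp
qed simp

subsection \<open>Generalized eigenspaces\<close>

definition shift :: "('a \<Rightarrow> 'a) \<Rightarrow> complex \<Rightarrow> 'a \<Rightarrow> 'a"
  where "shift f c x = f x - scale c x"

definition gen_eig :: "('a \<Rightarrow> 'a) \<Rightarrow> complex \<Rightarrow> 'a set"
  where "gen_eig f c = {v. \<exists>k. (shift f c ^^ k) v = 0}"

definition eig :: "('a \<Rightarrow> 'a) \<Rightarrow> complex \<Rightarrow> 'a set"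
  where "eig f c = {v. f v = scale c v}"

lemma lin_shift: "lin f \<Longrightarrow> lin (shift f c)"
  unfolding shift_def by (intro lin_minus lin_scaled lin_id)

lemma shift_pow_zero_mono: "lin f \<Longrightarrow> (shift f c ^^ k) v = 0 \<Longrightarrow> k \<le> l \<Longrightarrow> (shift f c ^^ l) v = 0"
  using funpow_add[of "l - k" k "shift f c"]
  by (metis add.commute comp_apply le_add_diff_inverse lin_0 lin_funpow lin_shift)

lemma eig_subset_gen_eig: "eig f c \<subseteq> gen_eig f c"
  unfolding eig_def gen_eig_def by (auto intro!: exI[of _ 1] simp: shift_def)

lemma subspace_eig: "lin f \<Longrightarrow> subspace (eig f c)"
  unfolding eig_def
  by (intro subspaceI) (simp_all add: lin_0 lin_add lin_scale scale_right_distrib mult.commute)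

lemma subspace_gen_eig: assumes f: "lin f" shows "subspace (gen_eig f c)"
proof (intro subspaceI)
  show "0 \<in> gen_eig f c" by (auto simp: gen_eig_def intro: exI[of _ 0])
next
  fix x y assume "x \<in> gen_eig f c" "y \<in> gen_eig f c"
  then obtain k l where "(shift f c ^^ k) x = 0" "(shift f c ^^ l) y = 0" by (auto simp: gen_eig_def)
  then have "(shift f c ^^ (max k l)) x = 0" "(shift f c ^^ (max k l)) y = 0"
    using shift_pow_zero_mono[OF f] by (meson max.cobounded1 max.cobounded2)+
  then show "x + y \<in> gen_eig f c"
    by (auto simp: gen_eig_def lin_add[OF lin_funpow[OF lin_shift[OF f]]] intro!: exI[of _ "max k l"])
next
  fix x r assume "x \<in> gen_eig f c"
  then show "scale r x \<in> gen_eig f c"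
    by (auto simp: gen_eig_def lin_scale[OF lin_funpow[OF lin_shift[OF f]]])
qed

lemma commute_shift:
  assumes "lin g" "\<And>x. f (g x) = g (f x)" shows "shift f c (g x) = g (shift f c x)"
  using assms by (simp add: shift_def lin_diff lin_scale)

lemma commute_funpow:
  assumes "\<And>x. f (g x) = g (f x)" shows "(f ^^ k) (g x) = g ((f ^^ k) x)"
  by (induction k) (simp_all add: assms)

lemma gen_eig_commute:
  assumes "lin g" "\<And>x. f (g x) = g (f x)" "x \<in> gen_eig f c" shows "g x \<in> gen_eig f c"
proof -
  obtain k where "(shift f c ^^ k) x = 0" using assms by (auto simp: gen_eig_def)
  then have "(shift f c ^^ k) (g x) = 0"
    using commute_funpow[of "shift f c" g k x] commute_shift[of g f, OF assms(1,2)] lin_0[OF assms(1)] by simp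
  then show ?thesis by (auto simp: gen_eig_def)
qed

lemma shift_commute: "lin f \<Longrightarrow> shift f a (shift f c x) = shift f c (shift f a x)"
  by (simp add: shift_def lin_diff lin_scale scale_right_diff_distrib mult.commute)

lemma gen_eig_of_shift: "shift f c v \<in> gen_eig f c \<Longrightarrow> v \<in> gen_eig f c"
proof -
  assume "shift f c v \<in> gen_eig f c"
  then obtain k where "(shift f c ^^ k) (shift f c v) = 0" by (auto simp: gen_eig_def)
  then have "(shift f c ^^ Suc k) v = 0" by (simp add: funpow_swap1)
  then show ?thesis unfolding gen_eig_def by blast
qed

lemma gen_eig_shift: "lin f \<Longrightarrow> u \<in> gen_eig f c \<Longrightarrow> shift f a u \<in> gen_eig f c"
  by (rule gen_eig_commute[OF lin_shift]) (simp_all add: shift_def lin_diff lin_scale)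

text \<open>On \<open>gen_eig f c\<close> the operator \<open>shift f a\<close> is invertible and
  its inverse is a polynomial in \<open>f\<close>, so it keeps \<open>H\<close>. Induction on the
  nilpotency order avoids the inverse: \<open>u\<close> is a multiple of the difference of
  \<open>shift f a u\<close> and \<open>shift f c u\<close>, and the second of these has smaller
  order.\<close>

lemma gen_eig_mem_of_shift_mem:
  assumes f: "lin f" and H: "subspace H" "\<And>x. x \<in> H \<Longrightarrow> f x \<in> H" and "c \<noteq> a"
    and u: "u \<in> gen_eig f c" "shift f a u \<in> H"
  shows "u \<in> H"
proof -
  have shH: "shift f b x \<in> H" if "x \<in> H" for b x
    using H that by (simp add: shift_def subspace_diff subspace_scale)
  have "u \<in> H" if "(shift f c ^^ k) u = 0" "shift f a u \<in> H" for k u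
    using that
  proof (induction k arbitrary: u)
    case 0 then show ?case using H(1) by (simp add: subspace_0)
  next
    case (Suc k)
    have "shift f c u \<in> H"
    proof (rule Suc.IH)
      show "(shift f c ^^ k) (shift f c u) = 0" using Suc.prems by (simp add: funpow_swap1)
      show "shift f a (shift f c u) \<in> H" using shH[OF Suc.prems(2)] shift_commute[OF f] by metis
    qed
    moreover have "u = scale (1 / (c - a)) (shift f a u - shift f c u)"
      using \<open>c \<noteq> a\<close> by (simp add: shift_def scale_left_diff_distrib[symmetric])
    ultimately show ?case using Suc.prems H by (metis subspace_diff subspace_scale)
  qed
  then show ?thesis using u by (auto simp: gen_eig_def)
qed

lemma gen_eig_pow_mem_of:
  assumes f: "lin f" and H: "subspace H" "\<And>x. x \<in> H \<Longrightarrow> f x \<in> H" and "c \<noteq> a"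
    and "u \<in> gen_eig f c" "(shift f a ^^ k) u \<in> H"
  shows "u \<in> H"
  using assms(5,6)
proof (induction k arbitrary: u)
  case (Suc k)
  then have "shift f a u \<in> H" using gen_eig_shift[OF f] by (simp add: funpow_swap1)
  then show ?case using gen_eig_mem_of_shift_mem[OF f H \<open>c \<noteq> a\<close>] Suc.prems by blast
qed simp

text \<open>A power of \<open>shift f a\<close> kills the component for \<open>a\<close> and can be
  undone inside \<open>H\<close> on the other components, so the number of summands drops. With
  \<open>H = {0}\<close> this is the independence of generalized eigenspaces; in general it lets
  invariant subspaces be decomposed degree by degree.\<close>

lemma gen_eig_components_mem:
  assumes f: "lin f" and H: "subspace H" "\<And>x. x \<in> H \<Longrightarrow> f x \<in> H"
    and "finite F" "\<And>c. c \<in> F \<Longrightarrow> v c \<in> gen_eig f c" "(\<Sum>c\<in>F. v c) \<in> H" "c \<in> F"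
  shows "v c \<in> H"
  using assms(4-)
proof (induction F arbitrary: v c)
  case (insert a F)
  obtain k where k: "(shift f a ^^ k) (v a) = 0" using insert.prems(1)[of a] by (auto simp: gen_eig_def)
  note L = lin_funpow[OF lin_shift[OF f], of k a]
  have shH: "(shift f a ^^ k) x \<in> H" if "x \<in> H" for x
    using that by (induction k) (simp_all add: shift_def subspace_diff[OF H(1)] H subspace_scale[OF H(1)])
  have shG: "(shift f a ^^ k) x \<in> gen_eig f c" if "x \<in> gen_eig f c" for c x
    using that by (induction k) (simp_all add: gen_eig_shift[OF f])
  have "(\<Sum>c\<in>F. (shift f a ^^ k) (v c)) = (shift f a ^^ k) (\<Sum>c\<in>insert a F. v c)"
    using insert.hyps k by (simp add: lin_add[OF L] lin_sum[OF L])
  then have *: "(\<Sum>c\<in>F. (shift f a ^^ k) (v c)) \<in> H" using shH insert.prems(2) by simp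
  have vF: "v c \<in> H" if "c \<in> F" for c
  proof (rule gen_eig_pow_mem_of[OF f H])
    show "c \<noteq> a" using that insert.hyps by blast
    show "v c \<in> gen_eig f c" using that insert.prems by blast
    show "(shift f a ^^ k) (v c) \<in> H"
      by (rule insert.IH[of "\<lambda>c. (shift f a ^^ k) (v c)", OF _ * that]) (simp add: shG insert.prems)
  qed
  have "v a = (\<Sum>c\<in>insert a F. v c) - (\<Sum>c\<in>F. v c)" using insert.hyps by simp
  then have "v a \<in> H" using insert.prems(2) vF H(1) by (metis subspace_diff subspace_sum)
  then show ?case using vF insert.prems(3) by blast
qed simp

lemma gen_eig_independent:
  assumes "lin f" "finite F" "\<And>c. c \<in> F \<Longrightarrow> v c \<in> gen_eig f c" "(\<Sum>c\<in>F. v c) = 0" "c \<in> F"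
  shows "v c = 0"
  using gen_eig_components_mem[of f "{0}" F v c] assms by (simp add: lin_0)

section \<open>Spectrum and primary decomposition\<close>

definition spec :: "('a \<Rightarrow> 'a) \<Rightarrow> complex set"
  where "spec f = {c. gen_eig f c \<noteq> {0}}"

text \<open>One nonzero vector is chosen from each generalized eigenspace, and these are
  independent. The uniform bound by \<open>dimension\<close> is what later lets a grading with the
  most components be chosen.\<close>

lemma finite_spec_card_le:
  assumes f: "lin f" shows "finite (spec f) \<and> card (spec f) \<le> dimension"
proof -
  have ex: "\<exists>v. v \<in> gen_eig f c \<and> v \<noteq> 0" if "c \<in> spec f" for c
    using that subspace_0[OF subspace_gen_eig[OF f]] by (auto simp: spec_def)
  then obtain v where v: "v c \<in> gen_eig f c" "v c \<noteq> 0" if "c \<in> spec f" for c by metis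
  have bound: "card F \<le> dimension" if F: "finite F" "F \<subseteq> spec f" for F
  proof -
    have inj: "inj_on v F"
    proof (rule inj_onI, rule ccontr)
      fix a b assume ab: "a \<in> F" "b \<in> F" "v a = v b" "a \<noteq> b"
      have "v a \<in> gen_eig f a" "- v b \<in> gen_eig f b"
        using subspace_neg[OF subspace_gen_eig[OF f] v(1)] v(1) ab F by blast+
      then have "(if c = a then v a else - v b) \<in> gen_eig f c" if "c \<in> {a, b}" for c using that by auto
      then have "(if a = a then v a else - v b) = 0"
        by (intro gen_eig_independent[OF f, of "{a,b}" "\<lambda>c. if c = a then v a else - v b"]) (use ab in auto)
      then show False using ab F v by auto
    qed
    have "independent (v ` F)"
    proof (rule independent_if_scalars_zero)
      fix g x assume g: "(\<Sum>x\<in>v ` F. scale (g x) x) = 0" and x: "x \<in> v ` F"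
      then obtain a where a: "a \<in> F" "x = v a" by blast
      have "(\<Sum>c\<in>F. scale (g (v c)) (v c)) = 0" using g inj by (simp add: sum.reindex)
      then have "scale (g (v a)) (v a) = 0"
        using gen_eig_independent[OF f F(1), of "\<lambda>c. scale (g (v c)) (v c)" a] a F v
          subspace_scale[OF subspace_gen_eig[OF f]] by blast
      then show "g x = 0" using v[of a] a F by auto
    qed (use F in simp)
    then have "card (v ` F) \<le> dimension"
      using independent_card_le_dim[of "v ` F" UNIV] by (simp add: dimension_def)
    then show ?thesis using inj by (simp add: card_image)
  qed
  then have "finite (spec f)" by (meson finite_if_finite_subsets_card_bdd)
  then show ?thesis using bound by blast
qed

lemma finite_spec: "lin f \<Longrightarrow> finite (spec f)"
  using finite_spec_card_le by blast

definition poly_act :: "('a \<Rightarrow> 'a) \<Rightarrow> complex poly \<Rightarrow> 'a \<Rightarrow> 'a"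
  where "poly_act f p x = (\<Sum>i\<le>degree p. scale (coeff p i) ((f ^^ i) x))"

lemma poly_act_altdef: "degree p \<le> n \<Longrightarrow> poly_act f p x = (\<Sum>i\<le>n. scale (coeff p i) ((f ^^ i) x))"
  unfolding poly_act_def by (rule sum.mono_neutral_left) (auto simp: coeff_eq_0)

lemma poly_act_linear_factor:
  assumes f: "lin f" shows "poly_act f ([:-a, 1:] * q) x = shift f a (poly_act f q x)"
proof -
  let ?n = "Suc (degree q)"
  have "degree ([:-a, 1:] * q) \<le> ?n" using degree_mult_le[of "[:-a,1:]" q] by simp
  then have "poly_act f ([:-a, 1:] * q) x = (\<Sum>i\<le>?n. scale (coeff ([:-a, 1:] * q) i) ((f ^^ i) x))"
    by (rule poly_act_altdef)
  also have "\<dots> = (\<Sum>i\<le>?n. scale (coeff (pCons 0 q) i) ((f ^^ i) x)) - scale a (\<Sum>i\<le>?n. scale (coeff q i) ((f ^^ i) x))"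
    by (simp add: scale_sum_right scale_left_diff_distrib sum_subtractf del: sum.atMost_Suc)
  also have "(\<Sum>i\<le>?n. scale (coeff q i) ((f ^^ i) x)) = poly_act f q x"
    by (rule poly_act_altdef[symmetric]) simp
  also have "(\<Sum>i\<le>?n. scale (coeff (pCons 0 q) i) ((f ^^ i) x)) = f (poly_act f q x)"
    unfolding poly_act_def by (subst sum.atMost_Suc_shift) (simp add: lin_sum[OF f] lin_scale[OF f])
  finally show ?thesis by (simp add: shift_def)
qed

lemma ex_annihilating_poly: "\<exists>p. p \<noteq> 0 \<and> poly_act f p x = 0"
proof -
  let ?h = "\<lambda>i. (f ^^ i) x"
  show ?thesis
  \<comment> \<open>Linear dependence is a property of the set of iterates, so a repetition among
    them is a case of its own; it yields the polynomial X^i - X^j.\<close>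
  proof (cases "inj_on ?h {..dimension}")
    case False
    then obtain i j where ij: "i \<noteq> j" "?h i = ?h j" by (auto simp: inj_on_def)
    let ?p = "monom 1 i - monom (1::complex) j"
    have "coeff ?p i = 1" using ij by simp
    then have "?p \<noteq> 0" by (metis coeff_0 zero_neq_one)
    have "degree ?p \<le> max i j" by (intro degree_diff_le) (auto simp: degree_monom_le order.trans[OF degree_monom_le])
    then have "poly_act f ?p x = (\<Sum>k\<le>max i j. scale (coeff ?p k) (?h k))" by (rule poly_act_altdef)
    also have "\<dots> = (\<Sum>k\<le>max i j. (if k = i then ?h i else 0)) - (\<Sum>k\<le>max i j. (if k = j then ?h j else 0))"
      unfolding sum_subtractf[symmetric] by (rule sum.cong) (auto simp: scale_left_diff_distrib)
    also have "\<dots> = 0" using ij by simp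
    finally show ?thesis using \<open>?p \<noteq> 0\<close> by blast
  next
    case True
    have "dependent (?h ` {..dimension})"
    proof (rule ccontr)
      assume "\<not> ?thesis"
      then have "card (?h ` {..dimension}) \<le> dim UNIV" by (intro independent_card_le_dim) auto
      then show False using True by (simp add: card_image dimension_def)
    qed
    then obtain u where u: "\<exists>v\<in>?h ` {..dimension}. u v \<noteq> 0" "(\<Sum>v\<in>?h ` {..dimension}. scale (u v) v) = 0"
      by (auto simp: dependent_finite)
    define p where "p = Poly (map (\<lambda>i. u (?h i)) [0..<Suc dimension])"
    have c: "coeff p i = (if i \<le> dimension then u (?h i) else 0)" for i
      by (auto simp: p_def nth_default_def simp del: upt_Suc)
    have "degree p \<le> dimension" by (rule degree_le) (simp add: c)
    then have "poly_act f p x = (\<Sum>i\<le>dimension. scale (u (?h i)) (?h i))"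
      by (simp add: poly_act_altdef c)
    also have "\<dots> = 0" using u True by (simp add: sum.reindex)
    finally have "poly_act f p x = 0" .
    moreover obtain i where "i \<le> dimension" "u (?h i) \<noteq> 0" using u(1) by blast
    then have "coeff p i \<noteq> 0" by (simp add: c)
    then have "p \<noteq> 0" by auto
    ultimately show ?thesis by blast
  qed
qed

text \<open>With s' = s / (e - a) one has \<open>shift f a\<close> s' = s + \<open>shift f e\<close>
  s', and the error term has smaller nilpotency order. Correcting it recursively is a Neumann series
  that terminates.\<close>

lemma gen_eig_shift_surj:
  assumes f: "lin f" and "e \<noteq> a" and s: "s \<in> gen_eig f e"
  shows "\<exists>w\<in>gen_eig f e. shift f a w = s"
proof -
  have "\<exists>w\<in>gen_eig f e. shift f a w = s" if "(shift f e ^^ k) s = 0" "s \<in> gen_eig f e" for k s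
    using that
  proof (induction k arbitrary: s)
    case 0 then show ?case by (intro bexI[of _ 0]) (simp_all add: lin_0 lin_shift f subspace_0 subspace_gen_eig)
  next
    case (Suc k)
    let ?s = "scale (1 / (e - a)) s"
    have G: "subspace (gen_eig f e)" by (rule subspace_gen_eig[OF f])
    have s': "?s \<in> gen_eig f e" "shift f e ?s \<in> gen_eig f e"
      using Suc.prems G by (simp_all add: subspace_scale gen_eig_shift f)
    have "(shift f e ^^ k) (shift f e ?s) = (shift f e ^^ Suc k) ?s" by (simp add: funpow_swap1)
    also have "\<dots> = scale (1 / (e - a)) ((shift f e ^^ Suc k) s)"
      by (rule lin_scale[OF lin_funpow[OF lin_shift[OF f]]])
    finally have "(shift f e ^^ k) (shift f e ?s) = 0" using Suc.prems by simp
    then obtain w where w: "w \<in> gen_eig f e" "shift f a w = shift f e ?s" using Suc.IH s' by blast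
    have "shift f a (?s - w) = shift f a ?s - shift f e ?s" using w by (simp add: lin_diff[OF lin_shift[OF f]])
    also have "\<dots> = s" using \<open>e \<noteq> a\<close> by (simp add: shift_def scale_left_diff_distrib[symmetric] diff_divide_distrib[symmetric])
    finally show ?case using w s' G subspace_diff by blast
  qed
  then show ?thesis using s unfolding gen_eig_def by blast
qed

text \<open>If the sum U of the generalized eigenspaces is not everything, take x outside U and a
  polynomial p of least degree with p(f) x in U. A root a of p gives p(f) = (f - a) q(f), and since
  \<open>shift f a v\<close> lies in U only if \<open>v\<close> does, q already works.\<close>

lemma span_gen_eig: assumes f: "lin f" shows "span (\<Union>c. gen_eig f c) = UNIV"
proof (rule ccontr)
  let ?U = "span (\<Union>c. gen_eig f c)"
  have key: "v \<in> ?U" if sv: "shift f a v \<in> ?U" for a v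
  proof -
    \<comment> \<open>Modulo \<open>gen_eig f a\<close>, every s in U is hit by
      \<open>shift f a\<close> from U: components for e \<noteq> a are hit exactly, and the
      component for a is discarded.\<close>
    have "\<exists>w\<in>?U. shift f a w - s \<in> gen_eig f a" if "s \<in> ?U" for s
      using that
    proof (induction rule: span_induct_alt)
      case base
      then show ?case by (intro bexI[of _ 0]) (simp_all add: span_zero lin_0[OF lin_shift[OF f]] subspace_0[OF subspace_gen_eig[OF f]])
    next
      case (step r x y)
      then obtain w where w: "w \<in> ?U" "shift f a w - y \<in> gen_eig f a" by blast
      have "\<exists>z\<in>?U. shift f a z - x \<in> gen_eig f a"
      proof -
        obtain e where e: "x \<in> gen_eig f e" using step by blast
        show ?thesis
        proof (cases "e = a")
          case True
          then show ?thesis using e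
            by (intro bexI[of _ 0]) (simp_all add: span_zero lin_0[OF lin_shift[OF f]] subspace_neg[OF subspace_gen_eig[OF f]])
        next
          case False
          then obtain z where "z \<in> gen_eig f e" "shift f a z = x" using gen_eig_shift_surj[OF f False e] by blast
          then show ?thesis
            using subspace_0[OF subspace_gen_eig[OF f], of a] span_base[of z "\<Union>c. gen_eig f c"]
            by (intro bexI[of _ z]) auto
        qed
      qed
      then obtain z where z: "z \<in> ?U" "shift f a z - x \<in> gen_eig f a" by blast
      have "shift f a (scale r z + w) - (scale r x + y) = scale r (shift f a z - x) + (shift f a w - y)"
        by (simp add: lin_add[OF lin_shift[OF f]] lin_scale[OF lin_shift[OF f]] scale_right_diff_distrib)
      also have "\<dots> \<in> gen_eig f a"
        using z w subspace_gen_eig[OF f] by (simp add: subspace_add subspace_scale)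
      finally show ?case using z w by (meson span_add span_scale)
    qed
    then obtain w where w: "w \<in> ?U" "shift f a w - shift f a v \<in> gen_eig f a" using sv by blast
    then have "shift f a (w - v) \<in> gen_eig f a" by (simp add: lin_diff[OF lin_shift[OF f]])
    then have "w - v \<in> gen_eig f a" by (rule gen_eig_of_shift)
    then have "w - v \<in> ?U" by (intro span_base UN_I[of a]) auto
    then have "w - (w - v) \<in> ?U" using w span_diff by blast
    then show ?thesis by simp
  qed
  assume "?U \<noteq> UNIV"
  then obtain x where x: "x \<notin> ?U" by blast
  let ?P = "\<lambda>n. \<exists>p. p \<noteq> 0 \<and> poly_act f p x \<in> ?U \<and> degree p = n"
  have "\<exists>n. ?P n" using ex_annihilating_poly[of f x] span_zero by metis
  then obtain p where p: "p \<noteq> 0" "poly_act f p x \<in> ?U" "\<And>n. n < degree p \<Longrightarrow> \<not> ?P n"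
    using exists_least_iff[of ?P] by auto
  have "degree p \<noteq> 0"
  proof
    assume d: "degree p = 0"
    then have "coeff p 0 \<noteq> 0" using p(1) by (metis leading_coeff_0_iff)
    moreover have "scale (coeff p 0) x \<in> ?U" using p(2) d by (simp add: poly_act_def)
    ultimately have "scale (1 / coeff p 0) (scale (coeff p 0) x) \<in> ?U" using span_scale by blast
    then show False using x \<open>coeff p 0 \<noteq> 0\<close> by simp
  qed
  then obtain a where "poly p a = 0"
    using fundamental_theorem_of_algebra[of p] by (auto simp: constant_degree)
  then obtain q where q: "p = [:-a, 1:] * q" by (metis poly_eq_0_iff_dvd dvdE)
  then have "q \<noteq> 0" using p(1) by auto
  moreover have "degree q < degree p" using q \<open>q \<noteq> 0\<close> by (simp add: degree_mult_eq del: mult_pCons_left)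
  moreover have "poly_act f q x \<in> ?U" using key[of a "poly_act f q x"] p(2) q poly_act_linear_factor[OF f] by simp
  ultimately show False using p(3) by blast
qed

lemma ex_gen_eig_decomp: assumes f: "lin f"
  shows "\<exists>v. (\<forall>c. v c \<in> gen_eig f c) \<and> x = (\<Sum>c\<in>spec f. v c)"
proof -
  have "x \<in> span (\<Union>c. gen_eig f c)" by (simp add: span_gen_eig[OF f])
  then show ?thesis
  proof (induction rule: span_induct_alt)
    case base then show ?case by (intro exI[of _ "\<lambda>_. 0"]) (simp add: subspace_0 subspace_gen_eig f)
  next
    case (step r x y)
    then obtain v where v: "\<And>c. v c \<in> gen_eig f c" "y = (\<Sum>c\<in>spec f. v c)" by blast
    obtain e where e: "x \<in> gen_eig f e" using step by blast
    let ?v = "\<lambda>c. scale r (if c = e then x else 0) + v c"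
    have "?v c \<in> gen_eig f c" for c
      using v e by (auto intro!: subspace_add subspace_scale subspace_gen_eig f)
    moreover have "(\<Sum>c\<in>spec f. (if c = e then x else 0)) = x"
      using e finite_spec[OF f] by (auto simp: spec_def)
    then have "scale r x + y = (\<Sum>c\<in>spec f. ?v c)"
      by (simp only: sum.distrib scale_sum_right[symmetric] v(2))
    ultimately show ?case by (intro exI[of _ ?v]) blast
  qed
qed

text \<open>The choice is made for the whole family \<open>v\<close>, independently of
  \<open>c\<close>, so the components for different \<open>c\<close> add up to \<open>x\<close>.
  Uniqueness of the components makes the result linear, and off \<open>spec f\<close> it is
  0.\<close>

definition gproj :: "('a \<Rightarrow> 'a) \<Rightarrow> complex \<Rightarrow> 'a \<Rightarrow> 'a"
  where "gproj f c x = (SOME v. (\<forall>c. v c \<in> gen_eig f c) \<and> x = (\<Sum>c\<in>spec f. v c)) c"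

lemma gproj_mem: "lin f \<Longrightarrow> gproj f c x \<in> gen_eig f c"
  and sum_gproj: "lin f \<Longrightarrow> (\<Sum>c\<in>spec f. gproj f c x) = x"
  using someI_ex[OF ex_gen_eig_decomp[of f x]] by (simp_all add: gproj_def)

lemma gproj_outside: "lin f \<Longrightarrow> c \<notin> spec f \<Longrightarrow> gproj f c x = 0"
  using gproj_mem[of f c x] by (simp add: spec_def)

lemma gproj_unique:
  assumes f: "lin f" and v: "\<And>c. v c \<in> gen_eig f c" "x = (\<Sum>c\<in>spec f. v c)"
  shows "gproj f c x = v c"
proof (cases "c \<in> spec f")
  case True
  have "gproj f c x - v c = 0"
    by (rule gen_eig_independent[OF f finite_spec[OF f], of "\<lambda>c. gproj f c x - v c" c])
      (use v True in \<open>simp_all add: sum_subtractf sum_gproj[OF f] subspace_diff subspace_gen_eig[OF f] gproj_mem[OF f]\<close>)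
  then show ?thesis by simp
next
  case False
  then show ?thesis using v(1)[of c] gproj_mem[OF f, of c x] by (simp add: spec_def)
qed

lemma lin_gproj: assumes f: "lin f" shows "lin (gproj f c)"
proof (rule linI)
  show "gproj f c (x + y) = gproj f c x + gproj f c y" for x y
    by (rule gproj_unique[OF f])
      (simp_all add: sum.distrib sum_gproj[OF f] subspace_add subspace_gen_eig[OF f] gproj_mem[OF f])
  show "gproj f c (scale r x) = scale r (gproj f c x)" for r x
    by (rule gproj_unique[OF f])
      (simp_all add: scale_sum_right[symmetric] sum_gproj[OF f] subspace_scale subspace_gen_eig[OF f] gproj_mem[OF f])
qed

lemma gproj_gen_eig: assumes f: "lin f" and x: "x \<in> gen_eig f d"
  shows "gproj f c x = (if c = d then x else 0)"
proof (rule gproj_unique[OF f])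
  show "x = (\<Sum>c\<in>spec f. if c = d then x else 0)" using x finite_spec[OF f] by (auto simp: spec_def)
qed (use x in \<open>auto simp: subspace_0 subspace_gen_eig[OF f]\<close>)

lemma gproj_invariant:
  assumes f: "lin f" and H: "subspace H" "\<And>x. x \<in> H \<Longrightarrow> f x \<in> H" and "x \<in> H"
  shows "gproj f c x \<in> H"
proof (cases "c \<in> spec f")
  case True
  show ?thesis
    by (rule gen_eig_components_mem[OF f H finite_spec[OF f], of "\<lambda>c. gproj f c x"])
      (use True assms in \<open>simp_all add: gproj_mem sum_gproj\<close>)
qed (simp add: gproj_outside f subspace_0 H)

lemma gproj_commute:
  assumes f: "lin f" and g: "lin g" "\<And>x. f (g x) = g (f x)"
  shows "gproj f c (g x) = g (gproj f c x)"
proof (rule gproj_unique[OF f])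
  show "g (gproj f c x) \<in> gen_eig f c" for c by (rule gen_eig_commute[OF g gproj_mem[OF f]])
  have "g x = g (\<Sum>c\<in>spec f. gproj f c x)" by (simp add: sum_gproj[OF f])
  then show "g x = (\<Sum>c\<in>spec f. g (gproj f c x))" by (simp only: lin_sum[OF g(1)])
qed

lemma gproj_idem: "lin f \<Longrightarrow> gproj f c (gproj f d x) = (if c = d then gproj f d x else 0)"
  by (simp add: gproj_gen_eig gproj_mem)

text \<open>\<open>shift f c\<close> composed with \<open>gproj f c\<close> kills every eigenvector,
  hence a spanning set. Working with a spanning set allows eigenvectors that come as a union of
  joint eigenspaces instead of a basis.\<close>

lemma diagonalizable_gen_eig:
  assumes f: "lin f" and B: "span B = UNIV" "\<And>b. b \<in> B \<Longrightarrow> \<exists>c. f b = scale c b"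
  shows "gen_eig f c = eig f c"
proof
  have L: "lin (\<lambda>x. shift f c (gproj f c x))" by (rule lin_comp[OF lin_shift[OF f] lin_gproj[OF f]])
  have "shift f c (gproj f c x) = 0" for x
  proof (rule lin_ext_span[OF L lin_zero, of B])
    fix b assume "b \<in> B"
    then obtain d where d: "f b = scale d b" using B by blast
    then have "b \<in> gen_eig f d" using eig_subset_gen_eig by (auto simp: eig_def)
    then show "shift f c (gproj f c b) = 0"
      using d by (auto simp: gproj_gen_eig[OF f] shift_def lin_0[OF f])
  qed (simp add: B)
  then have "shift f c x = 0" if "x \<in> gen_eig f c" for x
    using that gproj_gen_eig[OF f that, of c] by metis
  then show "gen_eig f c \<subseteq> eig f c" by (auto simp: eig_def shift_def)
qed (rule eig_subset_gen_eig)

lemma gen_eig_nilpotent_uniform: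
  assumes f: "lin f" shows "\<exists>k. \<forall>x\<in>gen_eig f c. (shift f c ^^ k) x = 0"
proof -
  have "\<forall>b. \<exists>k. (shift f c ^^ k) (gproj f c b) = 0" using gproj_mem[OF f] by (auto simp: gen_eig_def)
  then obtain k where k: "\<And>b. (shift f c ^^ k b) (gproj f c b) = 0" by metis
  define K where "K = Max (k ` Basis)"
  have L: "lin (\<lambda>x. (shift f c ^^ K) (gproj f c x))"
    by (rule lin_comp[OF lin_funpow[OF lin_shift[OF f]] lin_gproj[OF f]])
  have "(shift f c ^^ K) (gproj f c x) = 0" for x
  proof (rule lin_ext_span[OF L lin_zero, of Basis])
    fix b assume "b \<in> Basis"
    then have "k b \<le> K" unfolding K_def by (simp add: finite_Basis)
    then show "(shift f c ^^ K) (gproj f c b) = 0" using shift_pow_zero_mono[OF f k] by blast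
  qed (simp add: span_Basis)
  then have "(shift f c ^^ K) x = 0" if "x \<in> gen_eig f c" for x
    using gproj_gen_eig[OF f that, of c] by metis
  then show ?thesis by blast
qed

subsection \<open>The trace\<close>

definition tr :: "('a \<Rightarrow> 'a) \<Rightarrow> complex"
  where "tr f = (\<Sum>b\<in>Basis. representation Basis (f b) b)"

lemma rep_sum:
  assumes "independent C" "span C = UNIV"
  shows "representation C (\<Sum>b\<in>A. scale (s b) (v b)) c = (\<Sum>b\<in>A. s b * representation C (v b) c)"
  using assms by (simp add: representation_sum representation_scale)

lemma rep_expand: "independent C \<Longrightarrow> span C = UNIV \<Longrightarrow> (\<Sum>c\<in>C. scale (representation C x c) c) = x"
  by (rule sum_representation_eq) (simp_all add: finiteI_independent)

lemma rep_map:
  assumes "lin f" "independent C" "span C = UNIV" "independent D" "span D = UNIV"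
  shows "representation D (f x) d = (\<Sum>c\<in>C. representation C x c * representation D (f c) d)"
proof -
  have "f x = f (\<Sum>c\<in>C. scale (representation C x c) c)" using assms by (simp add: rep_expand)
  also have "\<dots> = (\<Sum>c\<in>C. scale (representation C x c) (f c))" using assms by (simp add: lin_sum lin_scale)
  finally show ?thesis using rep_sum[OF assms(4,5)] by simp
qed

lemma tr_basis:
  assumes f: "lin f" and C: "independent C" "span C = UNIV"
  shows "tr f = (\<Sum>c\<in>C. representation C (f c) c)"
proof -
  note B = independent_Basis span_Basis
  have "tr f = (\<Sum>b\<in>Basis. \<Sum>c\<in>C. representation C b c * representation Basis (f c) b)"
    unfolding tr_def by (intro sum.cong refl rep_map[OF f C B])
  also have "\<dots> = (\<Sum>c\<in>C. \<Sum>b\<in>Basis. representation Basis (f c) b * representation C b c)"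
    by (subst sum.swap) (simp add: mult.commute)
  also have "\<dots> = (\<Sum>c\<in>C. representation C (f c) c)"
    by (intro sum.cong refl) (simp only: rep_map[OF lin_id(1) B C, symmetric])
  finally show ?thesis .
qed

lemma tr_commute:
  assumes "lin f" "lin g" shows "tr (\<lambda>x. f (g x)) = tr (\<lambda>x. g (f x))"
proof -
  note B = independent_Basis span_Basis
  have *: "tr (\<lambda>x. f (g x)) = (\<Sum>b\<in>Basis. \<Sum>c\<in>Basis. representation Basis (g b) c * representation Basis (f c) b)"
    if "lin f" for f g
    unfolding tr_def by (intro sum.cong refl rep_map[OF that B B])
  show ?thesis unfolding *[OF assms(1)] *[OF assms(2)]
    by (subst sum.swap) (simp add: mult.commute)
qed

lemma tr_plus: "tr (\<lambda>x. f x + g x) = tr f + tr g"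
  by (simp add: tr_def representation_add independent_Basis span_Basis sum.distrib)

lemma tr_scaled: "tr (\<lambda>x. scale c (f x)) = c * tr f"
  by (simp add: tr_def representation_scale independent_Basis span_Basis sum_distrib_left)

lemma tr_minus: "tr (\<lambda>x. f x - g x) = tr f - tr g"
  by (simp add: tr_def representation_diff independent_Basis span_Basis sum_subtractf)

lemma tr_zero: "tr (\<lambda>x. 0) = 0"
  by (simp add: tr_def representation_zero)

lemma tr_setsum: "tr (\<lambda>x. \<Sum>i\<in>I. f i x) = (\<Sum>i\<in>I. tr (f i))"
  by (induction I rule: infinite_finite_induct) (simp_all add: tr_zero tr_plus)

text \<open>A basis is grown along the kernels of the powers of \<open>f\<close>. Since
  \<open>f\<close> maps each kernel into the previous one, the image of a basis vector has no
  coordinate along that vector.\<close>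

lemma tr_nilpotent:
  assumes f: "lin f" and nil: "\<And>x. (f ^^ k) x = 0"
  shows "tr f = 0"
proof -
  have "\<exists>C. independent C \<and> span C = {x. (f ^^ i) x = 0} \<and> (\<forall>c\<in>C. representation C (f c) c = 0)" for i
  proof (induction i)
    case 0 show ?case by (intro exI[of _ "{}"]) (auto simp: independent_empty)
  next
    case (Suc i)
    then obtain C where C: "independent C" "span C = {x. (f ^^ i) x = 0}"
      "\<And>c. c \<in> C \<Longrightarrow> representation C (f c) c = 0" by blast
    let ?K = "{x. (f ^^ Suc i) x = 0}"
    have sub: "span C \<subseteq> ?K" by (auto simp: C(2) lin_0[OF f])
    then have "C \<subseteq> ?K" using span_superset by blast
    then obtain D where D: "C \<subseteq> D" "D \<subseteq> ?K" "independent D" "?K \<subseteq> span D"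
      using maximal_independent_subset_extend[OF _ C(1)] by metis
    have sD: "span D = ?K"
      using D(4) span_minimal[OF D(2) subspace_kernel[OF lin_funpow[OF f]]] by blast
    have "representation D (f d) d = 0" if "d \<in> D" for d
    proof -
      have "(f ^^ i) (f d) = 0" using that D by (auto simp: funpow_swap1)
      then have fd: "f d \<in> span C" by (simp add: C(2))
      then have "representation D (f d) = representation C (f d)"
        using representation_extend[OF D(3) _ D(1)] by blast
      \<comment> \<open>For an old \<open>d\<close> this is the invariant on \<open>C\<close>; a new
        \<open>d\<close> lies outside \<open>C\<close> and so has no coordinate there.\<close>
      then show ?thesis using C(3) representation_ne_zero[of C "f d" d] by metis
    qed
    then show ?case using D(3) sD by blast
  qed
  then obtain C where "independent C" "span C = {x. (f ^^ k) x = 0}" "\<forall>c\<in>C. representation C (f c) c = 0"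
    by blast
  then show ?thesis using tr_basis[OF f, of C] nil by simp
qed

lemma tr_projection:
  assumes p: "lin p" and idem: "\<And>x. p (p x) = p x"
  shows "tr p = of_nat (dim (range p))"
proof -
  have sub: "subspace (range p)" by (rule lin_image_subspace[OF p subspace_UNIV])
  obtain C where C: "C \<subseteq> range p" "independent C" "range p \<subseteq> span C" "card C = dim (range p)"
    using basis_exists by blast
  have sC: "span C = range p" using C span_minimal[OF C(1) sub] by blast
  obtain D where D: "C \<subseteq> D" "independent D" "UNIV \<subseteq> span D"
    using maximal_independent_subset_extend[OF subset_UNIV C(2)] by metis
  have "representation D (p d) d = (if d \<in> C then 1 else 0)" if "d \<in> D" for d
  proof (cases "d \<in> C")
    case True
    then have "p d = d" using C idem by auto
    then show ?thesis using True that D by (simp add: representation_basis)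
  next
    case False
    have "representation D (p d) = representation C (p d)"
      by (rule representation_extend[OF D(2) _ D(1)]) (use sC in auto)
    then show ?thesis using False representation_ne_zero[of C "p d" d] by auto
  qed
  then have "tr p = (\<Sum>d\<in>D. if d \<in> C then 1 else 0)"
    using tr_basis[OF p D(2)] D(3) by (simp add: top.extremum_unique)
  also have "\<dots> = of_nat (card C)"
    using D finiteI_independent[of D] by (simp add: sum.If_cases Int_absorb1)
  finally show ?thesis using C by simp
qed

text \<open>On the image of the commuting projection \<open>p\<close> the map \<open>f\<close> is
  \<open>c\<close> plus a nilpotent map, and the latter has trace 0. This turns traces over graded
  components into eigenvalue times dimension.\<close>

lemma tr_single_eigenvalue:
  assumes f: "lin f" and p: "lin p" "\<And>x. p (p x) = p x" "\<And>x. f (p x) = p (f x)"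
    and nil: "\<And>x. (shift f c ^^ k) (p x) = 0"
  shows "tr (\<lambda>x. f (p x)) = c * of_nat (dim (range p))"
proof -
  let ?g = "\<lambda>x. shift f c (p x)"
  \<comment> \<open>For exponent 0 the left side would be \<open>x\<close> and not
    \<open>p x\<close>; hence \<open>Suc\<close> here and the exponent \<open>Suc k\<close>
    below.\<close>
  have "(?g ^^ Suc j) x = (shift f c ^^ Suc j) (p x)" for j x
  proof (induction j)
    case (Suc j)
    have "(?g ^^ Suc (Suc j)) x = shift f c (p ((shift f c ^^ Suc j) (p x)))" using Suc by simp
    also have "p ((shift f c ^^ Suc j) (p x)) = (shift f c ^^ Suc j) (p (p x))"
      using commute_funpow[of "shift f c" p "Suc j" "p x", OF commute_shift[of p f, OF p(1,3)]] by simp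
    finally show ?case by (simp add: p(2))
  qed simp
  then have "(?g ^^ Suc k) x = 0" for x
    using nil[of x] lin_0[OF lin_shift[OF f]] by simp
  then have "tr ?g = 0" by (intro tr_nilpotent[of _ "Suc k"] lin_comp[OF lin_shift[OF f] p(1)])
  moreover have "tr ?g = tr (\<lambda>x. f (p x)) - c * tr p"
    unfolding shift_def by (simp add: tr_minus tr_scaled)
  ultimately show ?thesis using tr_projection[OF p(1,2)] by simp
qed

end

text \<open>Pairs (l, c) of an eigenvalue of an automorphism and one of a derivation commuting with
  it are to become distinct eigenvalues l exp(t c) of a single automorphism. For small t > 0
  different l stay apart by continuity, and equal l stay apart because t (c - c') is shorter than
  the period of exp. Finitely many pairs leave a common t.\<close>

lemma ex_separating_exponent:
  fixes X :: "(complex \<times> complex) set"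
  assumes "finite X" and nz: "\<And>p. p \<in> X \<Longrightarrow> fst p \<noteq> 0"
  shows "\<exists>t::complex. inj_on (\<lambda>p. fst p * exp (t * snd p)) X"
proof -
  let ?P = "\<lambda>p q (t::real). fst p * exp (of_real t * snd p) \<noteq> fst q * exp (of_real t * snd q)"
  have "eventually (?P p q) (at_right 0)" if pq: "p \<in> X" "q \<in> X" "p \<noteq> q" for p q
  proof (cases "fst p = fst q")
    case False
    have "((\<lambda>t::real. fst p * exp (of_real t * snd p) - fst q * exp (of_real t * snd q)) \<longlongrightarrow>
        fst p * exp (of_real 0 * snd p) - fst q * exp (of_real 0 * snd q)) (at_right 0)"
      by (intro tendsto_intros)
    moreover have "fst p * exp (of_real 0 * snd p) - fst q * exp (of_real 0 * snd q) \<noteq> 0" using False by simp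
    ultimately have "eventually (\<lambda>t::real. fst p * exp (of_real t * snd p) - fst q * exp (of_real t * snd q) \<noteq> 0) (at_right 0)"
      by (rule tendsto_imp_eventually_ne)
    then show ?thesis by simp
  next
    case True
    let ?d = "snd p - snd q"
    have "?d \<noteq> 0" using True pq by (simp add: prod_eq_iff)
    then have "0 < 2 * pi / norm ?d" by simp
    then have "eventually (\<lambda>t::real. t \<in> {0<..<2 * pi / norm ?d}) (at_right 0)"
      by (rule eventually_at_right_real)
    then show ?thesis
    proof (rule eventually_mono)
      fix t :: real assume t: "t \<in> {0<..<2 * pi / norm ?d}"
      show "?P p q t"
      proof
        assume "fst p * exp (of_real t * snd p) = fst q * exp (of_real t * snd q)"
        then have "exp (of_real t * snd p) = exp (of_real t * snd q)" using True nz[OF pq(2)] by simp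
        then obtain n :: int where n: "of_real t * snd p = of_real t * snd q + (of_int (2 * n) * pi) * \<i>"
          by (auto simp: exp_eq)
        then have e: "of_real t * ?d = (of_int (2 * n) * pi) * \<i>" by (simp add: algebra_simps)
        have "norm (of_real t * ?d) = t * norm ?d" using t by (simp add: norm_mult)
        moreover have "norm ((of_int (2 * n) * of_real pi) * \<i> :: complex) = 2 * pi * real_of_int \<bar>n\<bar>"
          by (simp add: norm_mult)
        ultimately have *: "t * norm ?d = 2 * pi * real_of_int \<bar>n\<bar>" using e by simp
        have "n \<noteq> 0" using e t \<open>?d \<noteq> 0\<close> by auto
        then have "1 \<le> real_of_int \<bar>n\<bar>" by linarith
        then have "2 * pi * 1 \<le> 2 * pi * real_of_int \<bar>n\<bar>" by (intro mult_left_mono) auto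
        moreover have "t * norm ?d < 2 * pi" using t \<open>?d \<noteq> 0\<close> by (simp add: field_simps)
        ultimately show False using * by simp
      qed
    qed
  qed
  then have "eventually (\<lambda>t. \<forall>p\<in>X. \<forall>q\<in>X. p \<noteq> q \<longrightarrow> ?P p q t) (at_right 0)"
    using assms(1) by (auto simp: eventually_ball_finite_distrib)
  then obtain t where "\<forall>p\<in>X. \<forall>q\<in>X. p \<noteq> q \<longrightarrow> ?P p q t"
    using eventually_happens'[OF trivial_limit_at_right_real[of 0, unfolded trivial_limit_def[symmetric]]] by blast
  then show ?thesis by (intro exI[of _ "of_real t"]) (auto simp: inj_on_def)
qed

section \<open>Brackets, ideals and derived series\<close>

locale fd_lie_algebra = lie_algebra scale bracket + complex_fd_space scale Basis
  for scale :: "complex \<Rightarrow> 'a::ab_group_add \<Rightarrow> 'a" and bracket :: "'a \<Rightarrow> 'a \<Rightarrow> 'a" and Basis :: "'a set"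
begin

lemma lin_ad: "lin (bracket x)"
  by (rule linI) (simp_all add: bracket_add_right bracket_scale_right)

lemma lin_ad_right: "lin (\<lambda>x. bracket x y)"
  by (rule linI) (simp_all add: bracket_add_left bracket_scale_left)

lemma ad_bracket: "bracket (bracket x y) v = bracket x (bracket y v) - bracket y (bracket x v)"
proof -
  have "bracket (bracket x y) v = - bracket v (bracket x y)" by (rule bracket_antisym)
  moreover have "bracket y (bracket v x) = - bracket y (bracket x v)"
    using lin_scale[OF lin_ad, of y "-1" "bracket x v"] bracket_antisym[of v x] by simp
  moreover have "bracket x (bracket y v) + bracket y (bracket v x) = - bracket v (bracket x y)"
    using jacobi[of x y v] by (simp only: eq_neg_iff_add_eq_0)
  ultimately show ?thesis by simp
qed

lemma ad_derivation: "bracket h (bracket x y) = bracket (bracket h x) y + bracket x (bracket h y)"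
  by (simp add: ad_bracket)

lemma bracket_span_mem: "x \<in> A \<Longrightarrow> y \<in> B \<Longrightarrow> bracket x y \<in> bracket_span A B"
  unfolding bracket_span_def by (intro span_base) blast

lemma subspace_bracket_span: "subspace (bracket_span A B)"
  by (simp add: bracket_span_def)

lemma bracket_span_le:
  "subspace U \<Longrightarrow> (\<And>x y. x \<in> A \<Longrightarrow> y \<in> B \<Longrightarrow> bracket x y \<in> U) \<Longrightarrow> bracket_span A B \<subseteq> U"
  unfolding bracket_span_def by (intro span_minimal) auto

lemma automorphism_lin: "automorphism f \<Longrightarrow> lin f"
  and automorphism_bracket: "automorphism f \<Longrightarrow> f (bracket x y) = bracket (f x) (f y)"
  and automorphism_bij: "automorphism f \<Longrightarrow> bij f"
  by (simp_all add: automorphism_def)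

lemma ideal_subspace: "ideal I \<Longrightarrow> subspace I"
  by (simp add: ideal_def)

lemma ideal_bracket_right: "ideal I \<Longrightarrow> y \<in> I \<Longrightarrow> bracket x y \<in> I"
  by (simp add: ideal_def)

lemma ideal_bracket_span:
  assumes "ideal I" "ideal J" shows "ideal (bracket_span I J)"
  unfolding ideal_def
proof (intro conjI allI ballI)
  show "subspace (bracket_span I J)" by (rule subspace_bracket_span)
  fix x y assume "y \<in> bracket_span I J"
  then show "bracket x y \<in> bracket_span I J"
    unfolding bracket_span_def
  proof (induction rule: span_induct_alt)
    case (step c u v)
    then obtain a b where ab: "a \<in> I" "b \<in> J" "u = bracket a b" by blast
    have "bracket x u \<in> bracket_span I J"
      unfolding ab(3) ad_derivation[of x a b]
      using ab assms by (intro subspace_add[OF subspace_bracket_span] bracket_span_mem) (simp_all add: ideal_bracket_right)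
    then show ?case using step
      by (simp add: bracket_add_right bracket_scale_right bracket_span_def span_add span_scale)
  qed (simp add: bracket_zero_right span_zero)
qed

lemma ideal_derived_series: "ideal I \<Longrightarrow> ideal (derived_series I k)"
  by (induction k) (simp_all add: ideal_bracket_span)

lemma bracket_span_self_le: "ideal I \<Longrightarrow> bracket_span I I \<subseteq> I"
  by (intro bracket_span_le ideal_subspace) (simp_all add: ideal_bracket_right)

lemma derived_series_antimono:
  assumes "subspace A" "\<And>x y. x \<in> A \<Longrightarrow> y \<in> A \<Longrightarrow> bracket x y \<in> A" "i \<le> j"
  shows "derived_series A j \<subseteq> derived_series A i"
proof -
  have closed: "derived_series A (Suc k) \<subseteq> derived_series A k" for k
  proof (induction k)
    case 0 then show ?case using assms(1,2) by (simp add: bracket_span_le)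
  next
    case (Suc k) then show ?case using bracket_span_mono[OF Suc Suc] by simp
  qed
  show ?thesis using assms(3) by (induction rule: dec_induct) (use closed in blast)+
qed

lemma image_bracket_span_le:
  assumes "lin f" "\<And>x y. x \<in> A \<Longrightarrow> y \<in> B \<Longrightarrow> f (bracket x y) \<in> U" "subspace U" "x \<in> bracket_span A B"
  shows "f x \<in> U"
proof (rule lin_image_span[OF assms(1)])
  show "x \<in> span {bracket a b |a b. a \<in> A \<and> b \<in> B}" using assms(4) by (simp add: bracket_span_def)
qed (use assms in auto)

lemma automorphism_bracket_span:
  assumes "automorphism f" "\<And>x. x \<in> A \<Longrightarrow> f x \<in> A" "\<And>x. x \<in> B \<Longrightarrow> f x \<in> B" "x \<in> bracket_span A B"
  shows "f x \<in> bracket_span A B"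
  using image_bracket_span_le[OF automorphism_lin[OF assms(1)] _ subspace_bracket_span assms(4)]
  by (simp add: automorphism_bracket[OF assms(1)] bracket_span_mem assms(2,3))

lemma automorphism_derived_series:
  assumes "automorphism f" "\<And>x. x \<in> A \<Longrightarrow> f x \<in> A"
  shows "x \<in> derived_series A k \<Longrightarrow> f x \<in> derived_series A k"
  by (induction k arbitrary: x) (auto intro: assms(2) automorphism_bracket_span[OF assms(1)])

lemma shift_ad_bracket:
  "shift (bracket h) (c + d) (bracket x y) = bracket (shift (bracket h) c x) y + bracket x (shift (bracket h) d y)"
  by (simp add: shift_def ad_derivation[of h x y] scale_left_distrib lin_diff[OF lin_ad] lin_diff[OF lin_ad_right]
      bracket_scale_left bracket_scale_right)

text \<open>The shift by c + d obeys the Leibniz rule, and in each of the two resulting terms one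
  nilpotency order is lowered; hence induction on the sum of the orders. So the generalized
  eigenspaces of \<open>bracket h\<close> grade the algebra additively.\<close>

lemma gen_eig_ad_bracket:
  assumes "x \<in> gen_eig (bracket h) c" "y \<in> gen_eig (bracket h) d"
  shows "bracket x y \<in> gen_eig (bracket h) (c + d)"
proof -
  note G = subspace_gen_eig[OF lin_ad, of h]
  have "bracket x y \<in> gen_eig (bracket h) (c + d)"
    if "(shift (bracket h) c ^^ k) x = 0" "(shift (bracket h) d ^^ l) y = 0" for k l x y
    using that
  proof (induction "k + l" arbitrary: k l x y)
    case 0 then show ?case by (simp add: bracket_zero_left subspace_0[OF G])
  next
    case (Suc n)
    show ?case
    proof (cases "k = 0 \<or> l = 0")
      case True
      then show ?thesis using Suc.prems by (auto simp: bracket_zero_left bracket_zero_right subspace_0[OF G])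
    next
      case False
      then obtain k' l' where kl: "k = Suc k'" "l = Suc l'" by (metis not0_implies_Suc)
      have "bracket (shift (bracket h) c x) y \<in> gen_eig (bracket h) (c + d)"
        using Suc.hyps(1)[of k' l] Suc.hyps(2) Suc.prems kl by (simp add: funpow_swap1)
      moreover have "bracket x (shift (bracket h) d y) \<in> gen_eig (bracket h) (c + d)"
        using Suc.hyps(1)[of k l'] Suc.hyps(2) Suc.prems kl by (simp add: funpow_swap1)
      ultimately have "shift (bracket h) (c + d) (bracket x y) \<in> gen_eig (bracket h) (c + d)"
        unfolding shift_ad_bracket using subspace_add[OF G] by blast
      then show ?thesis by (rule gen_eig_of_shift)
    qed
  qed
  then show ?thesis using assms unfolding gen_eig_def by blast
qed

subsection \<open>Gradings by diagonalizable automorphisms\<close>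

text \<open>Diagonalizability is expressed as equality of generalized and ordinary eigenspaces, so
  that no eigenbasis has to be carried along.\<close>

definition diag_aut :: "('a \<Rightarrow> 'a) \<Rightarrow> bool"
  where "diag_aut f \<longleftrightarrow> automorphism f \<and> (\<forall>c. gen_eig f c = eig f c)"

lemma diag_autD:
  assumes "diag_aut f"
  shows "automorphism f" "lin f" "gen_eig f c = eig f c"
  using assms by (simp_all add: diag_aut_def automorphism_lin)

lemma diag_aut_diagonalizable: "automorphism f \<Longrightarrow> diagonalizable f \<Longrightarrow> diag_aut f"
  unfolding diag_aut_def diagonalizable_def
  using diagonalizable_gen_eig[OF automorphism_lin] by blast

lemma diag_aut_id: "diag_aut id"
proof (intro diag_aut_diagonalizable)
  show "automorphism id" by (simp add: automorphism_def lin_id)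
  show "diagonalizable id" unfolding diagonalizable_def
    using independent_Basis span_Basis by (intro exI[of _ Basis]) (auto intro: exI[of _ 1])
qed

lemma eig_bracket: "automorphism f \<Longrightarrow> x \<in> eig f u \<Longrightarrow> y \<in> eig f v \<Longrightarrow> bracket x y \<in> eig f (u * v)"
  by (simp add: eig_def automorphism_bracket bracket_scale_left bracket_scale_right mult.commute)

lemma eig_proj:
  assumes "diag_aut f"
  shows "gproj f c x \<in> eig f c" "x \<in> eig f d \<Longrightarrow> gproj f c x = (if c = d then x else 0)"
    "(\<Sum>c\<in>spec f. gproj f c x) = x"
  using gproj_mem[of f c x] gproj_gen_eig[of f x d c] sum_gproj[of f x] diag_autD[OF assms] by simp_all

lemma spec_eq: "diag_aut f \<Longrightarrow> spec f = {c. eig f c \<noteq> {0}}"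
  by (simp add: spec_def diag_autD)

lemma eigenvalues_eq_spec: "diag_aut f \<Longrightarrow> eigenvalues f = spec f"
  using subspace_0[OF subspace_eig[of f]] by (auto simp: spec_eq eigenvalues_def eig_def diag_autD)

lemma eig_0: "automorphism f \<Longrightarrow> eig f 0 = {0}"
  using bij_is_inj[OF automorphism_bij[of f]] lin_0[OF automorphism_lin[of f]]
  by (auto simp: eig_def inj_def)

lemma spec_nonzero: "diag_aut f \<Longrightarrow> c \<in> spec f \<Longrightarrow> c \<noteq> 0"
  using eig_0[of f] by (auto simp: spec_eq diag_autD)

lemma mem_spec: "diag_aut f \<Longrightarrow> x \<in> eig f c \<Longrightarrow> x \<noteq> 0 \<Longrightarrow> c \<in> spec f"
  by (auto simp: spec_eq)

lemma eig_disjoint: "diag_aut f \<Longrightarrow> x \<in> eig f c \<Longrightarrow> x \<in> eig f d \<Longrightarrow> c \<noteq> d \<Longrightarrow> x = 0"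
  using scale_right_imp_eq[of x c d] by (auto simp: eig_def)

lemma ad_commute_fixed: "automorphism f \<Longrightarrow> f h = h \<Longrightarrow> f (bracket h x) = bracket h (f x)"
  by (simp add: automorphism_bracket)

text \<open>The automorphism exp(t s), with s the semisimple part of \<open>bracket h\<close>,
  commutes with \<open>\<beta>\<close> because \<open>h\<close> is fixed. For generic t the
  eigenspaces of its product with \<open>\<beta>\<close> are the nonzero joint eigenspaces of
  \<open>\<beta>\<close> and s; the two values c1 and c2 on the component of \<open>\<nu>\<close>
  make their number exceed that of the old components.\<close>

lemma refine_grading:
  assumes b: "diag_aut \<beta>" and h: "\<beta> h = h"
    and uv: "u \<in> eig \<beta> \<nu>" "u \<in> gen_eig (bracket h) c1" "u \<noteq> 0"
      "v \<in> eig \<beta> \<nu>" "v \<in> gen_eig (bracket h) c2" "v \<noteq> 0" "c1 \<noteq> c2"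
  shows "\<exists>\<beta>'. diag_aut \<beta>' \<and> card (spec \<beta>) < card (spec \<beta>') \<and> (\<forall>\<mu>. \<exists>l. eig \<beta>' \<mu> \<subseteq> eig \<beta> l) \<and>
    eig \<beta>' 1 \<subseteq> eig \<beta> 1 \<and> \<beta>' h = h"
proof -
  define D where "D = bracket h"
  have D: "lin D" by (simp add: D_def lin_ad)
  note B = diag_autD[OF b]
  define J where "J p = eig \<beta> (fst p) \<inter> gen_eig D (snd p)" for p
  define X where "X = {p. J p \<noteq> {0}}"
  have J0: "0 \<in> J p" for p
    using subspace_0[OF subspace_eig[OF B(2)]] subspace_0[OF subspace_gen_eig[OF D]] by (simp add: J_def)
  have "X \<subseteq> spec \<beta> \<times> spec D"
    unfolding X_def J_def spec_def B(3)
    using subspace_0[OF subspace_eig[OF B(2)]] subspace_0[OF subspace_gen_eig[OF D]] by auto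
  then have finX: "finite X" using finite_spec[OF D] finite_spec[OF B(2)] finite_subset by blast
  have nzX: "fst p \<noteq> 0" if "p \<in> X" for p
    using that \<open>X \<subseteq> spec \<beta> \<times> spec D\<close> spec_nonzero[OF b, of "fst p"] by auto
  obtain t where t: "inj_on (\<lambda>p. fst p * exp (t * snd p)) X"
    using ex_separating_exponent[OF finX nzX] by blast
  define e where "e p = fst p * exp (t * snd p)" for p
  \<comment> \<open>This is exp(t s): it multiplies \<open>gen_eig D c\<close> by
    \<open>exp (t * c)\<close>, which respects brackets because c is additive under them.\<close>
  define \<Phi> where "\<Phi> = (\<lambda>x. \<Sum>c\<in>spec D. scale (exp (t * c)) (gproj D c x))"
  have \<Phi>: "lin \<Phi>" unfolding \<Phi>_def by (rule lin_setsum) (rule lin_scaled[OF lin_gproj[OF D]])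
  have \<Phi>_gen: "\<Phi> x = scale (exp (t * c)) x" if x: "x \<in> gen_eig D c" for x c
  proof (cases "x = 0")
    case False
    then have c: "c \<in> spec D" using x by (auto simp: spec_def)
    have "\<Phi> x = (\<Sum>d\<in>spec D. if d = c then scale (exp (t * c)) x else 0)"
      unfolding \<Phi>_def by (intro sum.cong) (auto simp: gproj_gen_eig[OF D x])
    then show ?thesis using c finite_spec[OF D] by simp
  qed (simp add: lin_0[OF \<Phi>])
  have Q\<Phi>: "gproj D c (\<Phi> x) = scale (exp (t * c)) (gproj D c x)" for c x
  proof -
    have "gproj D c (\<Phi> x) = (\<Sum>d\<in>spec D. gproj D c (scale (exp (t * d)) (gproj D d x)))"
      unfolding \<Phi>_def by (rule lin_sum[OF lin_gproj[OF D]])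
    also have "\<dots> = (\<Sum>d\<in>spec D. if c = d then scale (exp (t * c)) (gproj D c x) else 0)"
      by (intro sum.cong) (auto simp: lin_scale[OF lin_gproj[OF D]] gproj_idem[OF D])
    also have "\<dots> = scale (exp (t * c)) (gproj D c x)"
      using finite_spec[OF D] by (auto simp: gproj_outside[OF D])
    finally show ?thesis .
  qed
  have \<Phi>_br: "\<Phi> (bracket x y) = bracket (\<Phi> x) (\<Phi> y)" for x y
  proof -
    let ?Q = "gproj D" and ?S = "spec D"
    have "\<Phi> (bracket x y) = \<Phi> (\<Sum>c\<in>?S. \<Sum>d\<in>?S. bracket (?Q c x) (?Q d y))"
      by (simp only: lin_sum[OF lin_ad, symmetric] lin_sum[OF lin_ad_right, symmetric] sum_gproj[OF D])
    also have "\<dots> = (\<Sum>c\<in>?S. \<Sum>d\<in>?S. scale (exp (t * (c + d))) (bracket (?Q c x) (?Q d y)))"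
      unfolding lin_sum[OF \<Phi>]
      by (intro sum.cong refl \<Phi>_gen) (simp add: D_def gen_eig_ad_bracket gproj_mem lin_ad)
    also have "\<dots> = (\<Sum>c\<in>?S. \<Sum>d\<in>?S. bracket (scale (exp (t * c)) (?Q c x)) (scale (exp (t * d)) (?Q d y)))"
      by (simp add: bracket_scale_left bracket_scale_right distrib_left exp_add mult.commute)
    also have "\<dots> = bracket (\<Phi> x) (\<Phi> y)"
      unfolding \<Phi>_def by (simp only: lin_sum[OF lin_ad, symmetric] lin_sum[OF lin_ad_right, symmetric])
    finally show ?thesis .
  qed
  define \<beta>' where "\<beta>' = (\<lambda>x. \<Phi> (\<beta> x))"
  have L': "lin \<beta>'" unfolding \<beta>'_def by (rule lin_comp[OF \<Phi> B(2)])
  have "inj \<Phi>"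
  proof (rule injI)
    fix x y assume "\<Phi> x = \<Phi> y"
    then have "gproj D c (\<Phi> x) = gproj D c (\<Phi> y)" for c by simp
    then have "gproj D c x = gproj D c y" for c by (simp add: Q\<Phi>)
    then have "(\<Sum>c\<in>spec D. gproj D c x) = (\<Sum>c\<in>spec D. gproj D c y)" by (rule sum.cong[OF refl])
    then show "x = y" by (simp only: sum_gproj[OF D])
  qed
  then have "bij \<Phi>" using linear_inj_imp_surj[OF \<Phi>] by (simp add: bij_def)
  then have "bij \<beta>'" unfolding \<beta>'_def using bij_comp[OF automorphism_bij[OF B(1)]] by (simp add: o_def)
  then have A': "automorphism \<beta>'"
    using L' by (simp add: automorphism_def \<beta>'_def automorphism_bracket[OF B(1)] \<Phi>_br)
  have \<beta>D: "D (\<beta> x) = \<beta> (D x)" for x using ad_commute_fixed[OF B(1) h] by (simp add: D_def)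
  \<comment> \<open>The projection onto \<open>J p\<close>; the two kinds of projections commute
    since \<open>D\<close> and \<open>\<beta>\<close> do.\<close>
  define R where "R p x = gproj D (snd p) (gproj \<beta> (fst p) x)" for p x
  have RJ: "R p x \<in> J p" for p x
    unfolding R_def J_def
    using gproj_mem[OF D] gproj_commute[OF D B(2) \<beta>D, of "snd p" "gproj \<beta> (fst p) x"] eig_proj(1)[OF b, of "fst p" x]
    by (auto simp: eig_def lin_scale[OF lin_gproj[OF D]])
  have Rsum: "(\<Sum>p\<in>spec \<beta> \<times> spec D. R p x) = x" for x
  proof -
    have "(\<Sum>p\<in>spec \<beta> \<times> spec D. R p x) = (\<Sum>l\<in>spec \<beta>. \<Sum>c\<in>spec D. R (l, c) x)"
      by (simp add: sum.cartesian_product case_prod_unfold)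
    then show ?thesis by (simp add: R_def sum_gproj[OF D] sum_gproj[OF B(2)])
  qed
  have \<beta>'J: "\<beta>' x = scale (e p) x" if "x \<in> J p" for p x
    using that \<Phi>_gen[of x "snd p"] by (simp add: \<beta>'_def J_def eig_def e_def lin_scale[OF \<Phi>] mult.commute)
  have spJ: "span (\<Union>p. J p) = UNIV"
  proof -
    have "x \<in> span (\<Union>p. J p)" for x
      using RJ by (subst Rsum[of x, symmetric]) (blast intro: span_sum span_base)
    then show ?thesis by blast
  qed
  have dg: "diag_aut \<beta>'"
    unfolding diag_aut_def using A' diagonalizable_gen_eig[OF L' spJ] \<beta>'J by blast
  have R\<beta>': "R p (\<beta>' x) = \<beta>' (R p x)" for p x
  proof -
    have "gproj D c (\<beta> y) = \<beta> (gproj D c y)" for c y by (rule gproj_commute[OF D B(2) \<beta>D])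
    moreover have Q\<Phi>': "gproj D c (\<Phi> y) = \<Phi> (gproj D c y)" for c y
      using \<Phi>_gen[OF gproj_mem[OF D, of c y]] by (simp add: Q\<Phi>)
    moreover have "\<beta> (\<Phi> y) = \<Phi> (\<beta> y)" for y
      unfolding \<Phi>_def by (simp add: lin_sum[OF B(2)] lin_scale[OF B(2)] calculation(1))
    moreover have "gproj \<beta> c (\<Phi> y) = \<Phi> (gproj \<beta> c y)" for c y
      by (rule gproj_commute[OF B(2) \<Phi>]) (simp add: calculation(3))
    moreover have "gproj \<beta> c (\<beta> y) = \<beta> (gproj \<beta> c y)" for c y
      by (rule gproj_commute[OF B(2) B(2)]) simp
    ultimately show ?thesis by (simp add: R_def \<beta>'_def)
  qed
  \<comment> \<open>\<open>R p\<close> commutes with \<open>\<beta>'\<close>, so an eigenvector for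
    \<open>\<mu>\<close> has components only in those \<open>J p\<close> with
    \<open>e p = \<mu>\<close>; by the choice of \<open>t\<close> there is just one such
    \<open>p\<close> in \<open>X\<close>.\<close>
  have sub: "\<exists>p\<in>X. \<mu> = e p \<and> eig \<beta>' \<mu> \<subseteq> J p" if mu: "\<mu> \<in> spec \<beta>'" for \<mu>
  proof -
    have R_zero: "R p x = 0" if "x \<in> eig \<beta>' \<mu>" "e p \<noteq> \<mu>" for p x
    proof -
      have "R p x \<in> eig \<beta>' \<mu>"
        using that(1) R\<beta>'[of p x] by (simp add: eig_def R_def lin_scale[OF lin_gproj[OF D]] lin_scale[OF lin_gproj[OF B(2)]])
      moreover have "R p x \<in> eig \<beta>' (e p)" using \<beta>'J[OF RJ] by (simp add: eig_def)
      ultimately show ?thesis using eig_disjoint[OF dg] that(2) by blast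
    qed
    obtain x where x: "x \<in> eig \<beta>' \<mu>" "x \<noteq> 0"
      using mu subspace_0[OF subspace_eig[OF L', of \<mu>]] by (auto simp: spec_eq[OF dg])
    obtain p where p: "R p x \<noteq> 0"
      using x Rsum[of x] by (metis sum.neutral)
    then have pX: "p \<in> X" "\<mu> = e p" using R_zero[OF x(1), of p] RJ[of p x] by (auto simp: X_def)
    have "y \<in> J p" if y: "y \<in> eig \<beta>' \<mu>" for y
    proof -
      have "R q y = 0" if "q \<noteq> p" for q
      proof (cases "q \<in> X")
        case True
        then have "e q \<noteq> \<mu>" using t pX that by (auto simp: inj_on_def e_def)
        then show ?thesis by (rule R_zero[OF y])
      next
        case False
        then show ?thesis using RJ[of q y] by (auto simp: X_def)
      qed
      then have "(\<Sum>q\<in>spec \<beta> \<times> spec D. R q y) = (\<Sum>q\<in>{p}. R q y)"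
        using pX \<open>X \<subseteq> spec \<beta> \<times> spec D\<close> finite_spec[OF D] finite_spec[OF B(2)]
        by (intro sum.mono_neutral_right) auto
      then have "R p y = y" using Rsum[of y] by simp
      then show ?thesis using RJ[of p y] by simp
    qed
    then show ?thesis using pX by blast
  qed
  have spec': "spec \<beta>' = e ` X"
  proof
    show "spec \<beta>' \<subseteq> e ` X" using sub by blast
    show "e ` X \<subseteq> spec \<beta>'"
    proof clarify
      fix l c assume "(l, c) \<in> X"
      then obtain x where "x \<in> J (l, c)" "x \<noteq> 0" using J0 by (auto simp: X_def)
      then show "e (l, c) \<in> spec \<beta>'" using \<beta>'J by (intro mem_spec[OF dg, of x]) (auto simp: eig_def)
    qed
  qed
  have "card (spec \<beta>') = card X"
    unfolding spec' using t by (intro card_image) (auto simp: inj_on_def e_def)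
  have "fst ` X = spec \<beta>"
  proof
    show "fst ` X \<subseteq> spec \<beta>" using \<open>X \<subseteq> spec \<beta> \<times> spec D\<close> by auto
    show "spec \<beta> \<subseteq> fst ` X"
    proof
      fix l assume "l \<in> spec \<beta>"
      then obtain x where x: "x \<in> eig \<beta> l" "x \<noteq> 0"
        using subspace_0[OF subspace_eig[OF B(2)]] by (auto simp: spec_eq[OF b])
      then obtain c where "gproj D c x \<noteq> 0" using sum_gproj[OF D, of x] by (metis sum.neutral)
      moreover have "gproj D c x = R (l, c) x" using x by (simp add: R_def eig_proj(2)[OF b])
      ultimately have "(l, c) \<in> X" using RJ[of "(l,c)" x] by (auto simp: X_def)
      then show "l \<in> fst ` X" by force
    qed
  qed
  moreover have "card (fst ` X) < card X"
  proof -
    have "(\<nu>, c1) \<in> X" "(\<nu>, c2) \<in> X" using uv by (auto simp: X_def J_def D_def)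
    then have "\<not> inj_on fst X" using uv(7) by (metis fst_conv inj_onD prod.inject)
    then show ?thesis using finX card_image_le[OF finX] eq_card_imp_inj_on[OF finX] by (metis le_neq_implies_less)
  qed
  ultimately have "card (spec \<beta>) < card (spec \<beta>')" using \<open>card (spec \<beta>') = card X\<close> by simp
  moreover have "\<exists>l. eig \<beta>' \<mu> \<subseteq> eig \<beta> l" for \<mu>
  proof (cases "\<mu> \<in> spec \<beta>'")
    case True then show ?thesis using sub[OF True] by (auto simp: J_def)
  next
    case False
    then have "eig \<beta>' \<mu> = {0}" by (simp add: spec_eq[OF dg])
    then show ?thesis using subspace_0[OF subspace_eig[OF B(2)]] by auto
  qed
  \<comment> \<open>If \<open>h\<close> were 0, \<open>bracket h\<close> would have 0 as its only
    eigenvalue, against c1 \<noteq> c2. A nonzero \<open>h\<close> puts (1, 0) into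
    \<open>X\<close>, which identifies the joint eigenspace behind the eigenvalue 1 and yields
    \<open>eig \<beta>' 1 \<subseteq> eig \<beta> 1\<close>.\<close>
  moreover have "h \<noteq> 0"
  proof
    assume "h = 0"
    then have "D x = 0" for x by (simp add: D_def bracket_zero_left)
    then have "x \<in> gen_eig D 0" for x using eig_subset_gen_eig[of D 0] by (auto simp: eig_def)
    then have "c1 = 0" "c2 = 0"
      using uv gproj_gen_eig[OF D, of u 0 c1] gproj_gen_eig[OF D, of v 0 c2]
        gproj_gen_eig[OF D, of u c1 c1] gproj_gen_eig[OF D, of v c2 c2] by (auto simp: D_def split: if_splits)
    then show False using uv(7) by simp
  qed
  have hJ: "h \<in> J (1, 0)"
    using h eig_subset_gen_eig[of D 0] by (auto simp: J_def eig_def D_def bracket_self)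
  then have X1: "(1, 0) \<in> X" using \<open>h \<noteq> 0\<close> by (auto simp: X_def)
  have h': "\<beta>' h = h" using \<beta>'J[OF hJ] by (simp add: e_def)
  moreover have "eig \<beta>' 1 \<subseteq> eig \<beta> 1"
  proof -
    have "1 \<in> spec \<beta>'" using h' \<open>h \<noteq> 0\<close> by (intro mem_spec[OF dg, of h]) (simp_all add: eig_def)
    then obtain p where p: "p \<in> X" "1 = e p" "eig \<beta>' 1 \<subseteq> J p" using sub by blast
    have "p = (1, 0)" using t p(1,2) X1 by (auto simp: inj_on_def e_def)
    then show ?thesis using p(3) by (auto simp: J_def)
  qed
  ultimately show ?thesis using dg by blast
qed

subsection \<open>Engel's theorem\<close>

text \<open>In the form relative to a pair of subspaces the statement can be applied to the algebra
  itself: a largest subalgebra K with the property, acting on the pair K inside L, is normalized by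
  some x outside K, and K together with x again spans a subalgebra with the property.\<close>

lemma engel:
  assumes L: "subspace L" "\<And>x y. x \<in> L \<Longrightarrow> y \<in> L \<Longrightarrow> bracket x y \<in> L"
    and nil: "\<And>x. x \<in> L \<Longrightarrow> \<exists>k. \<forall>v. (bracket x ^^ k) v = 0"
    and U: "subspace U" "subspace U'" "U' \<subset> U" "\<And>x u. x \<in> L \<Longrightarrow> u \<in> U \<Longrightarrow> bracket x u \<in> U"
      "\<And>x u. x \<in> L \<Longrightarrow> u \<in> U' \<Longrightarrow> bracket x u \<in> U'"
  shows "\<exists>u\<in>U - U'. \<forall>x\<in>L. bracket x u \<in> U'"
proof -
  define inv where "inv K V \<longleftrightarrow> (\<forall>x\<in>K. \<forall>u\<in>V. bracket x u \<in> V)" for K V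
  \<comment> \<open>All invariant pairs are quantified over, so that the property of
    \<open>K\<close> can be used both for \<open>K\<close> inside \<open>L\<close> and for the pair
    at hand when \<open>K\<close> is enlarged.\<close>
  define good where "good K \<longleftrightarrow> subspace K \<and> K \<subseteq> L \<and> inv K K \<and>
    (\<forall>V V'. subspace V \<and> subspace V' \<and> V' \<subset> V \<and> inv K V \<and> inv K V' \<longrightarrow>
      (\<exists>u\<in>V - V'. \<forall>x\<in>K. bracket x u \<in> V'))" for K
  have "good {0}"
    by (auto simp: good_def inv_def bracket_zero_left subspace_0 subspace_single_0 L subset_iff psubset_eq)
  then obtain K where K: "good K" and max: "\<And>M. good M \<Longrightarrow> dim M \<le> dim K"
    using ex_has_greatest_nat[of good "{0}" dim "Suc dimension"] dim_subset_UNIV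
    by (metis le_imp_less_Suc)
  have K': "subspace K" "K \<subseteq> L" "inv K K" using K by (auto simp: good_def)
  have "K = L"
  proof (rule ccontr)
    assume "K \<noteq> L"
    then have "K \<subset> L" using K' by blast
    moreover have "inv K L" using L K' by (auto simp: inv_def)
    ultimately obtain x where x: "x \<in> L - K" "\<forall>k\<in>K. bracket k x \<in> K"
      using K L(1) K' unfolding good_def by blast
    define M where "M = {k + scale c x | k c. k \<in> K}"
    have "k + scale 0 x \<in> M" if "k \<in> K" for k using that unfolding M_def by blast
    then have KM: "K \<subseteq> M" by auto
    have "0 + scale 1 x \<in> M" using subspace_0[OF K'(1)] unfolding M_def by blast
    then have xM: "x \<in> M" by simp
    have sM: "subspace M"
    proof (rule subspaceI)
      show "0 \<in> M" using KM subspace_0[OF K'(1)] by blast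
    next
      fix a b assume "a \<in> M" "b \<in> M"
      then obtain k c l d where "k \<in> K" "l \<in> K" "a = k + scale c x" "b = l + scale d x" by (auto simp: M_def)
      then have "a + b = (k + l) + scale (c + d) x" "k + l \<in> K"
        using K' by (simp_all add: scale_left_distrib subspace_add algebra_simps)
      then show "a + b \<in> M" unfolding M_def by blast
    next
      fix r a assume "a \<in> M"
      then obtain k c where "k \<in> K" "a = k + scale c x" by (auto simp: M_def)
      then have "scale r a = scale r k + scale (r * c) x" "scale r k \<in> K"
        using K' by (simp_all add: scale_right_distrib subspace_scale)
      then show "scale r a \<in> M" unfolding M_def by blast
    qed
    have M_inv: "inv M V" if "inv K V" "subspace V" "\<And>v. v \<in> V \<Longrightarrow> bracket x v \<in> V" for V
      using that unfolding inv_def M_def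
      by (auto simp: bracket_add_left bracket_scale_left subspace_add subspace_scale)
    have "good M"
      unfolding good_def
    proof (intro conjI allI impI)
      show "subspace M" by (rule sM)
      show "M \<subseteq> L" using K' x L(1) by (auto simp: M_def subspace_add subspace_scale)
      have "bracket x v \<in> M" if v: "v \<in> M" for v
      proof -
        obtain k c where kc: "k \<in> K" "v = k + scale c x" using v by (auto simp: M_def)
        have "bracket x v = - bracket k x"
          using kc bracket_antisym[of x k] by (simp add: bracket_add_right bracket_scale_right bracket_self)
        then show ?thesis using x(2) kc(1) K'(1) subspace_neg KM by auto
      qed
      moreover have "inv K M"
      proof -
        have "bracket k (l + scale c x) \<in> K" if "k \<in> K" "l \<in> K" for k l c
          using that x(2) K'(1,3) by (simp add: bracket_add_right bracket_scale_right inv_def subspace_add subspace_scale)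
        then show ?thesis using KM unfolding inv_def M_def by blast
      qed
      ultimately show "inv M M" using M_inv[of M] sM by blast
    next
      fix V V' assume "subspace V \<and> subspace V' \<and> V' \<subset> V \<and> inv M V \<and> inv M V'"
      then have V: "subspace V" "subspace V'" "V' \<subset> V" "inv M V" "inv M V'" by auto
      then have "inv K V" "inv K V'" using KM by (auto simp: inv_def)
      then obtain u where u: "u \<in> V - V'" "\<forall>k\<in>K. bracket k u \<in> V'" using K V unfolding good_def by blast
      obtain n where n: "(bracket x ^^ n) u = 0" using nil x(1) by blast
      have it: "(bracket x ^^ i) u \<in> V \<and> (\<forall>k\<in>K. bracket k ((bracket x ^^ i) u) \<in> V')" for i
      proof (induction i)
        case (Suc i)
        let ?w = "(bracket x ^^ i) u"
        have "bracket x ?w \<in> V" using Suc V(4) xM by (auto simp: inv_def)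
        moreover have "bracket k (bracket x ?w) \<in> V'" if k: "k \<in> K" for k
        proof -
          have "bracket k (bracket x ?w) = bracket (bracket k x) ?w + bracket x (bracket k ?w)"
            by (rule ad_derivation)
          then show ?thesis using Suc k x(2) V(2,5) xM by (auto simp: inv_def subspace_add)
        qed
        ultimately show ?case by simp
      qed (use u in auto)
      \<comment> \<open>The vectors of \<open>V\<close> that \<open>K\<close> sends into
        \<open>V'\<close> are stable under \<open>bracket x\<close>. By nilpotency some iterate
        outside \<open>V'\<close> is followed by one inside, and that iterate is sent into
        \<open>V'\<close> by \<open>x\<close> as well.\<close>
      have "\<exists>i. (bracket x ^^ i) u \<notin> V' \<and> (bracket x ^^ Suc i) u \<in> V'"
      proof (rule ccontr)
        assume neg: "\<not> ?thesis"
        have "(bracket x ^^ i) u \<notin> V'" for i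
          by (induction i) (use u neg in auto)
        then show False using n subspace_0[OF V(2)] by metis
      qed
      then obtain i where i: "(bracket x ^^ i) u \<notin> V'" "bracket x ((bracket x ^^ i) u) \<in> V'" by auto
      have "bracket y ((bracket x ^^ i) u) \<in> V'" if "y \<in> M" for y
        using that it[of i] i(2) V(2)
        by (auto simp: M_def bracket_add_left bracket_scale_left subspace_add subspace_scale)
      then show "\<exists>u\<in>V - V'. \<forall>y\<in>M. bracket y u \<in> V'" using it[of i] i(1) by blast
    qed
    then have "dim M \<le> dim K" by (rule max)
    then have "K = M" using subspace_dim_equal[OF K'(1) sM KM] by simp
    then show False using xM x(1) by blast
  qed
  then show ?thesis using K U unfolding good_def inv_def by blast
qed

end

subsection \<open>A circular order on the multiplicative group of the complex numbers\<close>

text \<open>Nontrivial complex numbers are ordered by argument and then by modulus, with the reals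
  strictly between 0 and 1 put at angle 2 pi instead of 0, so that 1 sits at both ends. As for the
  residues 1, ..., n - 1 modulo n, a product either does not wrap around and exceeds both factors,
  or wraps around once and is below both. The rank is the position within the finite set
  \<open>S\<close>.\<close>

lemma ex_circular_rank:
  fixes S :: "complex set"
  assumes S: "finite S" "0 \<notin> S"
  shows "\<exists>\<rho> :: complex \<Rightarrow> nat. (\<forall>u\<in>S. u \<noteq> 1 \<longrightarrow> \<rho> u < card S) \<and>
    (\<forall>u\<in>S. \<forall>v\<in>S. u \<noteq> 1 \<longrightarrow> v \<noteq> 1 \<longrightarrow> u * v \<in> S \<longrightarrow> u * v \<noteq> 1 \<longrightarrow>
      (\<rho> u < \<rho> (u * v) \<and> \<rho> v < \<rho> (u * v)) \<or> (\<rho> (u * v) < \<rho> u \<and> \<rho> (u * v) < \<rho> v))"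
proof -
  define r where "r u = ln (norm u)" for u :: complex
  define th where "th u = (if Arg2pi u = 0 \<and> r u < 0 then 2 * pi else Arg2pi u)" for u :: complex
  have th_exp: "u = of_real (norm u) * exp (\<i> * of_real (th u))" for u
  proof -
    have "u = of_real (norm u) * exp (\<i> * of_real (Arg2pi u))" using Arg2pi[of u] by (simp add: is_Arg_def)
    moreover have "exp (\<i> * of_real (2 * pi)) = 1" by (auto simp: exp_eq_1 intro: exI[of _ 1])
    ultimately show ?thesis by (auto simp: th_def)
  qed
  have pos: "0 < th u \<or> (th u = 0 \<and> 0 < r u)" and below: "th u < 2 * pi \<or> (th u = 2 * pi \<and> r u < 0)"
    if "u \<noteq> 0" "u \<noteq> 1" for u
  proof -
    have "Arg2pi u = 0 \<Longrightarrow> r u \<noteq> 0"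
      using that Arg2pi[of u] by (auto simp: r_def is_Arg_def)
    then show "0 < th u \<or> (th u = 0 \<and> 0 < r u)" "th u < 2 * pi \<or> (th u = 2 * pi \<and> r u < 0)"
      using Arg2pi[of u] by (auto simp: th_def)
  qed
  define lt where "lt u v \<longleftrightarrow> th u < th v \<or> (th u = th v \<and> r u < r v)" for u v
  have key: "(lt u (u * v) \<and> lt v (u * v)) \<or> (lt (u * v) u \<and> lt (u * v) v)"
    if uv: "u \<noteq> 0" "v \<noteq> 0" "u \<noteq> 1" "v \<noteq> 1" "u * v \<noteq> 1" for u v
  proof -
    let ?w = "u * v"
    have rw: "r ?w = r u + r v" using uv by (simp add: r_def norm_mult ln_mult)
    have "of_real (norm ?w) * exp (\<i> * of_real (th ?w)) = ?w" by (rule th_exp[symmetric])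
    also have "\<dots> = (of_real (norm u) * exp (\<i> * of_real (th u))) * (of_real (norm v) * exp (\<i> * of_real (th v)))"
      using th_exp by metis
    also have "\<dots> = of_real (norm ?w) * exp (\<i> * of_real (th u) + \<i> * of_real (th v))"
      by (simp add: norm_mult exp_add)
    finally have "exp (\<i> * of_real (th ?w)) = exp (\<i> * of_real (th u) + \<i> * of_real (th v))"
      using uv by simp
    then obtain j :: int where "\<i> * of_real (th u) + \<i> * of_real (th v) = \<i> * of_real (th ?w) + (of_int (2 * j) * pi) * \<i>"
      unfolding exp_eq by (metis exp_eq)
    then have "\<i> * of_real (th u + th v) = \<i> * of_real (th ?w + 2 * j * pi)" by (simp add: algebra_simps)
    then have "(of_real (th u + th v) :: complex) = of_real (th ?w + 2 * j * pi)"
      by (metis complex_i_not_zero mult_left_cancel)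
    then have e0: "th u + th v = th ?w + 2 * j * pi" by (simp only: of_real_eq_iff)
    define a where "a = real_of_int j * pi"
    have e: "th u + th v = th ?w + 2 * a" using e0 by (simp add: a_def)
    have bd: "0 \<le> th z \<and> th z \<le> 2 * pi" if "z \<noteq> 0" "z \<noteq> 1" for z using pos[OF that] below[OF that] by auto
    have bds: "0 \<le> th u" "0 \<le> th v" "0 \<le> th ?w" "th u \<le> 2 * pi" "th v \<le> 2 * pi" "th ?w \<le> 2 * pi"
      using bd[of u] bd[of v] bd[of ?w] uv by auto
    \<comment> \<open>\<open>j\<close> counts the full turns lost in the product. Other values would
      force all three angles to the ends of the interval, where the signs of the logarithms of the
      moduli contradict \<open>r ?w = r u + r v\<close>.\<close>
    have "j = 0 \<or> j = 1"
    proof (rule ccontr)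
      assume "\<not> ?thesis"
      then have "j \<le> -1 \<or> 2 \<le> j" by linarith
      then show False
      proof
        assume "j \<le> -1"
        then have "a \<le> -1 * pi" unfolding a_def by (intro mult_right_mono) auto
        then have "th u = 0" "th v = 0" "th ?w = 2 * pi" using e bds by linarith+
        then have "0 < r u" "0 < r v" "r ?w < 0" using pos[of u] pos[of v] below[of ?w] uv by auto
        then show False using rw by linarith
      next
        assume "2 \<le> j"
        then have "2 * pi \<le> a" unfolding a_def by (intro mult_right_mono) auto
        then have "th u = 2 * pi" "th v = 2 * pi" "th ?w = 0" using e bds by linarith+
        then have "r u < 0" "r v < 0" "0 < r ?w" using below[of u] below[of v] pos[of ?w] uv by auto
        then show False using rw by linarith
      qed
    qed
    then show ?thesis
    proof
      assume "j = 0"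
      then have e1: "th ?w = th u + th v" using e by (simp add: a_def)
      have "lt u ?w" "lt v ?w" unfolding lt_def using pos[of u] pos[of v] uv(1-4) unfolding e1 rw by auto
      then show ?thesis by blast
    next
      assume "j = 1"
      then have e1: "th ?w = th u + th v - 2 * pi" using e by (simp add: a_def)
      have "lt ?w u" "lt ?w v" unfolding lt_def using below[of u] below[of v] uv(1-4) unfolding e1 rw by auto
      then show ?thesis by blast
    qed
  qed
  define \<rho> where "\<rho> u = card {v \<in> S. v \<noteq> 1 \<and> lt v u}" for u
  have mono: "\<rho> u < \<rho> v" if "u \<in> S" "u \<noteq> 1" "lt u v" for u v
    unfolding \<rho>_def
  proof (rule psubset_card_mono)
    have "u \<in> {w \<in> S. w \<noteq> 1 \<and> lt w v}" "u \<notin> {w \<in> S. w \<noteq> 1 \<and> lt w u}" using that by (auto simp: lt_def)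
    moreover have "lt w v" if "lt w u" for w using that \<open>lt u v\<close> by (auto simp: lt_def)
    ultimately show "{w \<in> S. w \<noteq> 1 \<and> lt w u} \<subset> {w \<in> S. w \<noteq> 1 \<and> lt w v}" by blast
  qed (use S in simp)
  have "\<rho> u < card S" if "u \<in> S" for u
    unfolding \<rho>_def using S that by (intro psubset_card_mono) (auto simp: lt_def)
  moreover have "(\<rho> u < \<rho> (u * v) \<and> \<rho> v < \<rho> (u * v)) \<or> (\<rho> (u * v) < \<rho> u \<and> \<rho> (u * v) < \<rho> v)"
    if "u \<in> S" "v \<in> S" "u \<noteq> 1" "v \<noteq> 1" "u * v \<in> S" "u * v \<noteq> 1" for u v
  proof -
    have "u \<noteq> 0" "v \<noteq> 0" using that S by auto
    then show ?thesis using key[of u v] that mono[of u "u * v"] mono[of v "u * v"] mono[of "u * v"] by blast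
  qed
  ultimately show ?thesis by blast
qed

subsection \<open>Kreknin's theorem relative to an ideal\<close>

context fd_lie_algebra
begin

text \<open>The subalgebra generated by \<open>J\<close> and the homogeneous elements of
  \<open>H\<close> with degree in \<open>T\<close>. In Kreknin's argument \<open>T\<close> contains
  only degrees other than 1, since fixed elements of \<open>H\<close> lie in \<open>J\<close>; it
  shrinks until it is empty and only \<open>J\<close> is left.\<close>

inductive_set gen :: "('a \<Rightarrow> 'a) \<Rightarrow> 'a set \<Rightarrow> 'a set \<Rightarrow> complex set \<Rightarrow> 'a set"
  for f :: "'a \<Rightarrow> 'a" and J :: "'a set" and H :: "'a set" and T :: "complex set"
where
  gen_J: "x \<in> J \<Longrightarrow> x \<in> gen f J H T"
| gen_eig: "u \<in> T \<Longrightarrow> x \<in> H \<Longrightarrow> x \<in> eig f u \<Longrightarrow> x \<in> gen f J H T"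
| gen_add: "x \<in> gen f J H T \<Longrightarrow> y \<in> gen f J H T \<Longrightarrow> x + y \<in> gen f J H T"
| gen_scale: "x \<in> gen f J H T \<Longrightarrow> scale c x \<in> gen f J H T"
| gen_bracket: "x \<in> gen f J H T \<Longrightarrow> y \<in> gen f J H T \<Longrightarrow> bracket x y \<in> gen f J H T"

lemma subspace_gen: "subspace J \<Longrightarrow> subspace (gen f J H T)"
  by (rule subspaceI) (auto intro: gen_add gen_scale gen_J[OF subspace_0])

definition graded_subalgebra :: "('a \<Rightarrow> 'a) \<Rightarrow> 'a set \<Rightarrow> bool"
  where "graded_subalgebra f H \<longleftrightarrow> subspace H \<and> (\<forall>x\<in>H. \<forall>y\<in>H. bracket x y \<in> H) \<and> (\<forall>x\<in>H. f x \<in> H)"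

lemma graded_subalgebra_derived_series:
  assumes f: "automorphism f" and H: "graded_subalgebra f H"
  shows "graded_subalgebra f (derived_series H k) \<and> derived_series H k \<subseteq> H"
proof -
  have le: "derived_series H j \<subseteq> derived_series H i" if "i \<le> j" for i j
    using H that by (intro derived_series_antimono) (auto simp: graded_subalgebra_def)
  have "bracket x y \<in> derived_series H k" if "x \<in> derived_series H k" "y \<in> derived_series H k" for x y
    using bracket_span_mem[OF that] le[of k "Suc k"] by auto
  moreover have "f x \<in> derived_series H k" if "x \<in> derived_series H k" for x
    using automorphism_derived_series[OF f _ that] H by (simp add: graded_subalgebra_def)
  ultimately show ?thesis
    using le[of 0 k] H subspace_derived_series[of H k] by (auto simp: graded_subalgebra_def)
qed

text \<open>Modulo \<open>J\<close>, a bracket of \<open>H\<close> with the generated subalgebra is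
  a combination of brackets [h, a] with \<open>a\<close> a homogeneous generator. Its part of degree
  \<open>w\<close> involves only degrees with u * j = w: for u = 1 the factor from \<open>H\<close>
  is fixed and so in \<open>J\<close>, and otherwise both degrees are in \<open>T'\<close> by
  assumption.\<close>

lemma gen_step:
  assumes f: "diag_aut f" and J: "ideal J" "\<And>x. x \<in> J \<Longrightarrow> f x \<in> J"
    and H: "graded_subalgebra f H" "H \<inter> eig f 1 \<subseteq> J"
    and T: "T \<subseteq> spec f - {1}" and w: "w \<in> T"
    and T': "\<And>u j. j \<in> T \<Longrightarrow> u \<in> spec f \<Longrightarrow> u \<noteq> 1 \<Longrightarrow> u * j = w \<Longrightarrow> u \<in> T' \<and> j \<in> T'"
    and x: "x \<in> eig f w" "x \<in> bracket_span H (gen f J H T)"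
  shows "x \<in> gen f J H T'"
proof -
  have sJ: "subspace J" by (rule ideal_subspace[OF J(1)])
  have sH: "subspace H" and clH: "\<And>x y. x \<in> H \<Longrightarrow> y \<in> H \<Longrightarrow> bracket x y \<in> H" and fH: "\<And>x. x \<in> H \<Longrightarrow> f x \<in> H"
    using H by (auto simp: graded_subalgebra_def)
  define HJ where "HJ = {h + j | h j. h \<in> H \<and> j \<in> J}"
  define Q where "Q = span ({bracket h a | h a. h \<in> H \<and> a \<in> H \<and> (\<exists>j\<in>T. a \<in> eig f j)} \<union> J)"
  have JQ: "J \<subseteq> Q" unfolding Q_def using span_superset by blast
  have sQ: "subspace Q" by (simp add: Q_def)
  have sHJ: "subspace HJ" unfolding HJ_def by (rule subspace_sums[OF sH sJ])
  have HHJ: "h \<in> HJ" if "h \<in> H" for h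
    unfolding HJ_def using that subspace_0[OF sJ] by (intro CollectI exI[of _ h] exI[of _ 0]) simp
  have JHJ: "j \<in> HJ" if "j \<in> J" for j
    unfolding HJ_def using that subspace_0[OF sH] by (intro CollectI exI[of _ 0] exI[of _ j]) simp
  have clHJ: "bracket p q \<in> HJ" if pq: "p \<in> HJ" "q \<in> HJ" for p q
  proof -
    obtain a b c d where *: "a \<in> H" "b \<in> J" "p = a + b" "c \<in> H" "d \<in> J" "q = c + d"
      using pq unfolding HJ_def by blast
    have "bracket p q = bracket a c + (bracket a d + bracket b q)"
      by (simp add: * bracket_add_left bracket_add_right)
    moreover have "bracket a c \<in> H" "bracket a d + bracket b q \<in> J"
      using * clH J(1) ideal_bracket_left[OF J(1)] by (auto simp: ideal_def intro!: subspace_add[OF sJ])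
    ultimately show ?thesis unfolding HJ_def by blast
  qed
  \<comment> \<open>By the Jacobi identity [y, [p, q]] is the difference of [[y, p], q] and [[y, q],
    p], whose outer arguments [y, p] and [y, q] are again in \<open>HJ\<close>; so iterated brackets
    never have to be expanded. \<open>HJ\<close> replaces \<open>H\<close> because \<open>J\<close>
    need not lie in \<open>H\<close>.\<close>
  have "q \<in> HJ \<and> (\<forall>y\<in>HJ. bracket y q \<in> Q)" if "q \<in> gen f J H T" for q
    using that
  proof induction
    case (gen_J x) then show ?case using JQ JHJ J(1) by (auto simp: ideal_def)
  next
    case (gen_eig u x)
    have "bracket y x \<in> Q" if y: "y \<in> HJ" for y
    proof -
      obtain h j where hj: "h \<in> H" "j \<in> J" "y = h + j" using y unfolding HJ_def by blast
      have "bracket h x \<in> Q" unfolding Q_def using hj gen_eig by (intro span_base) blast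
      moreover have "bracket j x \<in> Q" using ideal_bracket_left[OF J(1) hj(2)] JQ by blast
      ultimately show ?thesis using hj sQ by (simp add: bracket_add_left subspace_add)
    qed
    then show ?case using gen_eig HHJ by blast
  next
    case (gen_add x y) then show ?case using sHJ sQ by (simp add: subspace_add bracket_add_right)
  next
    case (gen_scale x c) then show ?case using sHJ sQ by (simp add: subspace_scale bracket_scale_right)
  next
    case (gen_bracket p q)
    have "bracket y (bracket p q) \<in> Q" if "y \<in> HJ" for y
    proof -
      have "bracket y (bracket p q) = bracket (bracket y p) q - bracket (bracket y q) p"
        using ad_derivation[of y p q] bracket_antisym[of p "bracket y q"] by simp
      moreover have "bracket y p \<in> HJ" "bracket y q \<in> HJ" using clHJ that gen_bracket by blast+
      ultimately show ?thesis using gen_bracket sQ by (simp add: subspace_diff)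
    qed
    then show ?case using gen_bracket clHJ by blast
  qed
  then have "bracket_span H (gen f J H T) \<subseteq> Q" using sQ HHJ by (intro bracket_span_le) auto
  then have xQ: "x \<in> Q" using x by blast
  have PJ: "gproj f u j \<in> J" if "j \<in> J" for u j
    by (rule gproj_invariant[OF diag_autD(2)[OF f] sJ J(2) that])
  have sG: "subspace (gen f J H T')" by (rule subspace_gen[OF sJ])
  have "gproj f w x \<in> gen f J H T'"
  proof (rule lin_image_span[OF lin_gproj[OF diag_autD(2)[OF f]] _ sG xQ[unfolded Q_def]])
    fix q assume "q \<in> {bracket h a | h a. h \<in> H \<and> a \<in> H \<and> (\<exists>j\<in>T. a \<in> eig f j)} \<union> J"
    then consider "q \<in> J" | h a j where "h \<in> H" "a \<in> H" "j \<in> T" "a \<in> eig f j" "q = bracket h a" by blast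
    then show "gproj f w q \<in> gen f J H T'"
    proof cases
      case 1 then show ?thesis using PJ gen.gen_J by blast
    next
      case 2
      have "gproj f w q = (\<Sum>u\<in>spec f. gproj f w (bracket (gproj f u h) a))"
        unfolding 2(5) lin_sum[OF lin_gproj[OF diag_autD(2)[OF f]], symmetric] lin_sum[OF lin_ad_right, symmetric]
        by (simp add: sum_gproj diag_autD(2)[OF f])
      also have "\<dots> \<in> gen f J H T'"
      proof (rule subspace_sum[OF sG])
        fix u assume u: "u \<in> spec f"
        let ?h = "gproj f u h"
        have hH: "?h \<in> H" by (rule gproj_invariant[OF diag_autD(2)[OF f] sH fH 2(1)])
        have hu: "?h \<in> eig f u" by (rule eig_proj(1)[OF f])
        have br: "gproj f w (bracket ?h a) = (if w = u * j then bracket ?h a else 0)"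
          using eig_bracket[OF diag_autD(1)[OF f] hu 2(4)] by (rule eig_proj(2)[OF f])
        show "gproj f w (bracket ?h a) \<in> gen f J H T'"
        proof (cases "w = u * j")
          case False then show ?thesis using br subspace_0[OF sG] by simp
        next
          case True
          show ?thesis
          proof (cases "u = 1")
            case True
            then have "?h \<in> J" using hu hH H(2) by auto
            then show ?thesis using br ideal_bracket_left[OF J(1)] gen.gen_J subspace_0[OF sG] by auto
          next
            case False
            then have "u \<in> T'" "j \<in> T'" using T'[OF 2(3) u] True by auto
            then show ?thesis using br True gen.gen_bracket[OF gen.gen_eig[of u] gen.gen_eig[of j]] hH hu 2 by auto
          qed
        qed
      qed
      finally show ?thesis .
    qed
  qed
  then show ?thesis using eig_proj(2)[OF f x(1)] by simp
qed

text \<open>Degrees are eliminated in the order of \<open>\<rho>\<close>, lowest first. If w has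
  rank k and w = u * j with j of rank at least k, then u and j cannot both be below w, so both have
  rank above k: after one more commutator, elements of degree w are generated by those of higher
  rank. The induction hypothesis is used for \<open>H\<close> and again for the term of index 2^k,
  whence 2^(k+1) - 1 = 2^k + (2^k - 1); this is why the claim is stated for all
  \<open>H\<close>.\<close>

theorem kreknin:
  assumes f: "diag_aut f" and J: "ideal J" "\<And>x. x \<in> J \<Longrightarrow> f x \<in> J"
    and H: "graded_subalgebra f H" "H \<inter> eig f 1 \<subseteq> J"
  shows "derived_series H (2 ^ card (spec f)) \<subseteq> J"
proof -
  let ?S = "spec f"
  note L = diag_autD(2)[OF f]
  have sJ: "subspace J" by (rule ideal_subspace[OF J(1)])
  obtain \<rho> :: "complex \<Rightarrow> nat" where \<rho>: "\<And>u. u \<in> ?S \<Longrightarrow> u \<noteq> 1 \<Longrightarrow> \<rho> u < card ?S"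
    "\<And>u v. u \<in> ?S \<Longrightarrow> v \<in> ?S \<Longrightarrow> u \<noteq> 1 \<Longrightarrow> v \<noteq> 1 \<Longrightarrow> u * v \<in> ?S \<Longrightarrow> u * v \<noteq> 1 \<Longrightarrow>
      (\<rho> u < \<rho> (u * v) \<and> \<rho> v < \<rho> (u * v)) \<or> (\<rho> (u * v) < \<rho> u \<and> \<rho> (u * v) < \<rho> v)"
    using ex_circular_rank[OF finite_spec[OF L]] spec_nonzero[OF f] by metis
  define T where "T k = {u \<in> ?S - {1}. k \<le> \<rho> u}" for k
  have claim: "derived_series H (2 ^ k - 1) \<subseteq> gen f J H (T k)"
    if "graded_subalgebra f H" "H \<inter> eig f 1 \<subseteq> J" for k H
    using that
  proof (induction k arbitrary: H)
    case (0 H)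
    have "x \<in> gen f J H (T 0)" if "x \<in> H" for x
    proof -
      have "(\<Sum>u\<in>?S. gproj f u x) \<in> gen f J H (T 0)"
      proof (rule subspace_sum[OF subspace_gen[OF sJ]])
        fix u assume u: "u \<in> ?S"
        have "gproj f u x \<in> H"
          by (rule gproj_invariant[OF L _ _ that]) (use 0 in \<open>auto simp: graded_subalgebra_def\<close>)
        moreover have "gproj f u x \<in> eig f u" by (rule eig_proj(1)[OF f])
        ultimately show "gproj f u x \<in> gen f J H (T 0)"
          using gen.gen_J[of "gproj f u x" J f H "T 0"] gen.gen_eig[of u "T 0" "gproj f u x" H f J] 0(2) u
          by (cases "u = 1") (auto simp: T_def)
      qed
      then show ?thesis by (simp add: sum_gproj[OF L])
    qed
    then show ?case by auto
  next
    case (Suc k H)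
    let ?N = "2 ^ k - 1 :: nat"
    define H' where "H' = derived_series H ?N"
    define M where "M = derived_series H (Suc ?N)"
    have H': "graded_subalgebra f H'" "H' \<subseteq> H" "H' \<subseteq> gen f J H (T k)"
      using graded_subalgebra_derived_series[OF diag_autD(1)[OF f] Suc.prems(1)] Suc.IH[OF Suc.prems]
      by (auto simp: H'_def)
    have M: "graded_subalgebra f M" "M \<subseteq> H"
      using graded_subalgebra_derived_series[OF diag_autD(1)[OF f] Suc.prems(1)] by (auto simp: M_def)
    have MT: "M \<subseteq> bracket_span H (gen f J H (T k))"
      unfolding M_def derived_series.simps using bracket_span_mono[OF H'(2,3)] by (simp only: H'_def)
    have gen_sub: "gen f J M (T k) \<subseteq> gen f J H (T (Suc k))"
    proof
      fix x assume "x \<in> gen f J M (T k)"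
      then show "x \<in> gen f J H (T (Suc k))"
      proof induction
        case (gen_eig w x)
        show ?case
        proof (cases "\<rho> w = k")
          case True
          show ?thesis
          proof (rule gen_step[OF f J Suc.prems])
            show "T k \<subseteq> ?S - {1}" by (auto simp: T_def)
            show "w \<in> T k" "x \<in> eig f w" by fact+
            show "x \<in> bracket_span H (gen f J H (T k))" using gen_eig MT by blast
            fix u j assume *: "j \<in> T k" "u \<in> spec f" "u \<noteq> 1" "u * j = w"
            then show "u \<in> T (Suc k) \<and> j \<in> T (Suc k)"
              using \<rho>(2)[of u j] gen_eig(1) True by (auto simp: T_def)
          qed
        next
          case False
          then have "w \<in> T (Suc k)" using gen_eig(1) by (auto simp: T_def)
          then show ?thesis using gen_eig M(2) by (intro gen.gen_eig) auto
        qed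
      qed (auto intro: gen.intros)
    qed
    have "2 ^ Suc k - 1 = Suc ?N + ?N" by simp
    then have "derived_series H (2 ^ Suc k - 1) = derived_series M ?N"
      unfolding M_def by (simp only: derived_series_add)
    also have "\<dots> \<subseteq> gen f J M (T k)" using Suc.IH[OF M(1)] M(2) Suc.prems(2) by blast
    also note gen_sub
    finally show ?case .
  qed
  \<comment> \<open>All ranks are below \<open>card ?S\<close>, so no degree survives the last
    stage.\<close>
  have Tn: "T (card ?S) = {}" using \<rho>(1) by (force simp: T_def)
  have "gen f J H {} \<subseteq> J"
  proof
    fix x assume "x \<in> gen f J H {}"
    then show "x \<in> J"
      by induction (auto simp: subspace_add[OF sJ] subspace_scale[OF sJ] ideal_bracket_right[OF J(1)])
  qed
  then have "derived_series H (2 ^ card ?S - 1) \<subseteq> J" using claim[OF H, of "card ?S"] Tn by auto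
  moreover have "derived_series H (2 ^ card ?S) \<subseteq> derived_series H (2 ^ card ?S - 1)"
    using H by (intro derived_series_antimono) (auto simp: graded_subalgebra_def)
  ultimately show ?thesis by blast
qed

section \<open>Derived length of a solvable invariant ideal\<close>

theorem derived_series_graded_bound:
  assumes f: "diag_aut f" and R: "ideal R" "solvable R" "\<And>x. x \<in> R \<Longrightarrow> f x \<in> R"
  shows "derived_series R ((dim (eig f 1) + 1) * 2 ^ card (spec f) + dim (eig f 1)) = {0}"
proof -
  define N where "N = (2::nat) ^ card (spec f)"
  define m where "m = dim (eig f 1)"
  define D where "D = derived_series R"
  have iD: "ideal (D i)" for i unfolding D_def by (rule ideal_derived_series[OF R(1)])
  have fD: "f x \<in> D i" if "x \<in> D i" for i x
    using automorphism_derived_series[OF diag_autD(1)[OF f] R(3)] that by (simp add: D_def)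
  have gD: "graded_subalgebra f (D i)" for i
    using iD[of i] fD[of _ i] by (simp add: graded_subalgebra_def ideal_def)
  have zD: "0 \<in> D i" for i using subspace_0[OF ideal_subspace[OF iD]] .
  have anti: "D j \<subseteq> D i" if "i \<le> j" for i j
    unfolding D_def using R(1) that by (intro derived_series_antimono) (auto simp: ideal_def)
  have add: "D (i + j) = derived_series (D i) j" for i j by (simp add: D_def derived_series_add)
  \<comment> \<open>Kreknin's theorem is applied with a term \<open>D j\<close> of the series itself
    as the ideal, which may be any term that contains the fixed points of
    \<open>D i\<close>.\<close>
  have step: "D (i + N) \<subseteq> D j" if "D i \<inter> eig f 1 \<subseteq> D j" for i j
    unfolding add N_def by (rule kreknin[OF f iD fD gD that])
  define d where "d i = dim (D i \<inter> eig f 1)" for i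
  have sub: "subspace (D i \<inter> eig f 1)" for i
    by (intro subspace_inter ideal_subspace[OF iD] subspace_eig diag_autD(2)[OF f])
  have "D (j * (N + 1)) = {0} \<or> d (j * (N + 1)) + j \<le> m" for j
  proof (induction j)
    case 0
    have "d 0 \<le> m" unfolding d_def m_def by (intro dim_subset) auto
    then show ?case by simp
  next
    case (Suc j)
    let ?i = "j * (N + 1)" and ?i' = "Suc j * (N + 1)"
    have le: "D ?i' \<subseteq> D ?i" by (rule anti) simp
    show ?case
    proof (cases "D ?i = {0}")
      case True then show ?thesis using le zD by blast
    next
      case False
      then have IH: "d ?i + j \<le> m" using Suc by blast
      show ?thesis
      proof (cases "d ?i \<le> d ?i'")
        case True
        then have "D ?i' \<inter> eig f 1 = D ?i \<inter> eig f 1"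
          unfolding d_def using le by (intro subspace_dim_equal sub) auto
        \<comment> \<open>Without a drop in dimension, the fixed points of \<open>D ?i\<close>
          already lie in \<open>D ?i'\<close>, whose index is one more than \<open>?i + N\<close>.
          So two consecutive terms coincide, and solvability makes them zero; this is why the stride
          is N + 1.\<close>
        then have "D (?i + N) \<subseteq> D ?i'" by (intro step) blast
        moreover have "?i' = Suc (?i + N)" by simp
        ultimately have "D (?i + N) \<subseteq> D (Suc (?i + N))" by (simp only:)
        then have stable: "D (Suc (?i + N)) = D (?i + N)" using anti[of "?i + N" "Suc (?i + N)"] by auto
        have "D (?i + N + k) = D (?i + N)" for k
        proof (induction k)
          case (Suc k)
          have "D (?i + N + Suc k) = bracket_span (D (?i + N + k)) (D (?i + N + k))" by (simp add: D_def)
          also have "\<dots> = D (Suc (?i + N))" unfolding Suc by (simp add: D_def)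
          finally show ?case using stable by simp
        qed simp
        moreover obtain l where "D l = {0}" using R(2) by (auto simp: solvable_def D_def)
        then have "D (?i + N + l) = {0}" using anti[of l "?i + N + l"] zD by auto
        ultimately have "D (?i + N) = {0}" by metis
        then show ?thesis using anti[of "?i + N" ?i'] zD by fastforce
      next
        case False then show ?thesis using IH by simp
      qed
    qed
  qed
  from this[of m] have "D (m * (N + 1) + N) = {0}"
  proof
    assume "D (m * (N + 1)) = {0}"
    then show ?thesis using anti[of "m * (N + 1)" "m * (N + 1) + N"] zD by auto
  next
    \<comment> \<open>After m drops no nonzero fixed point is left, and N more steps reach the term
      \<open>D l = {0}\<close>.\<close>
    assume "d (m * (N + 1)) + m \<le> m"
    then have "D (m * (N + 1)) \<inter> eig f 1 \<subseteq> {0}" by (simp add: d_def)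
    moreover obtain l where l: "D l = {0}" using R(2) by (auto simp: solvable_def D_def)
    ultimately have "D (m * (N + 1) + N) \<subseteq> {0}" using step[of "m * (N + 1)" l] by (simp only: l)
    then show ?thesis using zD[of "m * (N + 1) + N"] by (simp only: subset_singleton_iff) auto
  qed
  moreover have "m * (N + 1) + N = (m + 1) * N + m" by (simp add: algebra_simps)
  ultimately show ?thesis by (simp only: D_def m_def N_def)
qed

subsection \<open>The Killing form\<close>

definition kap :: "'a \<Rightarrow> 'a \<Rightarrow> complex"
  where "kap x y = tr (\<lambda>v. bracket x (bracket y v))"

lemma lin_ad_ad: "lin (\<lambda>v. bracket x (bracket y v))"
  by (rule lin_comp[OF lin_ad lin_ad])

lemma kap_sym: "kap x y = kap y x"
  unfolding kap_def by (rule tr_commute[OF lin_ad lin_ad])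

lemma kap_add_left: "kap (x + y) z = kap x z + kap y z"
  by (simp add: kap_def bracket_add_left tr_plus)

lemma kap_scale_left: "kap (scale c x) y = c * kap x y"
  by (simp add: kap_def bracket_scale_left tr_scaled)

lemma kap_add_right: "kap z (x + y) = kap z x + kap z y"
  using kap_add_left[of x y z] by (simp add: kap_sym)

lemma kap_scale_right: "kap x (scale c y) = c * kap x y"
  using kap_scale_left[of c y x] by (simp add: kap_sym)

lemma kap_0_left: "kap 0 y = 0"
  using kap_scale_left[of 0 0 y] by simp

lemma kap_0_right: "kap y 0 = 0"
  using kap_0_left[of y] by (simp add: kap_sym)

lemma kap_sum_right: "kap z (\<Sum>i\<in>I. x i) = (\<Sum>i\<in>I. kap z (x i))"
  by (induction I rule: infinite_finite_induct) (simp_all add: kap_0_right kap_add_right)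

lemma kap_invariant: "kap (bracket x y) z = kap x (bracket y z)"
proof -
  have "kap (bracket x y) z = tr (\<lambda>v. bracket x (bracket y (bracket z v))) - tr (\<lambda>v. bracket y (bracket x (bracket z v)))"
    by (simp add: kap_def ad_bracket[of x y] tr_minus)
  also have "tr (\<lambda>v. bracket y (bracket x (bracket z v))) = tr (\<lambda>v. bracket x (bracket z (bracket y v)))"
    by (rule tr_commute[OF lin_ad lin_ad_ad])
  finally show ?thesis
    by (simp add: kap_def ad_bracket[of y z] tr_minus lin_diff[OF lin_ad])
qed

lemma automorphism_inverse:
  assumes f: "automorphism f"
  obtains g where "lin g" "\<And>v. f (g v) = v" "\<And>v. g (f v) = v"
proof
  show fg: "f (inv f v) = v" "inv f (f v) = v" for v
    using automorphism_bij[OF f] by (simp_all add: surj_f_inv_f bij_is_surj bij_is_inj)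
  note L = automorphism_lin[OF f]
  show "lin (inv f)"
  proof (rule linI)
    show "inv f (u + v) = inv f u + inv f v" for u v
      using fg(2)[of "inv f u + inv f v"] by (simp add: lin_add[OF L] fg)
    show "inv f (scale c u) = scale c (inv f u)" for c u
      using fg(2)[of "scale c (inv f u)"] by (simp add: lin_scale[OF L] fg)
  qed
qed

text \<open>Conjugation by \<open>f\<close> preserves the trace but multiplies \<open>g\<close> by
  \<open>\<nu>\<close>.\<close>

lemma tr_degree:
  assumes f: "automorphism f" and g: "lin g" "\<And>v. f (g v) = scale \<nu> (g (f v))" and "\<nu> \<noteq> 1"
  shows "tr g = 0"
proof -
  obtain f' where f': "lin f'" "\<And>v. f (f' v) = v" "\<And>v. f' (f v) = v" using automorphism_inverse[OF f] by blast
  have "tr (\<lambda>v. f (g (f' v))) = tr (\<lambda>v. g (f' (f v)))"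
    by (rule tr_commute[OF automorphism_lin[OF f] lin_comp[OF g(1) f'(1)]])
  then have "tr g = tr (\<lambda>v. scale \<nu> (g v))" by (simp add: g(2) f')
  then have "tr g = \<nu> * tr g" by (simp add: tr_scaled)
  then show ?thesis using \<open>\<nu> \<noteq> 1\<close> by simp
qed

lemma kap_automorphism: assumes f: "automorphism f" shows "kap (f x) (f y) = kap x y"
proof -
  obtain g where g: "lin g" and fg: "\<And>v. f (g v) = v" "\<And>v. g (f v) = v"
    using automorphism_inverse[OF f] by blast
  have "bracket (f x) (bracket (f y) v) = f (bracket x (bracket y (g v)))" for v
    by (simp add: automorphism_bracket[OF f] fg)
  then have "kap (f x) (f y) = tr (\<lambda>v. f (bracket x (bracket y (g v))))" by (simp add: kap_def)
  also have "\<dots> = tr (\<lambda>v. bracket x (bracket y (g (f v))))"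
    by (rule tr_commute[OF automorphism_lin[OF f] lin_comp[OF lin_ad_ad g]])
  finally show ?thesis by (simp add: kap_def fg)
qed

lemma kap_eig:
  assumes f: "automorphism f" and "x \<in> eig f u" "y \<in> eig f v" "u * v \<noteq> 1"
  shows "kap x y = 0"
proof -
  have "kap x y = u * v * kap x y"
    using kap_automorphism[OF f, of x y] assms(2,3) by (simp add: eig_def kap_scale_left kap_scale_right mult.commute)
  then show ?thesis using assms(4) by (metis mult_cancel_right1)
qed

subsection \<open>Saturated gradings and their weights\<close>

definition saturated :: "('a \<Rightarrow> 'a) \<Rightarrow> 'a set \<Rightarrow> bool"
  where "saturated f R \<longleftrightarrow> (\<forall>h\<in>R. f h = h \<longrightarrow> (\<forall>\<nu>. \<exists>c. eig f \<nu> \<subseteq> gen_eig (bracket h) c))"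

text \<open>Among all gradings with property \<open>Q\<close> one with the most components is taken;
  if some fixed \<open>h\<close> had two eigenvalues on a component, a refinement would have more.
  \<open>Q\<close> is a parameter because it has to record different things: the survival of a fixed
  element that is not ad-nilpotent, or the fact that a given grading is refined.\<close>

lemma ex_saturated:
  assumes f0: "diag_aut f0" "Q f0"
    and step: "\<And>\<beta> \<beta>' h. diag_aut \<beta> \<Longrightarrow> Q \<beta> \<Longrightarrow> diag_aut \<beta>' \<Longrightarrow> h \<in> R \<Longrightarrow> \<beta>' h = h \<Longrightarrow>
      gen_eig (bracket h) 0 \<noteq> UNIV \<Longrightarrow> (\<forall>\<mu>. \<exists>l. eig \<beta>' \<mu> \<subseteq> eig \<beta> l) \<Longrightarrow> eig \<beta>' 1 \<subseteq> eig \<beta> 1 \<Longrightarrow> Q \<beta>'"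
  shows "\<exists>\<beta>. diag_aut \<beta> \<and> Q \<beta> \<and> saturated \<beta> R"
proof -
  let ?P = "\<lambda>\<beta>. diag_aut \<beta> \<and> Q \<beta>"
  have "\<exists>\<beta>. ?P \<beta> \<and> (\<forall>\<gamma>. ?P \<gamma> \<longrightarrow> card (spec \<gamma>) \<le> card (spec \<beta>))"
    by (rule ex_has_greatest_nat[of ?P f0 "\<lambda>\<beta>. card (spec \<beta>)" "Suc dimension"])
      (use f0 finite_spec_card_le in \<open>auto simp: diag_autD less_Suc_eq_le\<close>)
  then obtain \<beta> where \<beta>: "diag_aut \<beta>" "Q \<beta>" "\<And>\<gamma>. diag_aut \<gamma> \<Longrightarrow> Q \<gamma> \<Longrightarrow> card (spec \<gamma>) \<le> card (spec \<beta>)" by blast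
  have "\<exists>c. eig \<beta> \<nu> \<subseteq> gen_eig (bracket h) c" if h: "h \<in> R" "\<beta> h = h" for h \<nu>
  proof (rule ccontr)
    assume neg: "\<not> ?thesis"
    define D where "D = bracket h"
    have D: "lin D" by (simp add: D_def lin_ad)
    note B = diag_autD[OF \<beta>(1)]
    have comm: "D (\<beta> x) = \<beta> (D x)" for x using ad_commute_fixed[OF B(1) h(2)] by (simp add: D_def)
    have Qe: "gproj D c x \<in> eig \<beta> \<nu>" if "x \<in> eig \<beta> \<nu>" for c x
      using gproj_commute[OF D B(2) comm, of c x] that by (simp add: eig_def lin_scale[OF lin_gproj[OF D]])
    have ex: "\<exists>x c. x \<in> eig \<beta> \<nu> \<and> c \<noteq> d \<and> gproj D c x \<noteq> 0" for d
    proof -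
      obtain x where x: "x \<in> eig \<beta> \<nu>" "x \<notin> gen_eig D d" using neg by (auto simp: D_def)
      have "\<exists>c. c \<noteq> d \<and> gproj D c x \<noteq> 0"
      proof (rule ccontr)
        assume "\<not> ?thesis"
        then have "(\<Sum>c\<in>spec D. gproj D c x) \<in> gen_eig D d"
          by (intro subspace_sum[OF subspace_gen_eig[OF D]])
            (metis gproj_mem[OF D] subspace_0[OF subspace_gen_eig[OF D]])
        then show False using x by (simp add: sum_gproj[OF D])
      qed
      then show ?thesis using x by blast
    qed
    obtain x c where x: "x \<in> eig \<beta> \<nu>" "gproj D c x \<noteq> 0" using ex by blast
    obtain y d where y: "y \<in> eig \<beta> \<nu>" "d \<noteq> c" "gproj D d y \<noteq> 0" using ex[of c] by blast
    obtain \<beta>' where \<beta>': "diag_aut \<beta>'" "card (spec \<beta>) < card (spec \<beta>')"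
      "\<forall>\<mu>. \<exists>l. eig \<beta>' \<mu> \<subseteq> eig \<beta> l" "eig \<beta>' 1 \<subseteq> eig \<beta> 1" "\<beta>' h = h"
      using refine_grading[OF \<beta>(1) h(2) Qe[OF x(1)] _ x(2) Qe[OF y(1)] _ y(3)] y(2)
        gproj_mem[OF D, of c x] gproj_mem[OF D, of d y] unfolding D_def by metis
    have "gen_eig (bracket h) 0 \<noteq> UNIV" using neg by blast
    then have "Q \<beta>'" using step[OF \<beta>(1,2) \<beta>'(1) h(1) \<beta>'(5)] \<beta>' by blast
    then show False using \<beta>(3)[OF \<beta>'(1)] \<beta>'(2) by simp
  qed
  then show ?thesis using \<beta> by (auto simp: saturated_def)
qed

end

locale saturated_grading = fd_lie_algebra scale bracket Basis
  for scale :: "complex \<Rightarrow> 'a::ab_group_add \<Rightarrow> 'a" and bracket :: "'a \<Rightarrow> 'a \<Rightarrow> 'a" and Basis :: "'a set" +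
  fixes f :: "'a \<Rightarrow> 'a" and R :: "'a set"
  assumes diag: "diag_aut f" and subR: "subspace R" and sat: "saturated f R"
begin

abbreviation "E \<equiv> eig f"
abbreviation "P \<equiv> gproj f"
abbreviation "S \<equiv> spec f"
definition "A = R \<inter> E 1"
text \<open>The mean eigenvalue of \<open>bracket h\<close> on the component, which is its only
  eigenvalue there if \<open>h\<close> is in \<open>A\<close>. Written as a trace it is linear in
  \<open>h\<close> at once, although the elements of \<open>A\<close> are not yet known to commute;
  on a zero component it is 0.\<close>

definition wt :: "complex \<Rightarrow> 'a \<Rightarrow> complex"
  where "wt \<nu> h = tr (\<lambda>x. bracket h (P \<nu> x)) / of_nat (dim (E \<nu>))"

lemma aut: "automorphism f" and lin_f: "lin f" and finite_S: "finite S"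
  using diag_autD[OF diag] finite_spec by blast+

lemma lin_P: "lin (P \<nu>)" and P_mem: "P \<nu> x \<in> E \<nu>" and P_E: "x \<in> E \<mu> \<Longrightarrow> P \<nu> x = (if \<nu> = \<mu> then x else 0)"
  and sum_P: "(\<Sum>\<nu>\<in>S. P \<nu> x) = x" and P_idem: "P \<nu> (P \<nu> x) = P \<nu> x"
  using lin_gproj[OF lin_f] eig_proj[OF diag] gproj_idem[OF lin_f, of \<nu> \<nu> x] by auto

lemma subE: "subspace (E \<nu>)"
  by (rule subspace_eig[OF lin_f])

lemma E_bracket: "x \<in> E \<mu> \<Longrightarrow> y \<in> E \<nu> \<Longrightarrow> bracket x y \<in> E (\<mu> * \<nu>)"
  by (rule eig_bracket[OF aut])

lemma range_P: "range (P \<nu>) = E \<nu>"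
proof
  show "range (P \<nu>) \<subseteq> E \<nu>" using P_mem by blast
  show "E \<nu> \<subseteq> range (P \<nu>)" using P_E[of _ \<nu> \<nu>] by (metis rangeI subsetI)
qed

lemma A_R: "h \<in> A \<Longrightarrow> h \<in> R" and A_E: "h \<in> A \<Longrightarrow> h \<in> E 1" and A_fix: "h \<in> A \<Longrightarrow> f h = h"
  by (auto simp: A_def eig_def)

lemma subA: "subspace A"
  unfolding A_def by (rule subspace_inter[OF subR subE])

lemma P_ad: assumes "f h = h" shows "P \<nu> (bracket h x) = bracket h (P \<nu> x)"
  using gproj_commute[OF lin_f lin_ad] ad_commute_fixed[OF aut assms] by metis

lemma dim_E_pos: "\<nu> \<in> S \<Longrightarrow> 0 < dim (E \<nu>)"
  using subspace_0[OF subE[of \<nu>]] dim_eq_0[of "E \<nu>"] by (fastforce simp: spec_eq[OF diag])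

lemma ex_nil:
  assumes "E \<nu> \<subseteq> gen_eig (bracket h) c"
  obtains k where "\<And>x. (shift (bracket h) c ^^ k) (P \<nu> x) = 0"
  using gen_eig_nilpotent_uniform[OF lin_ad, of h c] assms P_mem by blast

lemma wt_gen: assumes h: "h \<in> A" shows "E \<nu> \<subseteq> gen_eig (bracket h) (wt \<nu> h)"
proof (cases "\<nu> \<in> S")
  case False
  then show ?thesis using subspace_0[OF subspace_gen_eig[OF lin_ad]] by (auto simp: spec_eq[OF diag])
next
  case True
  obtain c where c: "E \<nu> \<subseteq> gen_eig (bracket h) c"
    using sat A_R[OF h] A_fix[OF h] unfolding saturated_def by blast
  obtain k where k: "\<And>x. (shift (bracket h) c ^^ k) (P \<nu> x) = 0" using ex_nil[OF c] by blast
  have "tr (\<lambda>x. bracket h (P \<nu> x)) = c * of_nat (dim (range (P \<nu>)))"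
    by (rule tr_single_eigenvalue[OF lin_ad lin_P P_idem P_ad[OF A_fix[OF h], symmetric] k])
  then have "wt \<nu> h = c" using dim_E_pos[OF True] by (simp add: wt_def range_P del: dim_eq_0)
  then show ?thesis using c by simp
qed

lemma gen_eig_disjoint: "lin g \<Longrightarrow> x \<in> gen_eig g c \<Longrightarrow> x \<in> gen_eig g d \<Longrightarrow> x \<noteq> 0 \<Longrightarrow> c = d"
  using gproj_gen_eig[of g x c c] gproj_gen_eig[of g x d c] by (auto split: if_splits)

lemma wt_unique: "h \<in> A \<Longrightarrow> x \<in> E \<nu> \<Longrightarrow> x \<noteq> 0 \<Longrightarrow> x \<in> gen_eig (bracket h) c \<Longrightarrow> wt \<nu> h = c"
  using wt_gen gen_eig_disjoint[OF lin_ad] by blast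

lemma wt_bracket_add:
  assumes "h \<in> A" "x \<in> E \<mu>" "y \<in> E \<nu>" "bracket x y \<noteq> 0"
  shows "wt (\<mu> * \<nu>) h = wt \<mu> h + wt \<nu> h"
  using assms wt_gen[OF assms(1)] by (intro wt_unique[OF assms(1) E_bracket[OF assms(2,3)]] gen_eig_ad_bracket) auto

lemma wt_add: "wt \<nu> (h + h') = wt \<nu> h + wt \<nu> h'"
  by (simp add: wt_def bracket_add_left tr_plus add_divide_distrib)

lemma wt_scale: "wt \<nu> (scale c h) = c * wt \<nu> h"
  by (simp add: wt_def bracket_scale_left tr_scaled)

lemma wt_0: "wt \<nu> 0 = 0"
  using wt_scale[of \<nu> 0 0] by simp

lemma wt_sum: "wt \<nu> (\<Sum>i\<in>I. h i) = (\<Sum>i\<in>I. wt \<nu> (h i))"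
  by (induction I rule: infinite_finite_induct) (simp_all add: wt_0 wt_add)

lemma wt_one: assumes h: "h \<in> A" shows "wt 1 h = 0"
proof (cases "h = 0")
  case False
  have "h \<in> gen_eig (bracket h) 0"
    using eig_subset_gen_eig[of "bracket h" 0] by (auto simp: eig_def bracket_self)
  then show ?thesis using wt_unique[OF h A_E[OF h] False] by simp
qed (simp add: wt_0)

text \<open>Both operators preserve the component, and the trace of a commutator vanishes. This
  later forces \<open>A\<close> to be abelian.\<close>

lemma wt_commutator: assumes "f h = h" "f h' = h'" shows "wt \<nu> (bracket h h') = 0"
proof -
  have "tr (\<lambda>x. bracket h (bracket h' (P \<nu> x))) = tr (\<lambda>x. bracket h' (P \<nu> (bracket h x)))"
    by (rule tr_commute[OF lin_ad lin_comp[OF lin_ad lin_P]])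
  then show ?thesis by (simp add: wt_def ad_bracket tr_minus P_ad[OF assms(1)])
qed

lemma kap_self_wt: assumes h: "h \<in> A" shows "kap h h = (\<Sum>\<nu>\<in>S. of_nat (dim (E \<nu>)) * (wt \<nu> h)\<^sup>2)"
proof -
  let ?D = "bracket h"
  have "kap h h = tr (\<lambda>x. \<Sum>\<nu>\<in>S. ?D (?D (P \<nu> x)))"
    unfolding kap_def by (simp only: lin_sum[OF lin_ad, symmetric] sum_P)
  also have "\<dots> = (\<Sum>\<nu>\<in>S. tr (\<lambda>x. ?D (?D (P \<nu> x))))" by (rule tr_setsum)
  also have "\<dots> = (\<Sum>\<nu>\<in>S. (wt \<nu> h)\<^sup>2 * of_nat (dim (range (P \<nu>))))"
  proof (rule sum.cong[OF refl])
    fix \<nu>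
    let ?c = "wt \<nu> h"
    let ?F = "\<lambda>x. ?D (?D x)"
    obtain k where k: "\<And>x. (shift ?D ?c ^^ k) (P \<nu> x) = 0" using ex_nil[OF wt_gen[OF h]] by blast
    \<comment> \<open>The factorization D^2 - c^2 = (D + c)(D - c), with commuting factors, shows
      that the square of \<open>?D\<close> has c^2 as its only eigenvalue on the component.\<close>
    define T where "T x = ?D x + scale ?c x" for x
    have sh: "shift ?F (?c\<^sup>2) x = T (shift ?D ?c x)" "shift ?F (?c\<^sup>2) x = shift ?D ?c (T x)" for x
      by (simp_all add: shift_def T_def lin_diff[OF lin_ad] lin_add[OF lin_ad] lin_scale[OF lin_ad]
          scale_right_diff_distrib scale_right_distrib power2_eq_square)
    have T0: "T 0 = 0" by (simp add: T_def bracket_zero_right)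
    have "(shift ?F (?c\<^sup>2) ^^ j) x = (T ^^ j) ((shift ?D ?c ^^ j) x)" for j x
    proof (induction j arbitrary: x)
      case (Suc j)
      have TS: "T (shift ?D ?c x) = shift ?D ?c (T x)" for x using sh[of x] by simp
      have "(shift ?F (?c\<^sup>2) ^^ Suc j) x = (T ^^ j) ((shift ?D ?c ^^ j) (T (shift ?D ?c x)))"
        by (simp only: funpow_Suc_right o_apply Suc sh(1))
      also have "(shift ?D ?c ^^ j) (T (shift ?D ?c x)) = T ((shift ?D ?c ^^ j) (shift ?D ?c x))"
        by (rule commute_funpow) (simp add: TS)
      finally show ?case by (simp only: funpow_Suc_right o_apply)
    qed simp
    then have "(shift ?F (?c\<^sup>2) ^^ k) (P \<nu> x) = (T ^^ k) 0" for x by (simp add: k)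
    moreover have "(T ^^ k) 0 = 0" by (induction k) (simp_all add: T0)
    ultimately have nil: "(shift ?F (?c\<^sup>2) ^^ k) (P \<nu> x) = 0" for x by simp
    show "tr (\<lambda>x. ?D (?D (P \<nu> x))) = ?c\<^sup>2 * of_nat (dim (range (P \<nu>)))"
      by (rule tr_single_eigenvalue[OF lin_ad_ad lin_P P_idem _ nil]) (simp add: P_ad[OF A_fix[OF h]])
  qed
  finally show ?thesis by (simp add: range_P mult.commute)
qed

text \<open>Polarization of \<open>kap_self_wt\<close>.\<close>

lemma kap_wt: assumes h: "h \<in> A" "h' \<in> A"
  shows "kap h h' = (\<Sum>\<nu>\<in>S. of_nat (dim (E \<nu>)) * (wt \<nu> h * wt \<nu> h'))"
proof -
  have "kap (h + h') (h + h') = (\<Sum>\<nu>\<in>S. of_nat (dim (E \<nu>)) * (wt \<nu> (h + h'))\<^sup>2)"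
    by (rule kap_self_wt[OF subspace_add[OF subA h]])
  then have "kap h h + kap h' h' + 2 * kap h h' =
      (\<Sum>\<nu>\<in>S. of_nat (dim (E \<nu>)) * (wt \<nu> h)\<^sup>2) + (\<Sum>\<nu>\<in>S. of_nat (dim (E \<nu>)) * (wt \<nu> h')\<^sup>2) +
      2 * (\<Sum>\<nu>\<in>S. of_nat (dim (E \<nu>)) * (wt \<nu> h * wt \<nu> h'))"
    by (simp add: kap_add_left kap_add_right kap_sym[of h' h] wt_add power2_sum algebra_simps
        sum.distrib sum_distrib_left)
  then show ?thesis using kap_self_wt[OF h(1)] kap_self_wt[OF h(2)] by simp
qed

lemma wt_inverse:
  assumes "x \<in> E \<mu>" "y \<in> E (1 / \<mu>)" "bracket x y \<noteq> 0" "\<mu> \<in> S" "h \<in> A"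
  shows "wt (1 / \<mu>) h = - wt \<mu> h"
  using wt_bracket_add[OF assms(5,1,2,3)] wt_one[OF assms(5)] spec_nonzero[OF diag assms(4)]
  by (simp add: eq_neg_iff_add_eq_0 add.commute)

text \<open>The trace of \<open>[x, y]\<close> vanishes on the sum of the components whose weight lies in the
  \<open>\<mu>\<close>-string through \<open>\<nu>\<close>, because this sum is stable under \<open>x\<close> and \<open>y\<close>.\<close>

lemma wt_string:
  assumes x: "x \<in> E \<mu>" and y: "y \<in> E (1 / \<mu>)" and h: "bracket x y \<in> A" and \<mu>: "\<mu> \<in> S" and \<nu>: "\<nu> \<in> S"
  shows "\<exists>r::real. wt \<nu> (bracket x y) = of_real r * wt \<mu> (bracket x y)"
proof (cases "bracket x y = 0")
  case True then show ?thesis by (simp add: wt_0)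
next
  case nz: False
  \<comment> \<open>Weights are compared as functionals on \<open>A\<close>: a component belongs to
    the string if its weight differs from that of \<open>\<nu>\<close> by an integer multiple of
    that of \<open>\<mu>\<close>.\<close>
  define C where "C = {\<omega> \<in> S. \<exists>j::int. \<forall>a\<in>A. wt \<omega> a = wt \<nu> a + of_int j * wt \<mu> a}"
  define PC where "PC v = (\<Sum>\<omega>\<in>C. P \<omega> v)" for v
  have CS: "C \<subseteq> S" and finC: "finite C" using finite_S by (auto simp: C_def intro: finite_subset)
  have "\<nu> \<in> C" using \<nu> by (auto simp: C_def intro: exI[of _ 0])
  have lPC: "lin PC" unfolding PC_def[abs_def] by (rule lin_setsum) (rule lin_P)
  have PC_E: "PC v = (if \<omega> \<in> C then v else 0)" if "v \<in> E \<omega>" for v \<omega>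
  proof -
    have "PC v = (\<Sum>\<kappa>\<in>C. if \<kappa> = \<omega> then v else 0)" unfolding PC_def by (intro sum.cong refl P_E[OF that])
    then show ?thesis using finC by simp
  qed
  \<comment> \<open>A bracket with \<open>z\<close> moves weights by \<open>s\<close> steps along
    the string, so it neither enters nor leaves the string and commutes with the projection
    \<open>PC\<close>.\<close>
  have move: "PC (bracket z v) = bracket z (PC v)"
    if z: "z \<in> E \<kappa>" and w: "\<And>a. a \<in> A \<Longrightarrow> wt \<kappa> a = of_int s * wt \<mu> a" and v: "v \<in> E \<omega>" "\<omega> \<in> S" for z \<kappa> s v \<omega>
  proof (cases "bracket z v = 0")
    case True
    then show ?thesis using PC_E[OF v(1)] lin_0[OF lPC] by (simp add: bracket_zero_right)
  next
    case False
    have e: "bracket z v \<in> E (\<kappa> * \<omega>)" by (rule E_bracket[OF z v(1)])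
    then have "\<kappa> * \<omega> \<in> S" using mem_spec[OF diag] False by blast
    have sum: "wt (\<kappa> * \<omega>) a = wt \<omega> a + of_int s * wt \<mu> a" if "a \<in> A" for a
      using wt_bracket_add[OF that z v(1) False] w[OF that] by simp
    have "\<kappa> * \<omega> \<in> C \<longleftrightarrow> \<omega> \<in> C"
    proof
      assume "\<omega> \<in> C"
      then obtain j :: int where "\<forall>a\<in>A. wt \<omega> a = wt \<nu> a + of_int j * wt \<mu> a" by (auto simp: C_def)
      then have "\<forall>a\<in>A. wt (\<kappa> * \<omega>) a = wt \<nu> a + of_int (j + s) * wt \<mu> a" by (simp add: sum distrib_right)
      then show "\<kappa> * \<omega> \<in> C" using \<open>\<kappa> * \<omega> \<in> S\<close> unfolding C_def by blast
    next
      assume "\<kappa> * \<omega> \<in> C"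
      then obtain j :: int where "\<forall>a\<in>A. wt (\<kappa> * \<omega>) a = wt \<nu> a + of_int j * wt \<mu> a" by (auto simp: C_def)
      then have "\<forall>a\<in>A. wt \<omega> a = wt \<nu> a + of_int (j - s) * wt \<mu> a"
        by (simp add: sum left_diff_distrib eq_diff_eq algebra_simps)
      then show "\<omega> \<in> C" using v(2) unfolding C_def by blast
    qed
    then show ?thesis using PC_E[OF e] PC_E[OF v(1)] by (simp add: bracket_zero_right)
  qed
  have move': "PC (bracket z v) = bracket z (PC v)"
    if "z \<in> E \<kappa>" "\<And>a. a \<in> A \<Longrightarrow> wt \<kappa> a = of_int s * wt \<mu> a" for z \<kappa> s v
  proof -
    have "PC (bracket z v) = PC (bracket z (\<Sum>\<omega>\<in>S. P \<omega> v))" by (simp add: sum_P)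
    also have "\<dots> = (\<Sum>\<omega>\<in>S. PC (bracket z (P \<omega> v)))" by (simp only: lin_sum[OF lin_ad] lin_sum[OF lPC])
    also have "\<dots> = (\<Sum>\<omega>\<in>S. bracket z (PC (P \<omega> v)))"
      by (intro sum.cong refl move[OF that P_mem])
    also have "\<dots> = bracket z (PC (\<Sum>\<omega>\<in>S. P \<omega> v))" by (simp only: lin_sum[OF lin_ad] lin_sum[OF lPC])
    finally show ?thesis by (simp add: sum_P)
  qed
  have cx: "PC (bracket x v) = bracket x (PC v)" for v by (rule move'[OF x, of 1]) simp
  have cy: "PC (bracket y v) = bracket y (PC v)" for v
    by (rule move'[OF y, of "-1"]) (simp add: wt_inverse[OF x y nz \<mu>])
  let ?h = "bracket x y"
  have "tr (\<lambda>v. bracket x (PC (bracket y v))) = tr (\<lambda>v. bracket y (bracket x (PC v)))"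
    by (rule tr_commute[OF lin_comp[OF lin_ad lPC] lin_ad])
  then have "tr (\<lambda>v. bracket ?h (PC v)) = 0" by (simp add: ad_bracket tr_minus cy)
  moreover have "tr (\<lambda>v. bracket ?h (PC v)) = (\<Sum>\<omega>\<in>C. tr (\<lambda>v. bracket ?h (P \<omega> v)))"
    unfolding PC_def by (simp add: lin_sum[OF lin_ad] tr_setsum)
  moreover have "tr (\<lambda>v. bracket ?h (P \<omega> v)) = of_nat (dim (E \<omega>)) * wt \<omega> ?h" if "\<omega> \<in> C" for \<omega>
    using dim_E_pos[of \<omega>] that CS by (auto simp: wt_def simp del: dim_eq_0)
  ultimately have z: "(\<Sum>\<omega>\<in>C. of_nat (dim (E \<omega>)) * wt \<omega> ?h) = 0" by simp
  have "\<forall>\<omega>\<in>C. \<exists>j::int. wt \<omega> ?h = wt \<nu> ?h + of_int j * wt \<mu> ?h" using h by (auto simp: C_def)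
  then obtain j :: "complex \<Rightarrow> int" where j: "\<And>\<omega>. \<omega> \<in> C \<Longrightarrow> wt \<omega> ?h = wt \<nu> ?h + of_int (j \<omega>) * wt \<mu> ?h" by metis
  \<comment> \<open>The vanishing trace reads d * \<open>wt \<nu> ?h\<close> + e *
    \<open>wt \<mu> ?h\<close> = 0, where d is the total dimension of the string and is positive
    because \<open>\<nu>\<close> belongs to it.\<close>
  define d where "d = (\<Sum>\<omega>\<in>C. real (dim (E \<omega>)))"
  define e where "e = (\<Sum>\<omega>\<in>C. real (dim (E \<omega>)) * of_int (j \<omega>))"
  have "(\<Sum>\<omega>\<in>C. of_nat (dim (E \<omega>)) * wt \<omega> ?h) = of_real d * wt \<nu> ?h + of_real e * wt \<mu> ?h"
  proof -
    have "(\<Sum>\<omega>\<in>C. of_nat (dim (E \<omega>)) * wt \<omega> ?h) =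
        (\<Sum>\<omega>\<in>C. of_nat (dim (E \<omega>)) * wt \<nu> ?h + of_nat (dim (E \<omega>)) * of_int (j \<omega>) * wt \<mu> ?h)"
      by (intro sum.cong refl) (simp add: j distrib_left mult.assoc)
    then show ?thesis by (simp add: d_def e_def sum.distrib sum_distrib_right)
  qed
  then have *: "of_real d * wt \<nu> ?h = of_real (- e) * wt \<mu> ?h" using z by (simp add: eq_neg_iff_add_eq_0)
  have "0 < d" unfolding d_def using \<open>\<nu> \<in> C\<close> finC dim_E_pos CS by (intro sum_pos2[of C \<nu>]) auto
  then have "wt \<nu> ?h = of_real (- e / d) * wt \<mu> ?h" using * by (simp add: field_simps)
  then show ?thesis by blast
qed

end

subsection \<open>Cartan's criterion\<close>

context fd_lie_algebra
begin

text \<open>In a saturated grading the elements of \<open>A\<close> are sums of brackets of opposite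
  degrees, since \<open>R\<close> is perfect. At such a bracket all weights are real multiples of
  one of them, so the vanishing of \<open>kap\<close> is the vanishing of a sum of squares and all
  weights are 0. Thus the elements of \<open>A\<close> are ad-nilpotent, which leaves only the
  trivial grading, where \<open>A\<close> is \<open>R\<close>.\<close>

lemma kap_zero_perfect_nilpotent:
  assumes R: "ideal R" "bracket_span R R = R" "\<And>g x. automorphism g \<Longrightarrow> x \<in> R \<Longrightarrow> g x \<in> R"
    and kap0: "\<And>x y. x \<in> R \<Longrightarrow> y \<in> R \<Longrightarrow> kap x y = 0" and h: "h \<in> R"
  shows "gen_eig (bracket h) 0 = UNIV"
proof -
  have sR: "subspace R" by (rule ideal_subspace[OF R(1)])
  \<comment> \<open>As soon as the grading is nontrivial, a fixed element that is not ad-nilpotent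
    is kept as a witness; the vanishing of the weights will contradict it.\<close>
  define Q where "Q \<beta> \<longleftrightarrow> \<beta> = id \<or> (\<exists>h\<in>R. \<beta> h = h \<and> gen_eig (bracket h) 0 \<noteq> UNIV)" for \<beta>
  have "\<exists>\<beta>. diag_aut \<beta> \<and> Q \<beta> \<and> saturated \<beta> R"
    by (rule ex_saturated[of id]) (auto simp: Q_def diag_aut_id)
  then obtain \<beta> where \<beta>: "diag_aut \<beta>" "Q \<beta>" "saturated \<beta> R" by blast
  interpret saturated_grading scale bracket Basis \<beta> R
    by unfold_locales (use \<beta> sR in auto)
  have PR: "P \<nu> x \<in> R" if "x \<in> R" for \<nu> x
    by (rule gproj_invariant[OF lin_f sR R(3)[OF aut] that])
  have zero: "wt \<nu> (bracket x y) = 0"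
    if x: "x \<in> R" "x \<in> E \<mu>" and y: "y \<in> R" "y \<in> E (1 / \<mu>)" and ms: "\<mu> \<in> S" "\<nu> \<in> S" for x y \<mu> \<nu>
  proof -
    let ?h = "bracket x y"
    have "?h \<in> E 1" using E_bracket[OF x(2) y(2)] spec_nonzero[OF diag ms(1)] by simp
    then have hA: "?h \<in> A" using ideal_bracket_right[OF R(1) y(1)] by (simp add: A_def)
    obtain r :: "complex \<Rightarrow> real" where r: "\<And>\<omega>. \<omega> \<in> S \<Longrightarrow> wt \<omega> ?h = of_real (r \<omega>) * wt \<mu> ?h"
      using wt_string[OF x(2) y(2) hA ms(1)] by metis
    have "0 = kap ?h ?h" using kap0 A_R[OF hA] by simp
    also have "\<dots> = (\<Sum>\<omega>\<in>S. of_nat (dim (E \<omega>)) * (of_real (r \<omega>) * wt \<mu> ?h)\<^sup>2)"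
      unfolding kap_self_wt[OF hA] by (intro sum.cong refl) (simp add: r)
    also have "\<dots> = of_real (\<Sum>\<omega>\<in>S. real (dim (E \<omega>)) * (r \<omega>)\<^sup>2) * (wt \<mu> ?h)\<^sup>2"
      by (simp add: sum_distrib_right power_mult_distrib mult.assoc)
    finally have "of_real (\<Sum>\<omega>\<in>S. real (dim (E \<omega>)) * (r \<omega>)\<^sup>2) * (wt \<mu> ?h)\<^sup>2 = 0" by (rule sym)
    then have "wt \<mu> ?h = 0 \<or> (\<Sum>\<omega>\<in>S. real (dim (E \<omega>)) * (r \<omega>)\<^sup>2) = 0"
      unfolding mult_eq_0_iff of_real_eq_0_iff by auto
    then have "wt \<mu> ?h = 0"
    proof
      assume "(\<Sum>\<omega>\<in>S. real (dim (E \<omega>)) * (r \<omega>)\<^sup>2) = 0"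
      then have "real (dim (E \<mu>)) * (r \<mu>)\<^sup>2 = 0"
        using finite_S ms(1) by (subst (asm) sum_nonneg_eq_0_iff) auto
      then have "r \<mu> = 0" using dim_E_pos[OF ms(1)] by (simp del: dim_eq_0)
      then show "wt \<mu> ?h = 0" using r[OF ms(1)] by simp
    qed
    then show ?thesis using r[OF ms(2)] by simp
  qed
  have wt0: "wt \<nu> h = 0" if hA: "h \<in> A" and \<nu>: "\<nu> \<in> S" for h \<nu>
  proof -
    have "wt \<nu> (P 1 z) = 0" if "z \<in> bracket_span R R" for z
      using that unfolding bracket_span_def
    proof (induction rule: span_induct_alt)
      case base show ?case by (simp add: lin_0[OF lin_P] wt_0)
    next
      case (step c u z)
      then obtain a b where ab: "a \<in> R" "b \<in> R" "u = bracket a b" by blast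
      have "P 1 u = (\<Sum>\<mu>\<in>S. \<Sum>\<kappa>\<in>S. P 1 (bracket (P \<mu> a) (P \<kappa> b)))"
        unfolding ab(3) lin_sum[OF lin_P, symmetric] lin_sum[OF lin_ad, symmetric] lin_sum[OF lin_ad_right, symmetric] sum_P ..
      then have "wt \<nu> (P 1 u) = (\<Sum>\<mu>\<in>S. \<Sum>\<kappa>\<in>S. wt \<nu> (P 1 (bracket (P \<mu> a) (P \<kappa> b))))"
        by (simp add: wt_sum)
      also have "\<dots> = 0"
      proof (intro sum.neutral ballI)
        fix \<mu> \<kappa> assume \<mu>\<kappa>: "\<mu> \<in> S" "\<kappa> \<in> S"
        show "wt \<nu> (P 1 (bracket (P \<mu> a) (P \<kappa> b))) = 0"
        proof (cases "\<mu> * \<kappa> = 1")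
          case True
          then have "\<kappa> = 1 / \<mu>" using spec_nonzero[OF diag \<mu>\<kappa>(1)] by (simp add: field_simps)
          then show ?thesis
            using zero[OF PR[OF ab(1)] P_mem PR[OF ab(2)] _ \<mu>\<kappa>(1) \<nu>] P_mem[of \<kappa> b]
              P_E[OF E_bracket[OF P_mem P_mem], of 1 \<mu> a \<kappa> b] True by simp
        next
          case False
          then show ?thesis using P_E[OF E_bracket[OF P_mem P_mem], of 1 \<mu> a \<kappa> b] by (simp add: wt_0)
        qed
      qed
      finally show ?case using step by (simp add: lin_add[OF lin_P] lin_scale[OF lin_P] wt_add wt_scale)
    qed
    then have "wt \<nu> (P 1 h) = 0" using A_R[OF hA] R(2) by blast
    then show ?thesis using A_E[OF hA] P_E[of h 1 1] by simp
  qed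
  have nilA: "gen_eig (bracket h) 0 = UNIV" if h: "h \<in> A" for h
  proof -
    have "E \<nu> \<subseteq> gen_eig (bracket h) 0" if "\<nu> \<in> S" for \<nu> using wt_gen[OF h, of \<nu>] wt0[OF h that] by simp
    then have "(\<Sum>\<nu>\<in>S. P \<nu> x) \<in> gen_eig (bracket h) 0" for x
      using P_mem by (intro subspace_sum[OF subspace_gen_eig[OF lin_ad]]) blast
    then show ?thesis by (simp add: sum_P set_eq_iff)
  qed
  then have "\<beta> = id" using \<beta>(2) unfolding Q_def A_def by (auto simp: eig_def)
  then have "E 1 = UNIV" by (simp add: eig_def)
  then have "A = R" by (simp add: A_def)
  then show ?thesis using nilA h by simp
qed

text \<open>Engel's theorem for \<open>R\<close> acting on the pair {0} inside
  \<open>R\<close>.\<close>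

lemma kap_zero_perfect_center:
  assumes R: "ideal R" "bracket_span R R = R" "\<And>g x. automorphism g \<Longrightarrow> x \<in> R \<Longrightarrow> g x \<in> R"
    and kap0: "\<And>x y. x \<in> R \<Longrightarrow> y \<in> R \<Longrightarrow> kap x y = 0" and nz: "R \<noteq> {0}"
  shows "\<exists>v\<in>R. v \<noteq> 0 \<and> (\<forall>x\<in>R. bracket x v = 0)"
proof -
  have nil: "\<exists>k. \<forall>v. (bracket x ^^ k) v = 0" if "x \<in> R" for x
  proof -
    have "shift (bracket x) 0 = bracket x" by (simp add: shift_def fun_eq_iff)
    moreover have "gen_eig (bracket x) 0 = UNIV"
      by (rule kap_zero_perfect_nilpotent[of R]) (use R kap0 that in auto)
    ultimately show ?thesis using gen_eig_nilpotent_uniform[OF lin_ad, of x 0] by auto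
  qed
  have sR: "subspace R" by (rule ideal_subspace[OF R(1)])
  have "\<exists>u\<in>R - {0}. \<forall>x\<in>R. bracket x u \<in> {0}"
    by (rule engel[OF sR _ nil sR subspace_single_0])
      (use nz subspace_0[OF sR] ideal_bracket_right[OF R(1)] in \<open>auto simp: bracket_zero_right\<close>)
  then show ?thesis by auto
qed

end

subsection \<open>Obtuse systems of vectors\<close>

text \<open>The vectors are the columns of \<open>r\<close> in a Euclidean space with weights
  \<open>d\<close>, \<open>q\<close> is their Gram matrix, and \<open>g\<close> defines an open
  half-space containing them all. Split \<open>a\<close> into its positive and negative parts P and
  N. The combination of the vectors with coefficients P has squared length \<Sum> N P q \<le> 0, so
  it is zero, and pairing it with \<open>g\<close> forces P = 0; then the same follows for
  N.\<close>

lemma obtuse_half_space_independent: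
  fixes d :: "'i \<Rightarrow> real" and r :: "'i \<Rightarrow> 'j \<Rightarrow> real" and q :: "'j \<Rightarrow> 'j \<Rightarrow> real"
  assumes fin: "finite I" "finite B" and d: "\<And>i. i \<in> I \<Longrightarrow> 0 < d i"
    and q: "\<And>m n. m \<in> B \<Longrightarrow> n \<in> B \<Longrightarrow> q m n = (\<Sum>i\<in>I. d i * (r i m * r i n))"
    and obtuse: "\<And>m n. m \<in> B \<Longrightarrow> n \<in> B \<Longrightarrow> m \<noteq> n \<Longrightarrow> q m n \<le> 0"
    and pos: "\<And>m. m \<in> B \<Longrightarrow> 0 < (\<Sum>i\<in>I. d i * (g i * r i m))"
    and a: "\<And>n. n \<in> B \<Longrightarrow> (\<Sum>m\<in>B. a m * q m n) = 0"
  shows "\<forall>m\<in>B. a m = 0"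
proof -
  define P N where "P m = max (a m) 0" and "N m = max (- a m) 0" for m
  define ip where "ip x y = (\<Sum>i\<in>I. d i * (x i * y i))" for x y :: "'i \<Rightarrow> real"
  define c where "c b i = (\<Sum>m\<in>B. b m * r i m)" for b :: "'j \<Rightarrow> real" and i
  have ip_c: "ip (c b) y = (\<Sum>m\<in>B. b m * ip (\<lambda>i. r i m) y)" for b y
  proof -
    have "ip (c b) y = (\<Sum>i\<in>I. \<Sum>m\<in>B. b m * (d i * (r i m * y i)))"
      unfolding ip_def c_def by (simp add: sum_distrib_left sum_distrib_right mult_ac)
    also have "\<dots> = (\<Sum>m\<in>B. b m * ip (\<lambda>i. r i m) y)"
      unfolding ip_def by (subst sum.swap) (simp add: sum_distrib_left)
    finally show ?thesis .
  qed
  have ip_sym: "ip x y = ip y x" for x y by (simp add: ip_def mult.commute)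
  have ipr: "ip (\<lambda>i. r i m) (\<lambda>i. r i n) = q m n" if "m \<in> B" "n \<in> B" for m n
    using that by (simp add: ip_def q)
  have ipcc: "ip (c b) (c b') = (\<Sum>m\<in>B. \<Sum>n\<in>B. b m * b' n * q m n)" for b b'
  proof -
    have "ip (c b) (c b') = (\<Sum>m\<in>B. b m * ip (\<lambda>i. r i m) (c b'))" by (rule ip_c)
    also have "\<dots> = (\<Sum>m\<in>B. b m * (\<Sum>n\<in>B. b' n * q n m))"
    proof (intro sum.cong refl arg_cong2[where f = "(*)"])
      fix m assume m: "m \<in> B"
      have "ip (\<lambda>i. r i m) (c b') = ip (c b') (\<lambda>i. r i m)" by (rule ip_sym)
      also have "\<dots> = (\<Sum>n\<in>B. b' n * ip (\<lambda>i. r i n) (\<lambda>i. r i m))" by (rule ip_c)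
      also have "\<dots> = (\<Sum>n\<in>B. b' n * q n m)" by (intro sum.cong refl) (simp add: ipr m)
      finally show "ip (\<lambda>i. r i m) (c b') = (\<Sum>n\<in>B. b' n * q n m)" .
    qed
    also have "\<dots> = (\<Sum>m\<in>B. \<Sum>n\<in>B. b m * b' n * q m n)"
      unfolding sum_distrib_left
      by (intro sum.cong refl) (metis ip_sym ipr mult.assoc)
    finally show ?thesis .
  qed
  have aPN: "a m = P m - N m" for m by (simp add: P_def N_def)
  have eq: "(\<Sum>m\<in>B. P m * q m n) = (\<Sum>m\<in>B. N m * q m n)" if "n \<in> B" for n
    using a[OF that] by (simp add: aPN left_diff_distrib sum_subtractf)
  have nonpos: "(\<Sum>m\<in>B. \<Sum>n\<in>B. N m * P n * q m n) \<le> 0"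
  proof (intro sum_nonpos)
    fix m n assume mn: "m \<in> B" "n \<in> B"
    show "N m * P n * q m n \<le> 0"
    \<comment> \<open>The diagonal terms, the only ones in which \<open>q\<close> may be positive,
      vanish because \<open>P m\<close> or \<open>N m\<close> is 0.\<close>
    proof (cases "m = n")
      case True then show ?thesis by (simp add: P_def N_def)
    next
      case False
      then show ?thesis using obtuse[OF mn] by (intro mult_nonneg_nonpos) (auto simp: P_def N_def)
    qed
  qed
  have sq: "\<forall>i\<in>I. x i = 0" if "ip x x \<le> 0" for x
  proof
    fix i assume i: "i \<in> I"
    have nn: "0 \<le> d j * (x j * x j)" if "j \<in> I" for j
      using d[OF that] by (simp add: mult_nonneg_nonneg)
    then have "0 \<le> ip x x" unfolding ip_def by (intro sum_nonneg) blast
    then have "ip x x = 0" using that by simp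
    then have "d i * (x i * x i) = 0" unfolding ip_def using nn fin(1) i by (simp add: sum_nonneg_eq_0_iff)
    then show "x i = 0" using d[OF i] by simp
  qed
  have zero: "\<forall>m\<in>B. b m = 0" if "\<forall>i\<in>I. c b i = 0" "\<And>m. 0 \<le> b m" for b
  proof
    fix m assume m: "m \<in> B"
    have pos': "0 < ip (\<lambda>i. r i m) g" if "m \<in> B" for m
      using pos[OF that] by (simp add: ip_def mult.commute)
    have "0 = ip (c b) g" unfolding ip_def using that(1) by simp
    also have "\<dots> = (\<Sum>m\<in>B. b m * ip (\<lambda>i. r i m) g)" by (rule ip_c)
    finally have "(\<Sum>m\<in>B. b m * ip (\<lambda>i. r i m) g) = 0" by simp
    moreover have "0 \<le> b n * ip (\<lambda>i. r i n) g" if "n \<in> B" for n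
      using pos'[OF that] \<open>\<And>m. 0 \<le> b m\<close> by (simp add: mult_nonneg_nonneg less_imp_le)
    ultimately have "b m * ip (\<lambda>i. r i m) g = 0" using fin(2) m by (simp add: sum_nonneg_eq_0_iff)
    then show "b m = 0" using pos'[OF m] by simp
  qed
  have "ip (c P) (c P) = (\<Sum>n\<in>B. P n * (\<Sum>m\<in>B. P m * q m n))"
    unfolding ipcc by (subst sum.swap) (simp add: sum_distrib_left mult_ac)
  also have "\<dots> = (\<Sum>n\<in>B. P n * (\<Sum>m\<in>B. N m * q m n))" by (simp add: eq)
  also have "\<dots> = (\<Sum>m\<in>B. \<Sum>n\<in>B. N m * P n * q m n)"
    by (subst sum.swap) (simp add: sum_distrib_left mult_ac)
  finally have "ip (c P) (c P) \<le> 0" using nonpos by simp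
  then have "\<forall>m\<in>B. P m = 0" using zero[of P] sq by (simp add: P_def)
  moreover have "ip (c N) (c N) \<le> 0"
  proof -
    have "ip (c N) (c N) = (\<Sum>n\<in>B. N n * (\<Sum>m\<in>B. N m * q m n))"
      unfolding ipcc by (subst sum.swap) (simp add: sum_distrib_left mult_ac)
    also have "\<dots> = (\<Sum>n\<in>B. N n * (\<Sum>m\<in>B. P m * q m n))" by (simp add: eq)
    also have "\<dots> = 0" using \<open>\<forall>m\<in>B. P m = 0\<close> by simp
    finally show ?thesis by simp
  qed
  then have "\<forall>m\<in>B. N m = 0" using zero[of N] sq by (simp add: N_def)
  ultimately show ?thesis by (simp add: aPN)
qed

text \<open>The coefficients are adjusted one vector at a time. Adding s to the coefficient of w
  changes the sum at m by s * \<open>q w m\<close>, so each m treated before, and also w itself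
  since \<open>q w w\<close> is nonzero, excludes at most one value of s.\<close>

lemma ex_generic_combination:
  fixes q :: "'j \<Rightarrow> 'j \<Rightarrow> real"
  assumes "finite B" and pos: "\<And>m. m \<in> B \<Longrightarrow> q m m \<noteq> 0"
  shows "\<exists>k. \<forall>m\<in>B. (\<Sum>b\<in>B. k b * q b m) \<noteq> 0"
proof -
  have "\<exists>k. \<forall>m\<in>F. (\<Sum>b\<in>B. k b * q b m) \<noteq> 0" if "finite F" "F \<subseteq> B" for F
    using that
  proof (induction F)
    case (insert w F)
    then obtain k where k: "\<forall>m\<in>F. (\<Sum>b\<in>B. k b * q b m) \<noteq> 0" by blast
    define L where "L m = (\<Sum>b\<in>B. k b * q b m)" for m
    have w: "w \<in> B" using insert by simp
    have "finite {s. L m + s * q w m = 0}" if "m \<in> insert w F" for m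
    proof (cases "q w m = 0")
      case True
      then have "m \<noteq> w" using pos[OF w] by auto
      then show ?thesis using k that True by (auto simp: L_def)
    next
      case False
      then have "{s. L m + s * q w m = 0} \<subseteq> {- L m / q w m}" by (auto simp: field_simps)
      then show ?thesis using finite_subset by blast
    qed
    then have "finite (\<Union>m\<in>insert w F. {s. L m + s * q w m = 0})" using insert.hyps by blast
    then obtain s where s: "s \<notin> (\<Union>m\<in>insert w F. {s. L m + s * q w m = 0})"
      using ex_new_if_finite[OF infinite_UNIV_char_0] by blast
    have "(\<Sum>b\<in>B. (k b + (if b = w then s else 0)) * q b m) = L m + s * q w m" for m
    proof -
      have "(\<Sum>b\<in>B. (k b + (if b = w then s else 0)) * q b m) = L m + (\<Sum>b\<in>B. if b = w then s * q w m else 0)"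
        unfolding L_def sum.distrib[symmetric] by (rule sum.cong) (auto simp: distrib_right)
      then show ?thesis using assms(1) w by simp
    qed
    then show ?case using s by (intro exI[of _ "\<lambda>b. k b + (if b = w then s else 0)"]) auto
  qed simp
  then show ?thesis using assms(1) by blast
qed

subsection \<open>Counting the roots of a saturated grading\<close>

text \<open>\<open>R\<close> is to be the complement of the radical inside the whole space, with the
  radical acting as zero. So \<open>kap\<close> is nondegenerate on \<open>R\<close> only, and
  \<open>inner\<close> lets invariance under \<open>R\<close> pass to invariance under the whole
  algebra. Dimensions are measured by \<open>\<alpha>\<close>, whose grading is refined by that of
  \<open>f\<close>.\<close>

locale semisimple_grading = saturated_grading scale bracket Basis f R
  for scale :: "complex \<Rightarrow> 'a::ab_group_add \<Rightarrow> 'a" and bracket :: "'a \<Rightarrow> 'a \<Rightarrow> 'a" and Basis :: "'a set"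
    and f :: "'a \<Rightarrow> 'a" and R :: "'a set" +
  fixes \<alpha> :: "'a \<Rightarrow> 'a"
  assumes ideal_R: "ideal R" and perfect: "bracket_span R R = R" and fR: "\<And>x. x \<in> R \<Longrightarrow> f x \<in> R"
    and nondeg: "\<And>x. x \<in> R \<Longrightarrow> (\<And>y. y \<in> R \<Longrightarrow> kap x y = 0) \<Longrightarrow> x = 0"
    and inner: "\<And>x. \<exists>r\<in>R. \<forall>y. bracket x y = bracket r y"
    and \<alpha>: "diag_aut \<alpha>"
    and refine: "\<And>\<mu>. \<exists>l. eig f \<mu> \<subseteq> eig \<alpha> l" and refine1: "eig f 1 \<subseteq> eig \<alpha> 1"
begin

lemma PR: "x \<in> R \<Longrightarrow> P \<nu> x \<in> R"
  by (rule gproj_invariant[OF lin_f subR fR])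

abbreviation "RE \<mu> \<equiv> R \<inter> E \<mu>"

lemma P_RE: "x \<in> R \<Longrightarrow> P \<nu> x \<in> RE \<nu>"
  using PR P_mem by blast

lemma RE_bracket: "x \<in> RE \<mu> \<Longrightarrow> y \<in> RE \<nu> \<Longrightarrow> bracket x y \<in> RE (\<mu> * \<nu>)"
  using E_bracket ideal_bracket_right[OF ideal_R] by blast

lemma subRE: "subspace (RE \<mu>)"
  by (rule subspace_inter[OF subR subE])

lemma A_RE: "A = RE 1"
  by (simp add: A_def)

section \<open>The fixed points as a torus\<close>

lemma ex_pair:
  assumes x: "x \<in> RE \<mu>" "x \<noteq> 0" shows "\<exists>y\<in>RE (1 / \<mu>). kap x y = 1"
proof -
  have "\<mu> \<noteq> 0" using x mem_spec[OF diag] spec_nonzero[OF diag] by blast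
  obtain y where y: "y \<in> R" "kap x y \<noteq> 0" using nondeg x by blast
  have "kap x y = (\<Sum>\<nu>\<in>S. kap x (P \<nu> y))" by (simp only: kap_sum_right[symmetric] sum_P)
  also have "\<dots> = (\<Sum>\<nu>\<in>S. if \<nu> = 1 / \<mu> then kap x (P \<nu> y) else 0)"
    by (intro sum.cong refl) (use x kap_eig[OF aut _ P_mem] \<open>\<mu> \<noteq> 0\<close> in \<open>auto simp: field_simps\<close>)
  finally have "kap x (P (1 / \<mu>) y) \<noteq> 0" using y(2) finite_S by (auto split: if_splits)
  moreover have "scale (1 / kap x (P (1 / \<mu>) y)) (P (1 / \<mu>) y) \<in> RE (1 / \<mu>)"
    by (rule subspace_scale[OF subRE P_RE[OF y(1)]])
  ultimately show ?thesis
    by (intro bexI[of _ "scale (1 / kap x (P (1 / \<mu>) y)) (P (1 / \<mu>) y)"]) (simp_all add: kap_scale_right)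
qed

lemma A_nondeg: "h \<in> A \<Longrightarrow> (\<And>h'. h' \<in> A \<Longrightarrow> kap h h' = 0) \<Longrightarrow> h = 0"
  using ex_pair[of h 1] by (auto simp: A_RE)

text \<open>On \<open>A\<close> the form \<open>kap\<close> is expressed by the weights alone, so an
  element at which all weights vanish is orthogonal to \<open>A\<close>.\<close>

lemma wt_ext: "h \<in> A \<Longrightarrow> (\<And>\<nu>. \<nu> \<in> S \<Longrightarrow> wt \<nu> h = 0) \<Longrightarrow> h = 0"
  by (rule A_nondeg) (simp_all add: kap_wt)

lemma A_abelian: assumes "h \<in> A" "h' \<in> A" shows "bracket h h' = 0"
proof (rule wt_ext)
  show "bracket h h' \<in> A" using RE_bracket[of h 1 h' 1] assms by (simp add: A_RE)
qed (simp add: wt_commutator A_fix assms)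

text \<open>The nilpotent part \<open>n\<close> of \<open>ad h\<close> is a derivation with \<open>tr (n ad w) = 0\<close> for all \<open>w\<close>, hence
  \<open>n x\<close> is orthogonal to everything.\<close>

lemma ad_scalar:
  assumes h: "h \<in> A" and x: "x \<in> RE \<mu>" shows "bracket h x = scale (wt \<mu> h) x"
proof -
  \<comment> \<open>\<open>D\<close> is the semisimple part of \<open>bracket h\<close>. It is a
    derivation because weights add along nonzero brackets; hence so is the remainder
    \<open>n\<close>.\<close>
  define D where "D v = (\<Sum>\<nu>\<in>S. scale (wt \<nu> h) (P \<nu> v))" for v
  define n where "n v = bracket h v - D v" for v
  have lD: "lin D" unfolding D_def[abs_def] by (rule lin_setsum) (rule lin_scaled[OF lin_P])
  have ln: "lin n" unfolding n_def[abs_def] by (rule lin_minus[OF lin_ad lD])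
  have DE: "D v = scale (wt \<omega> h) v" if "v \<in> E \<omega>" for v \<omega>
  proof (cases "v = 0")
    case False
    then have "\<omega> \<in> S" using mem_spec[OF diag that] by blast
    have "D v = (\<Sum>\<nu>\<in>S. if \<nu> = \<omega> then scale (wt \<omega> h) v else 0)"
      unfolding D_def by (intro sum.cong) (auto simp: P_E[OF that])
    then show ?thesis using \<open>\<omega> \<in> S\<close> finite_S by simp
  qed (simp add: lin_0[OF lD])
  have nE: "n v = shift (bracket h) (wt \<omega> h) v" if "v \<in> E \<omega>" for v \<omega>
    by (simp add: n_def shift_def DE[OF that])
  have DR: "D v \<in> R" if "v \<in> R" for v
    unfolding D_def by (intro subspace_sum[OF subR] subspace_scale[OF subR] PR that)
  have nR: "n v \<in> R" if "v \<in> R" for v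
    unfolding n_def by (intro subspace_diff[OF subR] DR that ideal_bracket_right[OF ideal_R])
  have n_E: "n v \<in> E \<omega>" if "v \<in> E \<omega>" for v \<omega>
    unfolding n_def DE[OF that] using E_bracket[OF A_E[OF h] that] that
    by (simp add: subspace_diff[OF subE] subspace_scale[OF subE])
  have der: "n (bracket u v) = bracket (n u) v + bracket u (n v)" for u v
  proof -
    have *: "n (bracket u v) = bracket (n u) v + bracket u (n v)" if "u \<in> E \<kappa>" "v \<in> E \<omega>" for u v \<kappa> \<omega>
    \<comment> \<open>Additivity of weights is available only for a nonzero bracket; for a zero one
      both sides vanish by the derivation rule for \<open>bracket h\<close>.\<close>
    proof (cases "bracket u v = 0")
      case True
      have "bracket (bracket h u) v + bracket u (bracket h v) = 0"
        using ad_derivation[of h u v] True by (simp add: bracket_zero_right)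
      then show ?thesis
        using True by (simp add: lin_0[OF lD] bracket_zero_right n_def DE[OF that(1)] DE[OF that(2)] lin_diff[OF lin_ad]
            lin_diff[OF lin_ad_right] bracket_scale_left bracket_scale_right)
    next
      case False
      show ?thesis
        unfolding n_def DE[OF that(1)] DE[OF that(2)] DE[OF E_bracket[OF that]]
          wt_bracket_add[OF h that False] ad_derivation[of h u v]
        by (simp add: lin_diff[OF lin_ad] lin_diff[OF lin_ad_right] bracket_scale_left bracket_scale_right
            scale_left_distrib)
    qed
    have "n (bracket u v) = n (\<Sum>\<kappa>\<in>S. \<Sum>\<omega>\<in>S. bracket (P \<kappa> u) (P \<omega> v))"
      by (simp only: lin_sum[OF lin_ad, symmetric] lin_sum[OF lin_ad_right, symmetric] sum_P)
    also have "\<dots> = (\<Sum>\<kappa>\<in>S. \<Sum>\<omega>\<in>S. n (bracket (P \<kappa> u) (P \<omega> v)))" by (simp only: lin_sum[OF ln])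
    also have "\<dots> = (\<Sum>\<kappa>\<in>S. \<Sum>\<omega>\<in>S. bracket (n (P \<kappa> u)) (P \<omega> v) + bracket (P \<kappa> u) (n (P \<omega> v)))"
      by (intro sum.cong refl *[OF P_mem P_mem])
    also have "\<dots> = (\<Sum>\<kappa>\<in>S. \<Sum>\<omega>\<in>S. bracket (n (P \<kappa> u)) (P \<omega> v)) + (\<Sum>\<kappa>\<in>S. \<Sum>\<omega>\<in>S. bracket (P \<kappa> u) (n (P \<omega> v)))"
      by (simp add: sum.distrib)
    also have "\<dots> = bracket (n (\<Sum>\<kappa>\<in>S. P \<kappa> u)) (\<Sum>\<omega>\<in>S. P \<omega> v) + bracket (\<Sum>\<kappa>\<in>S. P \<kappa> u) (n (\<Sum>\<omega>\<in>S. P \<omega> v))"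
      by (simp only: lin_sum[OF lin_ad, symmetric] lin_sum[OF lin_ad_right, symmetric] lin_sum[OF ln, symmetric])
    finally show ?thesis by (simp only: sum_P)
  qed
  have fn: "f (n v) = n (f v)" for v
  proof -
    have "f (D v) = D (f v)"
      unfolding D_def lin_sum[OF lin_f] lin_scale[OF lin_f]
      using gproj_commute[OF lin_f lin_f] by simp
    then show ?thesis
      using ad_commute_fixed[OF aut A_fix[OF h]] by (simp add: n_def lin_diff[OF lin_f])
  qed
  \<comment> \<open>In a degree other than 1 a homogeneous operator has trace 0. In degree 1,
    \<open>w\<close> lies in the abelian \<open>A\<close>, so \<open>n\<close> kills
    \<open>w\<close> and commutes with \<open>bracket w\<close>; their product is nilpotent on each
    component because \<open>n\<close> is.\<close>
  have tr_nw: "tr (\<lambda>v. n (bracket w v)) = 0" if w: "w \<in> RE \<nu>" for w \<nu>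
  proof (cases "\<nu> = 1")
    case False
    show ?thesis
    proof (rule tr_degree[OF aut lin_comp[OF ln lin_ad] _ False])
      show "f (n (bracket w v)) = scale \<nu> (n (bracket w (f v)))" for v
        using w by (simp add: fn automorphism_bracket[OF aut] eig_def bracket_scale_left lin_scale[OF ln])
    qed
  next
    case True
    then have wA: "w \<in> A" using w by (simp add: A_RE)
    have nw0: "n w = 0" using DE[of w 1] w True A_abelian[OF h wA] wt_one[OF h] by (simp add: n_def)
    have comm: "n (bracket w v) = bracket w (n v)" for v by (simp add: der nw0 bracket_zero_left)
    let ?F = "\<lambda>v. n (bracket w v)"
    have Fpow: "(?F ^^ k) v = (bracket w ^^ k) ((n ^^ k) v)" for k v
    proof (induction k arbitrary: v)
      case (Suc k)
      have "(?F ^^ Suc k) v = (?F ^^ k) (?F v)" by (simp only: funpow_Suc_right o_apply)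
      also have "\<dots> = (bracket w ^^ k) ((n ^^ k) (?F v))" by (rule Suc)
      also have "?F v = bracket w (n v)" by (rule comm)
      also have "(n ^^ k) (bracket w (n v)) = bracket w ((n ^^ k) (n v))"
        by (rule commute_funpow) (rule comm)
      finally show ?case by (simp only: funpow_Suc_right o_apply)
    qed simp
    have "tr (\<lambda>v. ?F (P \<omega> v)) = 0" for \<omega>
    proof -
      obtain k where k: "\<And>v. (shift (bracket h) (wt \<omega> h) ^^ k) (P \<omega> v) = 0" using ex_nil[OF wt_gen[OF h]] by blast
      have npow: "(n ^^ j) v = (shift (bracket h) (wt \<omega> h) ^^ j) v \<and> (n ^^ j) v \<in> E \<omega>" if "v \<in> E \<omega>" for j v
      proof (induction j)
        case (Suc j)
        then show ?case using nE[OF conjunct2[OF Suc.IH]] n_E[OF conjunct2[OF Suc.IH]] Suc.IH by simp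
      qed (use that in simp)
      have F0: "shift ?F 0 = ?F" by (simp add: shift_def fun_eq_iff)
      have nP: "(n ^^ k) (P \<omega> v) = 0" for v using npow[where v = "P \<omega> v" and j = k, OF P_mem] k by simp
      have nil: "(shift ?F 0 ^^ k) (P \<omega> v) = 0" for v
        unfolding F0 Fpow nP using lin_0[OF lin_funpow[OF lin_ad]] .
      have PF: "?F (P \<omega> v) = P \<omega> (?F v)" for v
        using P_ad[OF A_fix[OF wA], of \<omega> v] gproj_commute[OF lin_f ln fn] by simp
      show ?thesis
        using tr_single_eigenvalue[OF lin_comp[OF ln lin_ad] lin_P P_idem PF nil] by simp
    qed
    moreover have "tr ?F = (\<Sum>\<omega>\<in>S. tr (\<lambda>v. ?F (P \<omega> v)))"
    proof -
      have "tr ?F = tr (\<lambda>v. \<Sum>\<omega>\<in>S. ?F (P \<omega> v))"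
        by (simp only: lin_sum[OF ln, symmetric] lin_sum[OF lin_ad, symmetric] sum_P)
      then show ?thesis by (simp add: tr_setsum)
    qed
    ultimately show ?thesis by simp
  qed
  have tr_nw': "tr (\<lambda>v. n (bracket w v)) = 0" if w: "w \<in> R" for w
  proof -
    have "tr (\<lambda>v. n (bracket w v)) = tr (\<lambda>v. \<Sum>\<nu>\<in>S. n (bracket (P \<nu> w) v))"
      by (simp only: lin_sum[OF ln, symmetric] lin_sum[OF lin_ad_right, symmetric] sum_P)
    also have "\<dots> = (\<Sum>\<nu>\<in>S. tr (\<lambda>v. n (bracket (P \<nu> w) v)))" by (rule tr_setsum)
    also have "\<dots> = 0" by (intro sum.neutral ballI tr_nw[OF P_RE[OF w]])
    finally show ?thesis .
  qed
  have xR: "x \<in> R" using x by blast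
  have "n x = 0"
  proof (rule nondeg[OF nR[OF xR]])
    fix y assume y: "y \<in> R"
    \<comment> \<open>As \<open>n\<close> is a derivation, ad (n x) is the commutator of n and ad x.
      Cyclicity of the trace turns \<open>kap (n x) y\<close> into the trace of n composed with ad
      [x, y], which is 0.\<close>
    have "bracket (n x) (bracket y v) = n (bracket x (bracket y v)) - bracket x (n (bracket y v))" for v
      using der[of x "bracket y v"] by simp
    then have "kap (n x) y = tr (\<lambda>v. n (bracket x (bracket y v))) - tr (\<lambda>v. bracket x (n (bracket y v)))"
      by (simp add: kap_def tr_minus)
    also have "tr (\<lambda>v. bracket x (n (bracket y v))) = tr (\<lambda>v. n (bracket y (bracket x v)))"
      by (rule tr_commute[OF lin_ad lin_comp[OF ln lin_ad]])
    also have "tr (\<lambda>v. n (bracket x (bracket y v))) - tr (\<lambda>v. n (bracket y (bracket x v))) =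
        tr (\<lambda>v. n (bracket (bracket x y) v))"
      by (simp add: ad_bracket[of x y] lin_diff[OF ln] tr_minus)
    also have "\<dots> = 0" by (rule tr_nw'[OF ideal_bracket_right[OF ideal_R y]])
    finally show "kap (n x) y = 0" .
  qed
  then show ?thesis using DE[of x \<mu>] x by (simp add: n_def)
qed

lemma kap_bracket_A: assumes "x \<in> RE \<mu>" "h \<in> A" shows "kap (bracket x y) h = wt \<mu> h * kap x y"
proof -
  have "kap (bracket x y) h = kap h (bracket x y)" by (rule kap_sym)
  also have "\<dots> = kap (bracket h x) y" by (rule kap_invariant[symmetric])
  finally show ?thesis by (simp add: ad_scalar[OF assms(2,1)] kap_scale_left)
qed

section \<open>Roots and their inner product\<close>

definition \<Delta> where "\<Delta> = {\<mu> \<in> S. RE \<mu> \<noteq> {0} \<and> (\<exists>h\<in>A. wt \<mu> h \<noteq> 0)}"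

lemma finite_\<Delta>: "finite \<Delta>"
  using finite_S by (simp add: \<Delta>_def)

lemma \<Delta>_S: "\<mu> \<in> \<Delta> \<Longrightarrow> \<mu> \<in> S"
  by (simp add: \<Delta>_def)

lemma \<Delta>_nonzero: "\<mu> \<in> \<Delta> \<Longrightarrow> \<mu> \<noteq> 0"
  using spec_nonzero[OF diag] \<Delta>_S by blast

lemma \<Delta>_I: "x \<in> RE \<mu> \<Longrightarrow> x \<noteq> 0 \<Longrightarrow> h \<in> A \<Longrightarrow> wt \<mu> h \<noteq> 0 \<Longrightarrow> \<mu> \<in> \<Delta>"
  using mem_spec[OF diag] by (auto simp: \<Delta>_def)

definition xx where "xx \<mu> = (SOME x. x \<in> RE \<mu> \<and> x \<noteq> 0)"
definition yy where "yy \<mu> = (SOME y. y \<in> RE (1 / \<mu>) \<and> kap (xx \<mu>) y = 1)"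
text \<open>For a root this is the element of \<open>A\<close> dual to its weight under
  \<open>kap\<close>, realized as a bracket of opposite degrees so that the string argument applies
  to it.\<close>

definition tt where "tt \<mu> = bracket (xx \<mu>) (yy \<mu>)"
text \<open>On roots this is the inner product of weights induced by \<open>kap\<close>. Taking the
  real part loses nothing for \<open>\<nu>\<close> in \<open>S\<close> and \<open>\<mu>\<close> in
  \<open>\<Delta>\<close>, where the value is real.\<close>

definition q where "q \<nu> \<mu> = Re (wt \<nu> (tt \<mu>))"

lemma xx: assumes "\<mu> \<in> \<Delta>" shows "xx \<mu> \<in> RE \<mu>" "xx \<mu> \<noteq> 0"
proof -
  have "\<exists>x. x \<in> RE \<mu> \<and> x \<noteq> 0" using assms subspace_0[OF subRE[of \<mu>]] by (auto simp: \<Delta>_def)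
  from someI_ex[OF this] show "xx \<mu> \<in> RE \<mu>" "xx \<mu> \<noteq> 0" unfolding xx_def[symmetric] by blast+
qed

lemma yy: assumes "\<mu> \<in> \<Delta>" shows "yy \<mu> \<in> RE (1 / \<mu>)" "kap (xx \<mu>) (yy \<mu>) = 1"
proof -
  have "\<exists>y. y \<in> RE (1 / \<mu>) \<and> kap (xx \<mu>) y = 1" using ex_pair[OF xx[OF assms]] by blast
  from someI_ex[OF this] show "yy \<mu> \<in> RE (1 / \<mu>)" "kap (xx \<mu>) (yy \<mu>) = 1" unfolding yy_def[symmetric] by blast+
qed

lemma tt_A: "\<mu> \<in> \<Delta> \<Longrightarrow> tt \<mu> \<in> A"
  using RE_bracket[OF xx(1) yy(1), of \<mu> \<mu>] \<Delta>_nonzero[of \<mu>] by (simp add: tt_def A_RE)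

lemma kap_tt: "\<mu> \<in> \<Delta> \<Longrightarrow> h \<in> A \<Longrightarrow> kap (tt \<mu>) h = wt \<mu> h"
  using kap_bracket_A[OF xx(1), of \<mu> h "yy \<mu>"] yy(2) by (simp add: tt_def)

text \<open>By the string argument all weights at t = \<open>tt \<mu>\<close> are real multiples of
  \<open>wt \<mu> t\<close>. Then \<open>wt \<mu> t = kap t t\<close> equals s times its own square,
  with s a sum of real squares weighted by dimensions. It is nonzero because t is dual to a nonzero
  weight, so its value is 1 / s > 0.\<close>

lemma wt_tt_real_pos:
  assumes \<mu>: "\<mu> \<in> \<Delta>"
  shows "0 < q \<mu> \<mu> \<and> (\<forall>\<nu>\<in>S. wt \<nu> (tt \<mu>) = of_real (q \<nu> \<mu>))"
proof -
  let ?t = "tt \<mu>"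
  have tA: "?t \<in> A" by (rule tt_A[OF \<mu>])
  obtain r :: "complex \<Rightarrow> real" where r: "\<And>\<nu>. \<nu> \<in> S \<Longrightarrow> wt \<nu> ?t = of_real (r \<nu>) * wt \<mu> ?t"
    using wt_string[of "xx \<mu>" \<mu> "yy \<mu>"] xx(1)[OF \<mu>] yy(1)[OF \<mu>] tA \<Delta>_S[OF \<mu>] unfolding tt_def by (metis Int_iff)
  define s where "s = (\<Sum>\<nu>\<in>S. real (dim (E \<nu>)) * (r \<nu>)\<^sup>2)"
  have "wt \<mu> ?t = kap ?t ?t" using kap_tt[OF \<mu> tA] by simp
  also have "\<dots> = (\<Sum>\<nu>\<in>S. of_nat (dim (E \<nu>)) * (of_real (r \<nu>) * wt \<mu> ?t)\<^sup>2)"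
    unfolding kap_self_wt[OF tA] by (intro sum.cong refl) (simp add: r)
  also have "\<dots> = of_real s * (wt \<mu> ?t)\<^sup>2"
    by (simp add: s_def sum_distrib_right power_mult_distrib mult.assoc)
  finally have e: "wt \<mu> ?t = of_real s * (wt \<mu> ?t)\<^sup>2" .
  have nz: "wt \<mu> ?t \<noteq> 0"
  proof
    assume "wt \<mu> ?t = 0"
    then have "?t = 0" using r by (intro wt_ext[OF tA]) simp
    then have "wt \<mu> h = 0" if "h \<in> A" for h using kap_tt[OF \<mu> that] by (simp add: kap_0_left)
    then show False using \<mu> by (auto simp: \<Delta>_def)
  qed
  have "0 \<le> s" unfolding s_def by (intro sum_nonneg) simp
  have "of_real s * wt \<mu> ?t = 1" using e nz by (simp add: power2_eq_square)
  then have "s \<noteq> 0" by auto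
  then have w: "s \<noteq> 0" "wt \<mu> ?t = of_real (1 / s)"
    using \<open>of_real s * wt \<mu> ?t = 1\<close> by (simp_all add: eq_divide_eq mult.commute)
  then have "0 < q \<mu> \<mu>" using \<open>0 \<le> s\<close> by (simp add: q_def)
  moreover have "wt \<nu> ?t = of_real (q \<nu> \<mu>)" if "\<nu> \<in> S" for \<nu>
    using r[OF that] w by (simp add: q_def)
  ultimately show ?thesis by blast
qed

lemma q_pos: "\<mu> \<in> \<Delta> \<Longrightarrow> 0 < q \<mu> \<mu>" and wt_tt: "\<mu> \<in> \<Delta> \<Longrightarrow> \<nu> \<in> S \<Longrightarrow> wt \<nu> (tt \<mu>) = of_real (q \<nu> \<mu>)"
  using wt_tt_real_pos by blast+

text \<open>Realizes \<open>q\<close> as the Gram matrix of the vectors with coordinates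
  \<open>q \<omega> \<mu>\<close> for \<open>\<omega>\<close> in \<open>S\<close>, in the Euclidean
  space weighted by the dimensions of the components. The symmetry of \<open>q\<close> on roots is
  also read off from it.\<close>

lemma q_sum:
  assumes "\<mu> \<in> \<Delta>" "\<nu> \<in> \<Delta>"
  shows "q \<mu> \<nu> = (\<Sum>\<omega>\<in>S. real (dim (E \<omega>)) * (q \<omega> \<mu> * q \<omega> \<nu>))"
proof -
  have "of_real (q \<mu> \<nu>) = kap (tt \<mu>) (tt \<nu>)"
    using kap_tt[OF assms(1) tt_A[OF assms(2)]] wt_tt[OF assms(2) \<Delta>_S[OF assms(1)]] by simp
  also have "\<dots> = of_real (\<Sum>\<omega>\<in>S. real (dim (E \<omega>)) * (q \<omega> \<mu> * q \<omega> \<nu>))"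
    using assms by (simp add: kap_wt tt_A wt_tt)
  finally show ?thesis by (simp only: of_real_eq_iff)
qed

lemma q_cong:
  assumes "\<mu> \<in> \<Delta>" "\<nu> \<in> \<Delta>" "\<omega> \<in> \<Delta>" "\<And>h. h \<in> A \<Longrightarrow> wt \<mu> h = wt \<nu> h"
  shows "q \<mu> \<omega> = q \<nu> \<omega>"
  using assms(4)[OF tt_A[OF assms(3)]] by (simp add: q_def)

text \<open>A nonzero \<open>v\<close> would be a lowest weight vector of positive weight, as in the
  theory of sl2. Raising it never gives zero, so \<open>bracket (tt \<nu>)\<close> would have
  infinitely many eigenvalues c + k d.\<close>

lemma lower_inj:
  assumes \<nu>: "\<nu> \<in> \<Delta>" and v: "v \<in> RE \<mu>" and \<mu>: "\<mu> \<in> S" and pos: "0 < q \<mu> \<nu>" and yv: "bracket (yy \<nu>) v = 0"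
  shows "v = 0"
proof (rule ccontr)
  assume "v \<noteq> 0"
  let ?x = "xx \<nu>" and ?y = "yy \<nu>" and ?t = "tt \<nu>"
  define c d where "c = q \<mu> \<nu>" and "d = q \<nu> \<nu>"
  have cd: "0 < c" "0 < d" using pos q_pos[OF \<nu>] by (simp_all add: c_def d_def)
  have tx: "bracket ?t ?x = scale (of_real d) ?x"
    using ad_scalar[OF tt_A[OF \<nu>] xx(1)[OF \<nu>]] wt_tt[OF \<nu> \<Delta>_S[OF \<nu>]] by (simp add: d_def)
  have tv: "bracket ?t v = scale (of_real c) v"
    using ad_scalar[OF tt_A[OF \<nu>] v] wt_tt[OF \<nu> \<mu>] by (simp add: c_def)
  define w where "w k = (bracket ?x ^^ k) v" for k
  have w_Suc: "w (Suc k) = bracket ?x (w k)" and w_0: "w 0 = v" for k by (simp_all add: w_def)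
  have tw: "bracket ?t (w k) = scale (of_real (c + real k * d)) (w k)" for k
  proof (induction k)
    case (Suc k)
    have "bracket ?t (w (Suc k)) = bracket (bracket ?t ?x) (w k) + bracket ?x (bracket ?t (w k))"
      unfolding w_Suc by (rule ad_derivation)
    also have "\<dots> = scale (of_real d) (w (Suc k)) + scale (of_real (c + real k * d)) (w (Suc k))"
      by (simp add: tx Suc bracket_scale_left bracket_scale_right w_Suc)
    also have "\<dots> = scale (of_real (c + real (Suc k) * d)) (w (Suc k))"
      by (simp add: scale_left_distrib[symmetric] algebra_simps del: scale_left_distrib)
    finally show ?case .
  qed (simp add: w_0 tv)
  \<comment> \<open>Moving \<open>?y\<close> past k + 1 copies of \<open>?x\<close> produces one
    term -t for each copy, and t acts on \<open>w i\<close> by c + i d.\<close>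
  define s where "s k = (\<Sum>i\<le>k. c + real i * d)" for k
  have yw: "bracket ?y (w (Suc k)) = scale (- of_real (s k)) (w k)" for k
  proof (induction k)
    case 0
    have "bracket ?y (w (Suc 0)) = bracket (bracket ?y ?x) v + bracket ?x (bracket ?y v)"
      unfolding w_Suc w_0 by (rule ad_derivation)
    also have "bracket ?y ?x = - ?t" unfolding tt_def by (rule bracket_antisym)
    finally show ?case
      using bracket_scale_left[of "-1" ?t v] by (simp add: yv bracket_zero_right tv s_def w_0)
  next
    case (Suc k)
    have "bracket ?y (w (Suc (Suc k))) = bracket (bracket ?y ?x) (w (Suc k)) + bracket ?x (bracket ?y (w (Suc k)))"
      unfolding w_Suc[of "Suc k"] by (rule ad_derivation)
    also have "bracket ?y ?x = - ?t" unfolding tt_def by (rule bracket_antisym)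
    also have "bracket (- ?t) (w (Suc k)) = - scale (of_real (c + real (Suc k) * d)) (w (Suc k))"
      using bracket_scale_left[of "-1" ?t "w (Suc k)"] by (simp add: tw[of "Suc k"] del: of_real_add of_real_mult)
    also have "bracket ?x (bracket ?y (w (Suc k))) = scale (- of_real (s k)) (w (Suc k))"
      by (simp only: Suc bracket_scale_right) (simp only: w_Suc[of k])
    finally show ?case by (simp add: s_def scale_left_distrib scale_left_diff_distrib)
  qed
  have spos: "0 < s k" for k unfolding s_def using cd by (intro sum_pos add_pos_nonneg) auto
  have wnz: "w k \<noteq> 0" for k
  proof (induction k)
    case (Suc k)
    show ?case
    proof
      assume "w (Suc k) = 0"
      then have "scale (- of_real (s k)) (w k) = 0" using yw[of k] by (simp add: bracket_zero_right)
      then show False using Suc spos[of k] by simp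
    qed
  qed (simp add: w_0 \<open>v \<noteq> 0\<close>)
  have "of_real (c + real k * d) \<in> spec (bracket ?t)" for k
    using wnz[of k] tw[of k] eig_subset_gen_eig[of "bracket ?t" "of_real (c + real k * d)"]
    by (auto simp: spec_def eig_def)
  then have "range (\<lambda>k. of_real (c + real k * d)) \<subseteq> spec (bracket ?t)" by blast
  then have "finite (range (\<lambda>k::nat. of_real (c + real k * d) :: complex))"
    using finite_spec[OF lin_ad] finite_subset by blast
  moreover have "inj (\<lambda>k::nat. of_real (c + real k * d) :: complex)"
    using cd by (auto simp: inj_def simp del: of_real_add of_real_mult)
  ultimately show False using finite_imageD by blast
qed

section \<open>Dimension of the nonzero weight spaces\<close>

definition \<Delta>\<alpha> where "\<Delta>\<alpha> l = {\<mu> \<in> \<Delta>. E \<mu> \<subseteq> eig \<alpha> l}"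

lemma \<Delta>\<alpha>_\<Delta>: "\<mu> \<in> \<Delta>\<alpha> l \<Longrightarrow> \<mu> \<in> \<Delta>"
  by (simp add: \<Delta>\<alpha>_def)

lemma P_shift:
  assumes y: "y \<in> E \<omega>" "\<omega> \<noteq> 0" shows "P (\<omega> * \<mu>) (bracket y u) = bracket y (P \<mu> u)"
proof -
  have "P (\<omega> * \<mu>) (bracket y u) = P (\<omega> * \<mu>) (bracket y (\<Sum>\<kappa>\<in>S. P \<kappa> u))" by (simp only: sum_P)
  also have "\<dots> = (\<Sum>\<kappa>\<in>S. P (\<omega> * \<mu>) (bracket y (P \<kappa> u)))" by (simp only: lin_sum[OF lin_ad] lin_sum[OF lin_P])
  also have "\<dots> = (\<Sum>\<kappa>\<in>S. if \<kappa> = \<mu> then bracket y (P \<mu> u) else 0)"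
    using y(2) by (intro sum.cong refl) (auto simp: P_E[OF E_bracket[OF y(1) P_mem]])
  also have "\<dots> = bracket y (P \<mu> u)"
    using finite_S by (auto simp: gproj_outside[OF lin_f] bracket_zero_right)
  finally show ?thesis .
qed

lemma neighbours_dim:
  assumes \<nu>: "\<nu> \<in> \<Delta>\<alpha> l"
  shows "dim (span (\<Union>\<mu>\<in>{\<mu> \<in> \<Delta>\<alpha> l. 0 < q \<mu> \<nu>}. RE \<mu>)) \<le> dim (eig \<alpha> 1)"
proof -
  let ?N = "{\<mu> \<in> \<Delta>\<alpha> l. 0 < q \<mu> \<nu>}"
  let ?U = "span (\<Union>\<mu>\<in>?N. RE \<mu>)"
  let ?g = "bracket (yy \<nu>)"
  have \<nu>\<Delta>: "\<nu> \<in> \<Delta>" by (rule \<Delta>\<alpha>_\<Delta>[OF \<nu>])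
  have PU: "P \<mu> u \<in> RE \<mu> \<and> (\<mu> \<notin> ?N \<longrightarrow> P \<mu> u = 0)" if "u \<in> ?U" for u \<mu>
  proof -
    have sub: "subspace {v. v \<in> RE \<mu> \<and> (\<mu> \<notin> ?N \<longrightarrow> v = 0)}"
      using subspace_0[OF subRE] subspace_add[OF subRE] subspace_scale[OF subRE]
      by (intro subspaceI) auto
    have "P \<mu> z \<in> {v. v \<in> RE \<mu> \<and> (\<mu> \<notin> ?N \<longrightarrow> v = 0)}" if "z \<in> (\<Union>\<mu>\<in>?N. RE \<mu>)" for z
      using that P_E[of z _ \<mu>] P_RE[of z \<mu>] by auto
    from lin_image_span[OF lin_P this sub that] show ?thesis by simp
  qed
  have inj: "inj_on ?g ?U"
  proof (rule inj_onI)
    fix u u' assume u: "u \<in> ?U" "u' \<in> ?U" "?g u = ?g u'"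
    let ?d = "u - u'"
    have d: "?d \<in> ?U" "?g ?d = 0" using u span_diff by (auto simp: lin_diff[OF lin_ad])
    \<comment> \<open>Lowering multiplies every degree by 1 / \<open>\<nu>\<close>, so its kernel
      can be tested on each component separately.\<close>
    have "P \<mu> ?d = 0" if "\<mu> \<in> S" for \<mu>
    proof (cases "\<mu> \<in> ?N")
      case True
      have "bracket (yy \<nu>) (P \<mu> ?d) = P (1 / \<nu> * \<mu>) (?g ?d)"
        using yy(1)[OF \<nu>\<Delta>] \<Delta>_nonzero[OF \<nu>\<Delta>] by (intro P_shift[symmetric]) auto
      then have "bracket (yy \<nu>) (P \<mu> ?d) = 0" using d(2) by (simp add: lin_0[OF lin_P])
      then show ?thesis using lower_inj[OF \<nu>\<Delta> _ that, of "P \<mu> ?d"] PU[OF d(1)] True by blast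
    next
      case False then show ?thesis using PU[OF d(1)] by blast
    qed
    then have "(\<Sum>\<mu>\<in>S. P \<mu> ?d) = 0" by simp
    then show "u = u'" by (simp add: sum_P)
  qed
  obtain l' where l': "E (1 / \<nu>) \<subseteq> eig \<alpha> l'" using refine by blast
  have a\<alpha>: "automorphism \<alpha>" by (rule diag_autD(1)[OF \<alpha>])
  \<comment> \<open>The nonzero element \<open>tt \<nu>\<close> has \<open>\<alpha>\<close>-degree l
    * l' as a bracket and 1 as an element of \<open>A\<close>.\<close>
  have "l' * l = 1"
  proof (rule ccontr)
    assume ne: "l' * l \<noteq> 1"
    have "tt \<nu> \<in> eig \<alpha> (l * l')"
      unfolding tt_def using xx(1)[OF \<nu>\<Delta>] yy(1)[OF \<nu>\<Delta>] \<nu> l' by (intro eig_bracket[OF a\<alpha>]) (auto simp: \<Delta>\<alpha>_def)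
    moreover have "tt \<nu> \<in> eig \<alpha> 1" using tt_A[OF \<nu>\<Delta>] refine1 by (auto simp: A_def)
    ultimately have "tt \<nu> = 0" using eig_disjoint[OF \<alpha>] ne by (metis mult.commute)
    then show False using q_pos[OF \<nu>\<Delta>] by (simp add: q_def wt_0)
  qed
  have img: "?g ` ?U \<subseteq> eig \<alpha> 1"
  proof clarify
    fix u assume u: "u \<in> ?U"
    show "?g u \<in> eig \<alpha> 1"
    proof (rule lin_image_span[OF lin_ad _ subspace_eig[OF diag_autD(2)[OF \<alpha>]] u])
      fix z assume "z \<in> (\<Union>\<mu>\<in>?N. RE \<mu>)"
      then have "z \<in> eig \<alpha> l" by (auto simp: \<Delta>\<alpha>_def)
      then have "?g z \<in> eig \<alpha> (l' * l)" using yy(1)[OF \<nu>\<Delta>] l' by (intro eig_bracket[OF a\<alpha>]) auto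
      then show "?g z \<in> eig \<alpha> 1" using \<open>l' * l = 1\<close> by simp
    qed
  qed
  have "dim ?U = dim (?g ` ?U)" using dim_image_eq[OF lin_ad, of "yy \<nu>" ?U] inj by (simp add: span_span)
  also have "\<dots> \<le> dim (eig \<alpha> 1)" using img by (rule dim_subset)
  finally show ?thesis .
qed

text \<open>The system is independent over the reals, and a complex relation among the elements
  \<open>tt \<mu>\<close> splits into its real and imaginary parts because the values of
  \<open>q\<close> are real. So these elements are independent in \<open>A\<close>.\<close>

lemma obtuse_half_card:
  assumes B: "B \<subseteq> \<Delta>" "\<And>\<mu> \<nu>. \<mu> \<in> B \<Longrightarrow> \<nu> \<in> B \<Longrightarrow> \<mu> \<noteq> \<nu> \<Longrightarrow> q \<mu> \<nu> \<le> 0"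
    and pos: "\<And>\<mu>. \<mu> \<in> B \<Longrightarrow> 0 < (\<Sum>\<omega>\<in>S. real (dim (E \<omega>)) * (g \<omega> * q \<omega> \<mu>))"
  shows "card B \<le> dim A"
proof -
  have finB: "finite B" using B(1) finite_\<Delta> finite_subset by blast
  have key: "\<forall>\<mu>\<in>B. a \<mu> = 0" if a: "\<And>\<omega>. \<omega> \<in> S \<Longrightarrow> (\<Sum>\<mu>\<in>B. a \<mu> * q \<omega> \<mu>) = 0" for a :: "complex \<Rightarrow> real"
  proof (rule obtuse_half_space_independent[where I = S and d = "\<lambda>\<omega>. real (dim (E \<omega>))" and r = q and q = q and g = g])
    fix n assume n: "n \<in> B"
    have "(\<Sum>\<mu>\<in>B. a \<mu> * q \<mu> n) = (\<Sum>\<mu>\<in>B. a \<mu> * q n \<mu>)"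
    proof (rule sum.cong[OF refl])
      fix \<mu> assume "\<mu> \<in> B"
      then show "a \<mu> * q \<mu> n = a \<mu> * q n \<mu>" using q_sum[of \<mu> n] q_sum[of n \<mu>] B(1) n by (simp add: mult.commute subset_iff)
    qed
    then show "(\<Sum>\<mu>\<in>B. a \<mu> * q \<mu> n) = 0" using a[of n] \<Delta>_S B(1) n by auto
  qed (use finite_S finB dim_E_pos B pos in \<open>auto intro: q_sum simp del: dim_eq_0\<close>)
  have lin0: "\<forall>\<mu>\<in>B. c \<mu> = 0" if c: "(\<Sum>\<mu>\<in>B. scale (c \<mu>) (tt \<mu>)) = 0" for c
  proof -
    have *: "(\<Sum>\<mu>\<in>B. c \<mu> * of_real (q \<omega> \<mu>)) = 0" if "\<omega> \<in> S" for \<omega>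
    proof -
      have "0 = wt \<omega> (\<Sum>\<mu>\<in>B. scale (c \<mu>) (tt \<mu>))" using c by (simp add: wt_0)
      also have "\<dots> = (\<Sum>\<mu>\<in>B. c \<mu> * of_real (q \<omega> \<mu>))"
        unfolding wt_sum wt_scale using B(1) that by (intro sum.cong refl) (simp add: wt_tt subset_iff)
      finally show ?thesis by simp
    qed
    have "\<forall>\<mu>\<in>B. Re (c \<mu>) = 0"
    proof (rule key)
      fix \<omega> assume "\<omega> \<in> S"
      from arg_cong[OF *[OF this], of Re] show "(\<Sum>\<mu>\<in>B. Re (c \<mu>) * q \<omega> \<mu>) = 0" by simp
    qed
    moreover have "\<forall>\<mu>\<in>B. Im (c \<mu>) = 0"
    proof (rule key)
      fix \<omega> assume "\<omega> \<in> S"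
      from arg_cong[OF *[OF this], of Im] show "(\<Sum>\<mu>\<in>B. Im (c \<mu>) * q \<omega> \<mu>) = 0" by simp
    qed
    ultimately show ?thesis by (simp add: complex_eq_iff)
  qed
  have inj: "inj_on tt B"
  proof (rule inj_onI, rule ccontr)
    fix \<mu> \<nu> assume *: "\<mu> \<in> B" "\<nu> \<in> B" "tt \<mu> = tt \<nu>" "\<mu> \<noteq> \<nu>"
    have "(\<Sum>\<omega>\<in>B. scale (if \<omega> = \<mu> then 1 else if \<omega> = \<nu> then -1 else 0) (tt \<omega>)) =
        (\<Sum>\<omega>\<in>B. if \<omega> = \<mu> then tt \<mu> else 0) - (\<Sum>\<omega>\<in>B. if \<omega> = \<nu> then tt \<nu> else 0)"
      unfolding sum_subtractf[symmetric] using *(4) by (intro sum.cong) auto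
    also have "\<dots> = 0" using * finB by simp
    finally show False using lin0[of "\<lambda>\<omega>. if \<omega> = \<mu> then 1 else if \<omega> = \<nu> then -1 else 0"] *(1) by auto
  qed
  have "independent (tt ` B)"
  proof (rule independent_if_scalars_zero)
    fix c x assume c: "(\<Sum>x\<in>tt ` B. scale (c x) x) = 0" and x: "x \<in> tt ` B"
    then have "(\<Sum>\<mu>\<in>B. scale (c (tt \<mu>)) (tt \<mu>)) = 0" using inj by (simp add: sum.reindex)
    then show "c x = 0" using lin0[of "\<lambda>\<mu>. c (tt \<mu>)"] x by blast
  qed (use finB in simp)
  then have "card (tt ` B) \<le> dim A" using tt_A B(1) by (intro independent_card_le_dim) auto
  then show ?thesis using inj by (simp add: card_image)
qed

text \<open>A generic vector \<open>g\<close> is orthogonal to no member of \<open>B\<close> and so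
  splits \<open>B\<close> into two systems, each in an open half-space; hence the factor 2.\<close>

lemma obtuse_card:
  assumes B: "B \<subseteq> \<Delta>" "\<And>\<mu> \<nu>. \<mu> \<in> B \<Longrightarrow> \<nu> \<in> B \<Longrightarrow> \<mu> \<noteq> \<nu> \<Longrightarrow> q \<mu> \<nu> \<le> 0"
  shows "card B \<le> 2 * dim A"
proof -
  have finB: "finite B" using B(1) finite_\<Delta> finite_subset by blast
  have "\<exists>k. \<forall>m\<in>B. (\<Sum>b\<in>B. k b * q b m) \<noteq> 0"
    using q_pos B(1) by (intro ex_generic_combination finB) (metis less_irrefl subsetD)
  then obtain k where k: "\<And>m. m \<in> B \<Longrightarrow> (\<Sum>b\<in>B. k b * q b m) \<noteq> 0" by blast
  define g where "g \<omega> = (\<Sum>b\<in>B. k b * q \<omega> b)" for \<omega>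
  have g: "(\<Sum>\<omega>\<in>S. real (dim (E \<omega>)) * (g \<omega> * q \<omega> m)) = (\<Sum>b\<in>B. k b * q b m)" if "m \<in> B" for m
  proof -
    have "(\<Sum>\<omega>\<in>S. real (dim (E \<omega>)) * (g \<omega> * q \<omega> m)) = (\<Sum>\<omega>\<in>S. \<Sum>b\<in>B. k b * (real (dim (E \<omega>)) * (q \<omega> b * q \<omega> m)))"
      by (simp add: g_def sum_distrib_left sum_distrib_right mult_ac)
    also have "\<dots> = (\<Sum>b\<in>B. k b * (\<Sum>\<omega>\<in>S. real (dim (E \<omega>)) * (q \<omega> b * q \<omega> m)))"
      by (subst sum.swap) (simp add: sum_distrib_left)
    also have "\<dots> = (\<Sum>b\<in>B. k b * q b m)"
      using B(1) that by (intro sum.cong refl) (simp add: q_sum[symmetric] subset_iff)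
    finally show ?thesis .
  qed
  let ?B1 = "{m \<in> B. 0 < (\<Sum>b\<in>B. k b * q b m)}" and ?B2 = "{m \<in> B. (\<Sum>b\<in>B. k b * q b m) < 0}"
  have "card ?B1 \<le> dim A" by (rule obtuse_half_card[where g = g]) (use B g in auto)
  moreover have "card ?B2 \<le> dim A"
    by (rule obtuse_half_card[where g = "\<lambda>\<omega>. - g \<omega>"]) (use B g in \<open>auto simp: sum_negf\<close>)
  moreover have "B = ?B1 \<union> ?B2" using k by (auto simp: not_less_iff_gr_or_eq)
  then have "card B \<le> card ?B1 + card ?B2" by (metis (no_types, lifting) card_Un_le)
  ultimately show ?thesis by linarith
qed

lemma dim_A_le: "dim A \<le> dim (eig \<alpha> 1)"
  using refine1 by (intro dim_subset) (auto simp: A_def)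

abbreviation "m \<equiv> dim (eig \<alpha> 1)"
abbreviation "V \<equiv> span (\<Union>\<mu>\<in>\<Delta>. RE \<mu>)"

text \<open>A largest obtuse subset is dominating: a root without positive product with any of its
  members could be added to it. So at most 2 m neighbourhoods, each of dimension at most m, span
  everything.\<close>

lemma dim_V_part: "dim (span (\<Union>\<mu>\<in>\<Delta>\<alpha> l. RE \<mu>)) \<le> 2 * m * m"
proof -
  define ob where "ob B \<longleftrightarrow> B \<subseteq> \<Delta>\<alpha> l \<and> (\<forall>\<mu>\<in>B. \<forall>\<nu>\<in>B. \<mu> \<noteq> \<nu> \<longrightarrow> q \<mu> \<nu> \<le> 0)" for B
  have fin: "finite (\<Delta>\<alpha> l)" using finite_\<Delta> by (simp add: \<Delta>\<alpha>_def)
  obtain B where B: "ob B" "\<And>C. ob C \<Longrightarrow> card C \<le> card B"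
    using ex_has_greatest_nat[of ob "{}" card "Suc (card (\<Delta>\<alpha> l))"] card_mono[OF fin]
    by (auto simp: ob_def less_Suc_eq_le)
  have B\<Delta>: "B \<subseteq> \<Delta>" using B(1) \<Delta>\<alpha>_\<Delta> by (auto simp: ob_def)
  have finB: "finite B" using B\<Delta> finite_\<Delta> finite_subset by blast
  let ?U = "\<lambda>\<nu>. span (\<Union>\<mu>\<in>{\<mu> \<in> \<Delta>\<alpha> l. 0 < q \<mu> \<nu>}. RE \<mu>)"
  have cov: "\<exists>\<nu>\<in>B. 0 < q \<mu> \<nu>" if \<mu>: "\<mu> \<in> \<Delta>\<alpha> l" for \<mu>
  proof (rule ccontr)
    assume neg: "\<not> ?thesis"
    have "\<mu> \<notin> B" using neg q_pos[OF \<Delta>\<alpha>_\<Delta>[OF \<mu>]] by auto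
    have qs: "q \<nu> \<mu> = q \<mu> \<nu>" if "\<nu> \<in> B" for \<nu>
      using q_sum[of \<mu> \<nu>] q_sum[of \<nu> \<mu>] \<Delta>\<alpha>_\<Delta>[OF \<mu>] that B\<Delta> by (simp add: mult.commute subset_iff)
    have "ob (insert \<mu> B)"
      using B(1) \<mu> neg qs unfolding ob_def by (auto simp: not_less)
    then have "card (insert \<mu> B) \<le> card B" by (rule B(2))
    then show False using \<open>\<mu> \<notin> B\<close> finB by simp
  qed
  have "(\<Union>\<mu>\<in>\<Delta>\<alpha> l. RE \<mu>) \<subseteq> (\<Union>\<nu>\<in>B. ?U \<nu>)"
  proof
    fix z assume "z \<in> (\<Union>\<mu>\<in>\<Delta>\<alpha> l. RE \<mu>)"
    then obtain \<mu> where \<mu>: "\<mu> \<in> \<Delta>\<alpha> l" "z \<in> RE \<mu>" by blast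
    obtain \<nu> where \<nu>: "\<nu> \<in> B" "0 < q \<mu> \<nu>" using cov[OF \<mu>(1)] by blast
    have "z \<in> ?U \<nu>" using \<mu> \<nu> by (intro span_base) blast
    then show "z \<in> (\<Union>\<nu>\<in>B. ?U \<nu>)" using \<nu> by blast
  qed
  then have "dim (span (\<Union>\<mu>\<in>\<Delta>\<alpha> l. RE \<mu>)) \<le> dim (span (\<Union>\<nu>\<in>B. ?U \<nu>))"
    by (intro dim_subset span_mono)
  also have "\<dots> \<le> (\<Sum>\<nu>\<in>B. dim (?U \<nu>))" by (rule dim_sum_le[OF finB])
  also have "\<dots> \<le> (\<Sum>\<nu>\<in>B. m)"
    using B(1) by (intro sum_mono neighbours_dim) (auto simp: ob_def)
  also have "\<dots> = card B * m" by simp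
  also have "\<dots> \<le> (2 * m) * m"
    using obtuse_card[OF B\<Delta>] B(1) dim_A_le by (intro mult_right_mono) (auto simp: ob_def)
  finally show ?thesis by simp
qed

lemma \<Delta>_cover: "\<Delta> \<subseteq> (\<Union>l\<in>spec \<alpha>. \<Delta>\<alpha> l)"
proof
  fix \<mu> assume \<mu>: "\<mu> \<in> \<Delta>"
  obtain l where l: "E \<mu> \<subseteq> eig \<alpha> l" using refine by blast
  have "l \<in> spec \<alpha>" using xx[OF \<mu>] l by (intro mem_spec[OF \<alpha>, of "xx \<mu>"]) auto
  then show "\<mu> \<in> (\<Union>l\<in>spec \<alpha>. \<Delta>\<alpha> l)" using l \<mu> by (auto simp: \<Delta>\<alpha>_def)
qed

lemma dim_V: "dim V \<le> card (spec \<alpha>) * (2 * m * m)"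
proof -
  have fin: "finite (spec \<alpha>)" by (rule finite_spec[OF diag_autD(2)[OF \<alpha>]])
  have "(\<Union>\<mu>\<in>\<Delta>. RE \<mu>) \<subseteq> (\<Union>l\<in>spec \<alpha>. span (\<Union>\<mu>\<in>\<Delta>\<alpha> l. RE \<mu>))"
  proof
    fix z assume "z \<in> (\<Union>\<mu>\<in>\<Delta>. RE \<mu>)"
    then obtain \<mu> l where "\<mu> \<in> \<Delta>\<alpha> l" "l \<in> spec \<alpha>" "z \<in> RE \<mu>" using \<Delta>_cover by blast
    moreover from this have "z \<in> span (\<Union>\<mu>\<in>\<Delta>\<alpha> l. RE \<mu>)" by (intro span_base) blast
    ultimately show "z \<in> (\<Union>l\<in>spec \<alpha>. span (\<Union>\<mu>\<in>\<Delta>\<alpha> l. RE \<mu>))" by blast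
  qed
  then have "dim V \<le> dim (span (\<Union>l\<in>spec \<alpha>. span (\<Union>\<mu>\<in>\<Delta>\<alpha> l. RE \<mu>)))" by (intro dim_subset span_mono)
  also have "\<dots> \<le> (\<Sum>l\<in>spec \<alpha>. dim (span (\<Union>\<mu>\<in>\<Delta>\<alpha> l. RE \<mu>)))" by (rule dim_sum_le[OF fin])
  also have "\<dots> \<le> (\<Sum>l\<in>spec \<alpha>. 2 * m * m)" by (intro sum_mono dim_V_part)
  finally show ?thesis by simp
qed

text \<open>Members of \<open>\<Delta>\<close> are degrees, and nothing prevents several degrees
  from having the same weight on \<open>A\<close>; so the degrees of opposite weight form a set and
  are not described by the inverse degree alone.\<close>

definition opp where "opp \<mu> = {\<nu> \<in> \<Delta>. \<forall>h\<in>A. wt \<nu> h = - wt \<mu> h}"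

text \<open>All members have the same weight. Inside one \<open>\<alpha>\<close>-degree they
  therefore have positive product with any one of them and belong to its neighbourhood, of dimension
  at most m.\<close>

lemma dim_opp: "dim (span (\<Union>\<nu>\<in>opp \<mu>. RE \<nu>)) \<le> card (spec \<alpha>) * m"
proof -
  have fin: "finite (spec \<alpha>)" by (rule finite_spec[OF diag_autD(2)[OF \<alpha>]])
  let ?W = "\<lambda>l. span (\<Union>\<nu>\<in>opp \<mu> \<inter> \<Delta>\<alpha> l. RE \<nu>)"
  have part: "dim (?W l) \<le> m" for l
  proof (cases "opp \<mu> \<inter> \<Delta>\<alpha> l = {}")
    case True then show ?thesis by (simp add: dim_span)
  next
    case False
    then obtain \<kappa> where \<kappa>: "\<kappa> \<in> opp \<mu>" "\<kappa> \<in> \<Delta>\<alpha> l" by blast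
    have "0 < q \<nu> \<kappa>" if "\<nu> \<in> opp \<mu>" for \<nu>
    proof -
      have "q \<nu> \<kappa> = q \<kappa> \<kappa>" using that \<kappa> by (intro q_cong) (auto simp: opp_def)
      then show ?thesis using q_pos[OF \<Delta>\<alpha>_\<Delta>[OF \<kappa>(2)]] by simp
    qed
    then have "?W l \<subseteq> span (\<Union>\<nu>\<in>{\<nu> \<in> \<Delta>\<alpha> l. 0 < q \<nu> \<kappa>}. RE \<nu>)" by (intro span_mono) blast
    then have "dim (?W l) \<le> dim (span (\<Union>\<nu>\<in>{\<nu> \<in> \<Delta>\<alpha> l. 0 < q \<nu> \<kappa>}. RE \<nu>))" by (rule dim_subset)
    also have "\<dots> \<le> m" by (rule neighbours_dim[OF \<kappa>(2)])
    finally show ?thesis .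
  qed
  have "(\<Union>\<nu>\<in>opp \<mu>. RE \<nu>) \<subseteq> (\<Union>l\<in>spec \<alpha>. ?W l)"
  proof
    fix z assume "z \<in> (\<Union>\<nu>\<in>opp \<mu>. RE \<nu>)"
    then obtain \<nu> l where "\<nu> \<in> opp \<mu>" "\<nu> \<in> \<Delta>\<alpha> l" "l \<in> spec \<alpha>" "z \<in> RE \<nu>"
      using \<Delta>_cover by (auto simp: opp_def)
    moreover from this have "z \<in> ?W l" by (intro span_base) blast
    ultimately show "z \<in> (\<Union>l\<in>spec \<alpha>. ?W l)" by blast
  qed
  then have "dim (span (\<Union>\<nu>\<in>opp \<mu>. RE \<nu>)) \<le> dim (span (\<Union>l\<in>spec \<alpha>. ?W l))" by (intro dim_subset span_mono)
  also have "\<dots> \<le> (\<Sum>l\<in>spec \<alpha>. dim (?W l))" by (rule dim_sum_le[OF fin])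
  also have "\<dots> \<le> (\<Sum>l\<in>spec \<alpha>. m)" by (intro sum_mono part)
  finally show ?thesis by simp
qed

abbreviation "Kgen \<equiv> {bracket x y | x y. \<exists>\<mu>\<in>\<Delta>. x \<in> RE \<mu> \<and> (\<exists>\<nu>\<in>opp \<mu>. y \<in> RE \<nu>)}"

text \<open>By bilinearity it suffices to bracket each vector of a homogeneous basis of
  \<open>V\<close> with the weight spaces opposite to it. Each basis vector thus contributes at most
  \<open>card (spec \<alpha>) * m\<close> dimensions.\<close>

lemma dim_K: "dim (span Kgen) \<le> dim V * (card (spec \<alpha>) * m)"
proof -
  obtain C where C: "C \<subseteq> (\<Union>\<mu>\<in>\<Delta>. RE \<mu>)" "independent C" "(\<Union>\<mu>\<in>\<Delta>. RE \<mu>) \<subseteq> span C" "card C = dim (\<Union>\<mu>\<in>\<Delta>. RE \<mu>)"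
    using basis_exists by blast
  have finC: "finite C" by (rule finiteI_independent[OF C(2)])
  have "\<forall>c\<in>C. \<exists>\<mu>\<in>\<Delta>. c \<in> RE \<mu>" using C(1) by blast
  then obtain \<kappa> where \<kappa>: "\<And>c. c \<in> C \<Longrightarrow> \<kappa> c \<in> \<Delta>" "\<And>c. c \<in> C \<Longrightarrow> c \<in> RE (\<kappa> c)" by metis
  have C0: "c \<noteq> 0" if "c \<in> C" for c using C(2) that dependent_zero by blast
  let ?Y = "\<lambda>c. bracket c ` span (\<Union>\<nu>\<in>opp (\<kappa> c). RE \<nu>)"
  have "bracket x y \<in> span (\<Union>c\<in>C. ?Y c)" if \<mu>: "\<mu> \<in> \<Delta>" "x \<in> RE \<mu>" "\<nu> \<in> opp \<mu>" "y \<in> RE \<nu>" for x y \<mu> \<nu>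
  proof -
    have "x \<in> span C" using C(3) \<mu> by blast
    have P0: "P \<mu> c = 0" if "c \<in> C" "\<kappa> c \<noteq> \<mu>" for c using P_E[of c "\<kappa> c" \<mu>] \<kappa>(2)[OF that(1)] that(2) by auto
    \<comment> \<open>\<open>P \<mu>\<close> is inserted so that basis vectors of other degrees,
      whose weight \<open>y\<close> need not oppose, drop out.\<close>
    have "bracket (P \<mu> x) y \<in> span (\<Union>c\<in>C. ?Y c)"
    proof (rule lin_image_span[OF lin_comp[OF lin_ad_right lin_P] _ _ \<open>x \<in> span C\<close>])
      fix c assume c: "c \<in> C"
      show "bracket (P \<mu> c) y \<in> span (\<Union>c\<in>C. ?Y c)"
      proof (cases "\<kappa> c = \<mu>")
        case True
        then have "P \<mu> c = c" using P_E[of c \<mu> \<mu>] \<kappa>(2)[OF c] by auto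
        moreover have "bracket c y \<in> ?Y c" using True \<mu> by (intro imageI span_base) blast
        ultimately show ?thesis using c by (intro span_base) auto
      next
        case False
        then show ?thesis by (simp add: P0[OF c] bracket_zero_left span_zero)
      qed
    qed simp
    then show ?thesis using P_E[of x \<mu> \<mu>] \<mu>(2) by simp
  qed
  then have "Kgen \<subseteq> span (\<Union>c\<in>C. ?Y c)" by blast
  then have "dim (span Kgen) \<le> dim (span (\<Union>c\<in>C. ?Y c))"
    by (intro dim_subset span_minimal) auto
  also have "\<dots> \<le> (\<Sum>c\<in>C. dim (?Y c))" by (rule dim_sum_le[OF finC])
  also have "\<dots> \<le> (\<Sum>c\<in>C. card (spec \<alpha>) * m)"
  proof (rule sum_mono)
    fix c
    have "dim (?Y c) \<le> dim (span (\<Union>\<nu>\<in>opp (\<kappa> c). RE \<nu>))" by (rule dim_image_le[OF lin_ad])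
    also have "\<dots> \<le> card (spec \<alpha>) * m" by (rule dim_opp)
    finally show "dim (?Y c) \<le> card (spec \<alpha>) * m" .
  qed
  finally show ?thesis using C(4) by (simp add: dim_span)
qed

text \<open>The sum \<open>J\<close> of the nonzero weight spaces and of the commutators of opposite ones is an ideal
  containing all fixed points in \<open>R\<close>, so Kreknin's theorem forces the perfect ideal \<open>R\<close> into \<open>J\<close>.\<close>

lemma R_subset: "R \<subseteq> span (Kgen \<union> (\<Union>\<mu>\<in>\<Delta>. RE \<mu>))"
proof -
  define J where "J = span (Kgen \<union> (\<Union>\<mu>\<in>\<Delta>. RE \<mu>))"
  have sJ: "subspace J" by (simp add: J_def)
  have VJ: "z \<in> J" if "\<mu> \<in> \<Delta>" "z \<in> RE \<mu>" for \<mu> z unfolding J_def using that by (intro span_base) blast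
  have KJ: "bracket x y \<in> J" if "\<mu> \<in> \<Delta>" "x \<in> RE \<mu>" "\<nu> \<in> opp \<mu>" "y \<in> RE \<nu>" for x y \<mu> \<nu>
    unfolding J_def using that by (intro span_base) blast
  \<comment> \<open>If the bracket has nonzero weight it lies in a root space. Otherwise
    \<open>z\<close> and \<open>x\<close> have opposite nonzero weights, and the bracket is one of
    the generators in \<open>Kgen\<close>.\<close>
  have step: "bracket z x \<in> J" if z: "z \<in> RE \<kappa>" and x: "\<mu> \<in> \<Delta>" "x \<in> RE \<mu>" for z \<kappa> x \<mu>
  proof (cases "bracket z x = 0")
    case True then show ?thesis by (simp add: subspace_0[OF sJ])
  next
    case False
    have add: "wt (\<kappa> * \<mu>) h = wt \<kappa> h + wt \<mu> h" if "h \<in> A" for h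
      using wt_bracket_add[OF that _ _ False] z x by blast
    show ?thesis
    proof (cases "\<kappa> * \<mu> \<in> \<Delta>")
      case True then show ?thesis using VJ RE_bracket[OF z x(2)] by blast
    next
      case no: False
      then have w0: "wt (\<kappa> * \<mu>) h = 0" if "h \<in> A" for h
        using \<Delta>_I[OF RE_bracket[OF z x(2)] False that] by blast
      have w: "wt \<kappa> h = - wt \<mu> h" if "h \<in> A" for h
        using add[OF that] w0[OF that] by (simp add: eq_neg_iff_add_eq_0)
      obtain h where h: "h \<in> A" "wt \<mu> h \<noteq> 0" using x(1) by (auto simp: \<Delta>_def)
      have "z \<noteq> 0" using False by (auto simp: bracket_zero_left)
      then have "\<kappa> \<in> \<Delta>" using \<Delta>_I[OF z _ h(1)] w[OF h(1)] h(2) by simp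
      moreover have "\<mu> \<in> opp \<kappa>" using x(1) w by (simp add: opp_def)
      ultimately show ?thesis using KJ z x by blast
    qed
  qed
  have adJ: "bracket z v \<in> J" if z: "z \<in> RE \<kappa>" and v: "v \<in> J" for z v \<kappa>
  proof (rule lin_image_span[OF lin_ad _ sJ v[unfolded J_def]])
    fix u assume "u \<in> Kgen \<union> (\<Union>\<mu>\<in>\<Delta>. RE \<mu>)"
    then consider x y \<mu> \<nu> where "u = bracket x y" "\<mu> \<in> \<Delta>" "x \<in> RE \<mu>" "\<nu> \<in> opp \<mu>" "y \<in> RE \<nu>"
      | \<mu> where "\<mu> \<in> \<Delta>" "u \<in> RE \<mu>" by blast
    then show "bracket z u \<in> J"
    proof cases
      case 1
      have "\<nu> \<in> \<Delta>" using 1(4) by (simp add: opp_def)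
      have "bracket z u = bracket (bracket z x) y - bracket (bracket z y) x"
        using ad_derivation[of z x y] bracket_antisym[of x "bracket z y"] by (simp add: 1(1))
      moreover have "bracket (bracket z x) y \<in> J" by (rule step[OF RE_bracket[OF z 1(3)] \<open>\<nu> \<in> \<Delta>\<close> 1(5)])
      moreover have "bracket (bracket z y) x \<in> J" by (rule step[OF RE_bracket[OF z 1(5)] 1(2,3)])
      ultimately show ?thesis by (simp add: subspace_diff[OF sJ])
    next
      case 2 then show ?thesis by (rule step[OF z])
    qed
  qed
  have "bracket z v \<in> J" if v: "v \<in> J" for z v
  proof -
    obtain r where r: "r \<in> R" "\<And>y. bracket z y = bracket r y" using inner by blast
    have "(\<Sum>\<kappa>\<in>S. bracket (P \<kappa> r) v) \<in> J" by (intro subspace_sum[OF sJ] adJ[OF P_RE[OF r(1)] v])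
    then show ?thesis by (simp only: r(2) lin_sum[OF lin_ad_right, symmetric] sum_P)
  qed
  then have iJ: "ideal J" using sJ by (simp add: ideal_def)
  have fJ: "f v \<in> J" if "v \<in> J" for v
  proof (rule lin_image_span[OF lin_f _ sJ that[unfolded J_def]])
    fix u assume "u \<in> Kgen \<union> (\<Union>\<mu>\<in>\<Delta>. RE \<mu>)"
    then consider x y \<mu> \<nu> where "u = bracket x y" "\<mu> \<in> \<Delta>" "x \<in> RE \<mu>" "\<nu> \<in> opp \<mu>" "y \<in> RE \<nu>"
      | \<mu> where "\<mu> \<in> \<Delta>" "u \<in> RE \<mu>" by blast
    then show "f u \<in> J"
    proof cases
      case 1
      then have "f u = scale (\<mu> * \<nu>) u" using E_bracket[of x \<mu> y \<nu>] by (auto simp: eig_def)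
      then show ?thesis using KJ[OF 1(2-5)] 1(1) by (simp add: subspace_scale[OF sJ])
    next
      case 2
      then have "f u = scale \<mu> u" by (auto simp: eig_def)
      then show ?thesis using VJ[OF 2] by (simp add: subspace_scale[OF sJ])
    qed
  qed
  \<comment> \<open>Outside \<open>\<Delta>\<close> either \<open>x\<close> is 0 or its weight
    vanishes on \<open>A\<close>; in both cases the bracket is orthogonal to \<open>A\<close> and
    therefore 0.\<close>
  have pair: "bracket x y \<in> J" if x: "x \<in> RE \<mu>" and y: "y \<in> RE (1 / \<mu>)" and \<mu>: "\<mu> \<in> S" for x y \<mu>
  proof (cases "\<mu> \<in> \<Delta>")
    case True
    have "bracket y x \<in> J" by (rule step[OF y True x])
    then show ?thesis using bracket_antisym[of x y] subspace_neg[OF sJ] by simp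
  next
    case False
    have A: "bracket x y \<in> A" using RE_bracket[OF x y] spec_nonzero[OF diag \<mu>] by (simp add: A_RE)
    have "bracket x y = 0"
    proof (rule A_nondeg[OF A])
      fix h assume h: "h \<in> A"
      have "x = 0 \<or> wt \<mu> h = 0" using False \<Delta>_I[OF x _ h] by blast
      then show "kap (bracket x y) h = 0"
        using kap_bracket_A[OF x h] by (auto simp: bracket_zero_left kap_0_left)
    qed
    then show ?thesis by (simp add: subspace_0[OF sJ])
  qed
  \<comment> \<open>Since \<open>R\<close> is perfect, its fixed points are sums of brackets of
    components of inverse degrees.\<close>
  have P1: "P 1 z \<in> J" if "z \<in> R" for z
  proof -
    have "P 1 u \<in> J" if u: "u \<in> {bracket a b | a b. a \<in> R \<and> b \<in> R}" for u
    proof -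
      obtain a b where ab: "a \<in> R" "b \<in> R" "u = bracket a b" using u by blast
      have "P 1 u = (\<Sum>\<mu>\<in>S. \<Sum>\<kappa>\<in>S. P 1 (bracket (P \<mu> a) (P \<kappa> b)))"
        unfolding ab(3) lin_sum[OF lin_P, symmetric] lin_sum[OF lin_ad, symmetric] lin_sum[OF lin_ad_right, symmetric] sum_P ..
      also have "\<dots> \<in> J"
      proof (intro subspace_sum[OF sJ])
        fix \<mu> \<kappa> assume "\<mu> \<in> S" "\<kappa> \<in> S"
        have "\<kappa> = 1 / \<mu>" if "1 = \<mu> * \<kappa>" using that spec_nonzero[OF diag \<open>\<mu> \<in> S\<close>] by (simp add: field_simps)
        then show "P 1 (bracket (P \<mu> a) (P \<kappa> b)) \<in> J"
          using pair[OF P_RE[OF ab(1)] _ \<open>\<mu> \<in> S\<close>] P_RE[OF ab(2)] subspace_0[OF sJ]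
          by (auto simp: P_E[OF E_bracket[OF P_mem P_mem]])
      qed
      finally show ?thesis .
    qed
    moreover have "z \<in> span {bracket a b | a b. a \<in> R \<and> b \<in> R}"
      using that perfect by (simp add: bracket_span_def)
    ultimately show ?thesis by (rule lin_image_span[OF lin_P _ sJ])
  qed
  have "R \<inter> E 1 \<subseteq> J" using P1 P_E[of _ 1 1] by force
  moreover have "graded_subalgebra f R"
    using subR ideal_bracket_right[OF ideal_R] fR by (simp add: graded_subalgebra_def)
  ultimately have "derived_series R (2 ^ card S) \<subseteq> J" using kreknin[OF diag iJ fJ] by blast
  moreover have "derived_series R k = R" for k by (induction k) (simp_all add: perfect)
  ultimately show ?thesis by (simp add: J_def)
qed

lemma dim_R_le:
  "dim R \<le> 2 * dim (eig \<alpha> 1) ^ 2 * card (spec \<alpha>) + 2 * dim (eig \<alpha> 1) ^ 3 * card (spec \<alpha>) ^ 2"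
proof -
  let ?n = "card (spec \<alpha>)"
  let ?F = "\<lambda>b. if b then Kgen else (\<Union>\<mu>\<in>\<Delta>. RE \<mu>)"
  have "Kgen \<union> (\<Union>\<mu>\<in>\<Delta>. RE \<mu>) = (\<Union>b\<in>{True, False}. ?F b)" by (simp add: Un_commute)
  then have "dim R \<le> dim (span (\<Union>b\<in>{True, False}. ?F b))"
    using R_subset by (intro dim_subset) simp
  also have "\<dots> \<le> (\<Sum>b\<in>{True, False}. dim (?F b))" by (rule dim_sum_le) simp
  also have "\<dots> = dim (span Kgen) + dim V" by (simp add: dim_span)
  also have "\<dots> \<le> dim V * (?n * m) + dim V" using dim_K by simp
  also have "\<dots> \<le> (?n * (2 * m * m)) * (?n * m) + ?n * (2 * m * m)"
    using dim_V by (intro add_mono mult_right_mono) auto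
  finally show ?thesis by (simp add: power2_eq_square power3_eq_cube algebra_simps)
qed

end

subsection \<open>Passing to the quotient by the radical\<close>

context fd_lie_algebra
begin

lemma finite_dim: finite_dim
  unfolding finite_dim_def using finite_Basis span_Basis by blast

lemma derived_series_eq_0: "derived_series A k \<subseteq> {0} \<Longrightarrow> subspace A \<Longrightarrow> solvable A"
  using subspace_0[OF subspace_derived_series] unfolding solvable_def by blast

lemma solvable_if_derived_series_subset:
  assumes "derived_series A k \<subseteq> B" "solvable B" "subspace A" shows "solvable A"
proof -
  obtain l where "derived_series B l = {0}" using assms by (auto simp: solvable_def)
  then have "derived_series A (k + l) \<subseteq> {0}"
    using derived_series_mono[OF assms(1), of l] by (simp add: derived_series_add)
  then show ?thesis using assms(3) by (rule derived_series_eq_0)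
qed

lemma abelian_solvable:
  assumes "subspace A" "\<And>x y. x \<in> A \<Longrightarrow> y \<in> A \<Longrightarrow> bracket x y = 0" shows "solvable A"
proof (rule derived_series_eq_0[OF _ assms(1)])
  have "bracket_span A A \<subseteq> {0}" by (rule bracket_span_le) (simp_all add: assms(2))
  then show "derived_series A (Suc 0) \<subseteq> {0}" by simp
qed

text \<open>An automorphism is onto, so the image of the radical is again an ideal; it is also
  solvable, and the radical contains all such ideals.\<close>

lemma automorphism_solvable_radical:
  assumes f: "automorphism f" and x: "x \<in> solvable_radical" shows "f x \<in> solvable_radical"
proof -
  let ?r = "solvable_radical"
  note L = automorphism_lin[OF f]
  note sub_image = lin_image_subspace[OF L]
  have ir: "ideal ?r" and sr: "solvable ?r"
    using solvable_radical_greatest[OF finite_dim] by blast+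
  have "bracket z (f y) \<in> f ` ?r" if "y \<in> ?r" for z y
  proof -
    obtain z' where "z = f z'" using bij_is_surj[OF automorphism_bij[OF f]] by (metis surjD)
    then have "bracket z (f y) = f (bracket z' y)" by (simp add: automorphism_bracket[OF f])
    then show ?thesis using ideal_bracket_right[OF ir that] by blast
  qed
  then have "ideal (f ` ?r)" using sub_image[OF ideal_subspace[OF ir]] by (auto simp: ideal_def)
  moreover have "derived_series (f ` ?r) k \<subseteq> f ` derived_series ?r k" for k
  proof (induction k)
    case (Suc k)
    have "bracket u v \<in> f ` derived_series ?r (Suc k)"
      if uv: "u \<in> derived_series (f ` ?r) k" "v \<in> derived_series (f ` ?r) k" for u v
    proof -
      obtain a b where ab: "a \<in> derived_series ?r k" "b \<in> derived_series ?r k" "u = f a" "v = f b"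
        using Suc uv by blast
      then show ?thesis using bracket_span_mem[OF ab(1,2)] by (simp add: automorphism_bracket[OF f, symmetric])
    qed
    then show ?case
      using bracket_span_le[OF sub_image[OF subspace_derived_series[OF ideal_subspace[OF ir], of "Suc k"]]]
      by (simp only: derived_series.simps(2)[of "f ` ?r"])
  qed simp
  then have "solvable (f ` ?r)"
    using sr derived_series_eq_0[OF _ ideal_subspace[OF \<open>ideal (f ` ?r)\<close>]] lin_0[OF L]
    unfolding solvable_def[of ?r] by (metis image_empty image_insert)
  ultimately have "f ` ?r \<subseteq> ?r" using solvable_radical_greatest(3)[OF finite_dim] by blast
  then show ?thesis using x by blast
qed

text \<open>An invariant subspace of a diagonalizable map is spanned by eigenvectors, so an
  eigenvector basis of \<open>U\<close> extends to one of the whole space. The projection kills the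
  first part and keeps the rest; it commutes with \<open>\<alpha>\<close> because both are diagonal
  in this basis.\<close>

lemma ex_invariant_projection:
  assumes a: "diag_aut \<alpha>" and U: "subspace U" "\<And>x. x \<in> U \<Longrightarrow> \<alpha> x \<in> U"
  obtains p where "lin p" "\<And>x. p (\<alpha> x) = \<alpha> (p x)" "\<And>x. p (p x) = p x" "\<And>x. p x = 0 \<longleftrightarrow> x \<in> U"
proof -
  note L = diag_autD(2)[OF a]
  define G where "G = (\<Union>c. eig \<alpha> c)"
  obtain C where C: "C \<subseteq> U \<inter> G" "independent C" "U \<inter> G \<subseteq> span C"
    using maximal_independent_subset by blast
  obtain T where T: "C \<subseteq> T" "T \<subseteq> G" "independent T" "G \<subseteq> span T"
    using maximal_independent_subset_extend[of C G] C by blast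
  have dec: "x \<in> span (V \<inter> G)" if "x \<in> V" "subspace V" "\<And>x. x \<in> V \<Longrightarrow> \<alpha> x \<in> V" for x V
  proof -
    have "gproj \<alpha> c x \<in> V \<inter> G" for c
      using gproj_invariant[OF L that(2,3,1)] eig_proj(1)[OF a] by (auto simp: G_def)
    then have "(\<Sum>c\<in>spec \<alpha>. gproj \<alpha> c x) \<in> span (V \<inter> G)" by (intro span_sum span_base)
    then show ?thesis by (simp add: sum_gproj[OF L])
  qed
  have "span C = U"
  proof
    show "span C \<subseteq> U" using C(1) U(1) by (intro span_minimal) auto
    show "U \<subseteq> span C" using dec[OF _ U] C(3) span_minimal[of "U \<inter> G" "span C"] by blast
  qed
  have spT: "span T = UNIV"
    using dec[of _ UNIV] T(4) span_minimal[of G "span T"] by auto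
  obtain p where p: "lin p" "\<And>b. b \<in> T \<Longrightarrow> p b = (if b \<in> C then 0 else b)"
    using lin_extend[OF T(3), of "\<lambda>b. if b \<in> C then 0 else b"] by blast
  have "p (\<alpha> x) = \<alpha> (p x)" for x
  proof (rule lin_ext_span[OF lin_comp[OF p(1) L] lin_comp[OF L p(1)], of T])
    fix b assume b: "b \<in> T"
    then obtain c where "\<alpha> b = scale c b" using T(2) by (auto simp: G_def eig_def)
    then show "p (\<alpha> b) = \<alpha> (p b)" using p(2)[OF b] by (simp add: lin_scale[OF p(1)] lin_0[OF L])
  qed (simp add: spT)
  moreover have "p (p x) = p x" for x
    by (rule lin_ext_span[OF lin_comp[OF p(1) p(1)] p(1), of T]) (simp_all add: p(2) lin_0[OF p(1)] spT)
  moreover have "p x = 0 \<longleftrightarrow> x \<in> U" for x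
  proof
    have "x - p x \<in> U"
    proof (rule lin_image_span[OF lin_minus[OF lin_id(1) p(1)] _ U(1), of T])
      fix b assume "b \<in> T"
      then show "b - p b \<in> U" using C(1) subspace_0[OF U(1)] by (auto simp: p(2))
    qed (simp add: spT)
    then show "x \<in> U" if "p x = 0" using that by simp
  next
    assume "x \<in> U"
    then have "x \<in> span C" by (simp only: \<open>span C = U\<close>)
    then show "p x = 0" using T(1) p(2) by (intro lin_ext_span[OF p(1) lin_zero, of C x]) auto
  qed
  ultimately show ?thesis using that p(1) by blast
qed

text \<open>The quotient is realized on the original space: the bracket followed by the projection
  \<open>p\<close> along the radical is a Lie bracket for which the radical acts as zero, and the
  range of \<open>p\<close> is a copy of the quotient. So \<open>\<alpha>\<close> stays the same map
  with the same eigenspaces.\<close>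

theorem quotient_dim_radical_bound:
  assumes a: "diag_aut \<alpha>"
  shows "quotient_dim solvable_radical \<le>
    2 * dim (eig \<alpha> 1) ^ 2 * card (spec \<alpha>) + 2 * dim (eig \<alpha> 1) ^ 3 * card (spec \<alpha>) ^ 2"
proof -
  define r where "r = solvable_radical"
  have ir: "ideal r" and sr: "solvable r" and greatest: "\<And>I. ideal I \<Longrightarrow> solvable I \<Longrightarrow> I \<subseteq> r"
    using solvable_radical_greatest[OF finite_dim] unfolding r_def by blast+
  note aut = diag_autD(1)[OF a]
  obtain p where p: "lin p" "\<And>x. p (\<alpha> x) = \<alpha> (p x)" "\<And>x. p (p x) = p x" "\<And>x. p x = 0 \<longleftrightarrow> x \<in> r"
    using ex_invariant_projection[OF a ideal_subspace[OF ir]] automorphism_solvable_radical[OF aut]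
    unfolding r_def by metis
  define b where "b x y = p (bracket (p x) (p y))" for x y
  have p_ad: "p (bracket (p x) y) = p (bracket x y)" for x y
  proof -
    have "x - p x \<in> r" using p(4)[of "x - p x"] by (simp add: lin_diff[OF p(1)] p(3))
    then have "p (bracket (x - p x) y) = 0" using p(4) ideal_bracket_left[OF ir] by blast
    then show ?thesis by (simp add: lin_diff[OF lin_ad_right] lin_diff[OF p(1)])
  qed
  have p_ad': "p (bracket x (p y)) = p (bracket x y)" for x y
    using p_ad[of y x] bracket_antisym[of x "p y"] bracket_antisym[of x y]
      lin_scale[OF p(1), of "-1" "bracket (p y) x"] lin_scale[OF p(1), of "-1" "bracket y x"] by simp
  have b_eq: "b x y = p (bracket x y)" for x y by (simp add: b_def p_ad p_ad')
  interpret q: fd_lie_algebra scale b Basis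
  proof unfold_locales
    fix x y z c
    show "b (x + y) z = b x z + b y z" "b x (y + z) = b x y + b x z"
      "b (scale c x) y = scale c (b x y)" "b x (scale c y) = scale c (b x y)" "b x x = 0"
      by (simp_all add: b_eq bracket_add_left bracket_add_right bracket_scale_left bracket_scale_right
          bracket_self lin_add[OF p(1)] lin_scale[OF p(1)] lin_0[OF p(1)])
    have "b x (b y z) + b y (b z x) + b z (b x y) =
        p (bracket x (bracket y z) + bracket y (bracket z x) + bracket z (bracket x y))"
      by (simp only: b_eq p_ad' lin_add[OF p(1)])
    then show "b x (b y z) + b y (b z x) + b z (b x y) = 0" by (simp add: jacobi lin_0[OF p(1)])
  qed
  have pb: "p (b x y) = b x y" for x y by (simp add: b_eq p(3))
  have bp: "b (p x) y = b x y" "b x (p y) = b x y" for x y by (simp_all add: b_def p(3))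
  have q_aut: "q.automorphism \<alpha>"
    using aut unfolding automorphism_def q.automorphism_def by (simp add: b_eq p(2)[symmetric])
  have q_diag: "q.diag_aut \<alpha>"
    using q_aut diag_autD(3)[OF a] by (simp add: q.diag_aut_def)
  note p_image = lin_image_subspace[OF p(1)]
  \<comment> \<open>The set \<open>I'\<close> of vectors that agree with \<open>I\<close> modulo
    \<open>r\<close> is an ideal for the original bracket. Some derived term of it falls into
    \<open>r\<close>, so it is solvable and lies in \<open>r\<close>.\<close>
  have q_solvable: "I \<subseteq> r" if I: "q.ideal I" "q.solvable I" for I
  proof -
    have sI: "subspace I" by (rule q.ideal_subspace[OF I(1)])
    define I' where "I' = {x. p x \<in> p ` I}"
    have sI': "subspace I'"
    proof (intro subspaceI)
      note s = p_image[OF sI]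
      show "0 \<in> I'" using subspace_0[OF s] by (simp add: I'_def lin_0[OF p(1)])
      show "x + y \<in> I'" if "x \<in> I'" "y \<in> I'" for x y
        using subspace_add[OF s] that by (simp add: I'_def lin_add[OF p(1)])
      show "scale c x \<in> I'" if "x \<in> I'" for c x
        using subspace_scale[OF s] that by (simp add: I'_def lin_scale[OF p(1)])
    qed
    have "bracket x y \<in> I'" if y: "y \<in> I'" for x y
    proof -
      obtain i where i: "i \<in> I" "p y = p i" using y by (auto simp: I'_def)
      have "p (bracket x y) = b x (p y)" by (simp add: b_eq p_ad')
      also have "\<dots> = p (b x i)" by (simp add: i(2) bp pb)
      finally have "p (bracket x y) = p (b x i)" .
      then show ?thesis using q.ideal_bracket_right[OF I(1) i(1)] by (auto simp: I'_def)
    qed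
    then have iI': "ideal I'" using sI' by (simp add: ideal_def)
    have "p x \<in> p ` q.derived_series I k" if "x \<in> derived_series I' k" for k x
      using that
    proof (induction k arbitrary: x)
      case 0 then show ?case by (simp add: I'_def)
    next
      case (Suc k)
      have "p (bracket u v) \<in> p ` q.derived_series I (Suc k)"
        if uv: "u \<in> derived_series I' k" "v \<in> derived_series I' k" for u v
      proof -
        obtain u' v' where *: "u' \<in> q.derived_series I k" "v' \<in> q.derived_series I k" "p u = p u'" "p v = p v'"
          using Suc.IH[OF uv(1)] Suc.IH[OF uv(2)] by blast
        have "p (bracket u v) = b (p u) (p v)" by (simp add: b_eq p_ad p_ad')
        also have "\<dots> = p (b u' v')" by (simp add: *(3,4) bp pb)
        finally have "p (bracket u v) = p (b u' v')" .
        then show ?thesis using q.bracket_span_mem[OF *(1,2)] by simp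
      qed
      then show ?case
        using image_bracket_span_le[OF p(1) _ p_image[OF q.subspace_derived_series[OF sI, of "Suc k"]],
            of "derived_series I' k" "derived_series I' k" x] Suc.prems
        by simp
    qed
    moreover obtain k where "q.derived_series I k = {0}" using I(2) by (auto simp: q.solvable_def)
    ultimately have "derived_series I' k \<subseteq> r" using p(4) lin_0[OF p(1)] by fastforce
    then have "solvable I'" by (rule solvable_if_derived_series_subset[OF _ sr sI'])
    then have "I' \<subseteq> r" by (rule greatest[OF iI'])
    then show ?thesis by (auto simp: I'_def)
  qed
  define W where "W = range p"
  have sW: "subspace W" using p_image[of UNIV] by (simp add: W_def)
  have pW: "p x = x" if "x \<in> W" for x using that p(3) by (auto simp: W_def)
  have bW: "b x y \<in> W" for x y using pb[of x y] by (auto simp: W_def intro: range_eqI[of _ _ "b x y"])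
  have Wr: "x = 0" if "x \<in> W" "x \<in> r" for x using that pW p(4) by metis
  \<comment> \<open>The line through a central \<open>x\<close> is an abelian ideal, hence inside
    \<open>r\<close>, which meets \<open>W\<close> only in 0.\<close>
  have central: "x = 0" if x: "x \<in> W" "\<And>y. b x y = 0" for x
  proof -
    let ?I = "span {x}"
    have z: "b u v = 0" if "u \<in> ?I" for u v
      by (rule lin_ext_span[OF q.lin_ad_right[of v] lin_zero _ that]) (use x(2) in simp)
    have "b u v = 0" if "v \<in> ?I" for u v using z[OF that, of u] q.bracket_antisym[of u v] by simp
    then have "q.ideal ?I" by (simp add: q.ideal_def span_zero)
    moreover have "q.solvable ?I" by (rule q.abelian_solvable) (simp_all add: z)
    ultimately have "?I \<subseteq> r" by (rule q_solvable)
    then show ?thesis using Wr[OF x(1)] span_base[of x "{x}"] by blast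
  qed
  define N where "N = {x. \<forall>y. q.kap x y = 0}"
  have N_ideal: "q.ideal N"
    unfolding q.ideal_def
  proof (intro conjI allI ballI)
    show "subspace N"
      by (intro subspaceI) (simp_all add: N_def q.kap_0_left q.kap_add_left q.kap_scale_left)
    fix x y assume "y \<in> N"
    then have "q.kap (b x y) z = 0" for z
      using q.kap_scale_left[of "-1" "b y x" z] q.bracket_antisym[of x y] q.kap_invariant[of y x z]
      by (simp add: N_def)
    then show "b x y \<in> N" by (simp add: N_def)
  qed
  have N_aut: "g x \<in> N" if g: "q.automorphism g" and x: "x \<in> N" for g x
  proof -
    have "q.kap (g x) y = 0" for y
    proof -
      obtain y' where "y = g y'" using bij_is_surj[OF q.automorphism_bij[OF g]] by (metis surjD)
      then show ?thesis using x q.kap_automorphism[OF g] by (simp add: N_def)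
    qed
    then show ?thesis by (simp add: N_def)
  qed
  have "N \<subseteq> r"
  proof -
    let ?D = "q.derived_series N"
    have anti: "?D j \<subseteq> ?D i" if "i \<le> j" for i j
      using N_ideal that by (intro q.derived_series_antimono) (auto simp: q.ideal_def)
    have iD: "q.ideal (?D k)" for k by (rule q.ideal_derived_series[OF N_ideal])
    \<comment> \<open>A term of least dimension is perfect. If it were nonzero, Cartan's criterion
      and Engel's theorem would give it a nonzero centre, an abelian ideal and hence inside
      \<open>r\<close>; but a perfect ideal is spanned by values of \<open>b\<close> and so lies in
      \<open>W\<close>.\<close>
    obtain k where k: "\<And>j. dim (?D k) \<le> dim (?D j)"
      using ex_has_least_nat[of "\<lambda>_. True" 0 "\<lambda>k. dim (?D k)"] by auto
    have perf: "?D (Suc k) = ?D k"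
      using anti[of k "Suc k"] k[of "Suc k"] by (intro subspace_dim_equal q.ideal_subspace[OF iD]) auto
    have "?D k = {0}"
    proof (rule ccontr)
      assume nz: "?D k \<noteq> {0}"
      have "\<exists>v\<in>?D k. v \<noteq> 0 \<and> (\<forall>x\<in>?D k. b x v = 0)"
      proof (rule q.kap_zero_perfect_center[OF iD _ _ _ nz])
        show "q.bracket_span (?D k) (?D k) = ?D k" using perf by simp
        show "g x \<in> ?D k" if "q.automorphism g" "x \<in> ?D k" for g x
          using q.automorphism_derived_series[OF that(1) N_aut[OF that(1)] that(2)] .
        show "q.kap x y = 0" if "x \<in> ?D k" "y \<in> ?D k" for x y
          using that anti[of 0 k] by (auto simp: N_def)
      qed
      then obtain v where v: "v \<in> ?D k" "v \<noteq> 0" "\<And>x. x \<in> ?D k \<Longrightarrow> b x v = 0" by blast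
      define C where "C = {v \<in> ?D k. \<forall>x\<in>?D k. b x v = 0}"
      have C_ideal: "q.ideal C"
        unfolding q.ideal_def
      proof (intro conjI allI ballI)
        show "subspace C"
          using q.ideal_subspace[OF iD, of k] unfolding C_def
          by (intro subspaceI) (auto simp: subspace_0 subspace_add subspace_scale q.bracket_add_right
              q.bracket_scale_right q.bracket_zero_right)
        fix x u assume u: "u \<in> C"
        have "b y (b x u) = 0" if y: "y \<in> ?D k" for y
          using u y q.ideal_bracket_left[OF iD y, of x] q.ad_derivation[of y x u]
          by (simp add: C_def q.bracket_zero_right)
        then show "b x u \<in> C" using u q.ideal_bracket_right[OF iD] by (simp add: C_def)
      qed
      have "q.solvable C"
        by (rule q.abelian_solvable[OF q.ideal_subspace[OF C_ideal]]) (simp add: C_def)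
      then have "C \<subseteq> r" by (rule q_solvable[OF C_ideal])
      then have "v \<in> r" using v by (auto simp: C_def)
      moreover have "?D (Suc k) \<subseteq> W" using sW bW by (simp add: q.bracket_span_le)
      then have "v \<in> W" using v(1) perf by blast
      ultimately show False using Wr v(2) by blast
    qed
    then have "q.solvable N" by (auto simp: q.solvable_def)
    then show ?thesis by (rule q_solvable[OF N_ideal])
  qed
  have nondeg: "x = 0" if x: "x \<in> W" "\<And>y. y \<in> W \<Longrightarrow> q.kap x y = 0" for x
  proof -
    have "q.kap x y = q.kap x (p y)" for y by (simp add: q.kap_def bp)
    then have "x \<in> N" using x(2) by (simp add: N_def W_def)
    then show ?thesis using \<open>N \<subseteq> r\<close> Wr x(1) by blast
  qed
  have W_ideal: "q.ideal W" using sW bW by (simp add: q.ideal_def)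
  have perfect: "q.bracket_span W W = W"
  proof (rule ccontr)
    let ?U = "q.bracket_span W W"
    assume ne: "?U \<noteq> W"
    have sU: "subspace ?U" by (rule q.subspace_bracket_span)
    have UW: "?U \<subseteq> W" by (rule q.bracket_span_self_le[OF W_ideal])
    then have lt: "dim ?U < dim W" using subspace_dim_equal[OF sU sW UW] ne by linarith
    obtain C where C: "C \<subseteq> ?U" "independent C" "?U \<subseteq> span C" "card C = dim ?U"
      by (rule basis_exists[of ?U])
    have finC: "finite C" by (rule finiteI_independent[OF C(2)])
    \<comment> \<open>\<open>\<phi>\<close> encodes the pairing with a basis of \<open>?U\<close> as
      a map into \<open>?U\<close>, so that counting dimensions gives a nonzero \<open>x\<close> in
      \<open>W\<close> orthogonal to \<open>?U\<close>. By invariance every \<open>b x y\<close> is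
      then orthogonal to \<open>W\<close>, and \<open>x\<close> is central.\<close>
    define \<phi> where "\<phi> x = (\<Sum>c\<in>C. scale (q.kap x c) c)" for x
    have l\<phi>: "lin \<phi>"
      by (rule linI) (simp_all add: \<phi>_def q.kap_add_left q.kap_scale_left scale_left_distrib sum.distrib
          scale_sum_right)
    have "\<phi> x \<in> ?U" for x unfolding \<phi>_def using C(1) by (intro subspace_sum[OF sU] subspace_scale[OF sU]) blast
    then have "dim (\<phi> ` W) \<le> dim ?U" by (intro dim_subset) blast
    then obtain x where x: "x \<in> W" "x \<noteq> 0" "\<phi> x = 0" using lin_kernel_nonzero[OF l\<phi> sW] lt by (metis le_less_trans)
    have kC: "q.kap x c = 0" if "c \<in> C" for c
      using independentD[OF C(2) finC subset_refl, of "q.kap x" c] x(3) that by (simp add: \<phi>_def)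
    have lk: "q.kap x u = 0" if "u \<in> span C" for u
      using that by (induction rule: span_induct_alt) (simp_all add: q.kap_0_right q.kap_add_right q.kap_scale_right kC)
    have "b x y = 0" for y
    proof (rule nondeg[OF bW])
      fix w
      have "b y w \<in> ?U" using q.bracket_span_mem[of "p y" W "p w" W] by (simp add: W_def bp)
      then show "q.kap (b x y) w = 0" using lk C(3) by (auto simp: q.kap_invariant)
    qed
    then show False using central x by blast
  qed
  define Q where "Q \<beta> \<longleftrightarrow> (\<forall>\<mu>. \<exists>l. eig \<beta> \<mu> \<subseteq> eig \<alpha> l) \<and> eig \<beta> 1 \<subseteq> eig \<alpha> 1" for \<beta>
  have "\<exists>\<beta>. q.diag_aut \<beta> \<and> Q \<beta> \<and> q.saturated \<beta> W"
  proof (rule q.ex_saturated[OF q_diag])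
    show "Q \<alpha>" by (auto simp: Q_def)
    show "Q \<beta>'" if "Q \<beta>" "\<forall>\<mu>. \<exists>l. eig \<beta>' \<mu> \<subseteq> eig \<beta> l" "eig \<beta>' 1 \<subseteq> eig \<beta> 1" for \<beta> \<beta>'
      using that unfolding Q_def by (meson subset_trans)
  qed
  then obtain \<beta> where \<beta>: "q.diag_aut \<beta>" "Q \<beta>" "q.saturated \<beta> W" by blast
  interpret s: semisimple_grading scale b Basis \<beta> W \<alpha>
  proof unfold_locales
    show "q.ideal W" by (rule W_ideal)
    \<comment> \<open>\<open>W\<close> is the span of all brackets of the whole space, so every
      automorphism of \<open>b\<close> preserves it.\<close>
    show "\<beta> x \<in> W" if "x \<in> W" for x
      using q.automorphism_bracket_span[OF q.diag_autD(1)[OF \<beta>(1)], of UNIV UNIV x] that perfect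
        q.bracket_span_mono[of W UNIV W UNIV] q.bracket_span_le[OF sW, of UNIV UNIV] bW by auto
    show "\<exists>r\<in>W. \<forall>y. b x y = b r y" for x
      by (intro bexI[of _ "p x"]) (simp_all add: W_def bp)
  qed (use \<beta> sW perfect nondeg q_diag in \<open>auto simp: Q_def\<close>)
  have "dim UNIV \<le> dim (span (\<Union>c\<in>{True, False}. if c then W else r))"
  proof (intro dim_subset subsetI)
    fix x
    have "x - p x \<in> r" using p(4)[of "x - p x"] by (simp add: lin_diff[OF p(1)] p(3))
    then have "p x + (x - p x) \<in> span (\<Union>c\<in>{True, False}. if c then W else r)"
      by (intro span_add span_base) (auto simp: W_def)
    then show "x \<in> span (\<Union>c\<in>{True, False}. if c then W else r)" by simp
  qed
  also have "\<dots> \<le> (\<Sum>c\<in>{True, False}. dim (if c then W else r))" by (rule dim_sum_le) simp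
  finally have "dim UNIV \<le> dim W + dim r" by simp
  then have "quotient_dim r \<le> dim W"
    using quotient_dim_eq(3)[OF finite_dim ideal_subspace[OF ir]] by linarith
  then show ?thesis using s.dim_R_le by (simp add: r_def)
qed

end

theorem corollary1:
  fixes scale :: "complex \<Rightarrow> 'a::ab_group_add \<Rightarrow> 'a"
    and bracket :: "'a \<Rightarrow> 'a \<Rightarrow> 'a"
    and \<alpha> :: "'a \<Rightarrow> 'a"
    and m n :: nat
  assumes "lie_algebra scale bracket"
    and "lie_algebra.finite_dim scale"
    and "lie_algebra.automorphism scale bracket \<alpha>"
    and "lie_algebra.diagonalizable scale \<alpha>"
    and "card (lie_algebra.eigenvalues scale \<alpha>) = n"
    and "vector_space.dim scale {x. \<alpha> x = x} = m"
  shows "lie_algebra.derived_length scale bracket (lie_algebra.solvable_radical scale bracket)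
           \<le> (m + 1) * 2 ^ n + m
         \<and> lie_algebra.quotient_dim scale (lie_algebra.solvable_radical scale bracket)
           \<le> 16 * (m * n) ^ 3 + 4 * (m * n) ^ 2 + 224 * (m * n)"
proof -
  interpret lie_algebra scale bracket by fact
  obtain B0 where B0: "finite B0" "span B0 = UNIV" using assms(2) unfolding finite_dim_def by blast
  obtain B where B: "B \<subseteq> B0" "independent B" "B0 \<subseteq> span B"
    using maximal_independent_subset by blast
  interpret fd_lie_algebra scale bracket B
  proof
    show "finite B" using B B0 finite_subset by blast
    show "independent B" by (rule B)
    show "span B = UNIV" using B B0 by (metis span_mono span_span top.extremum_unique)
  qed
  have a: "diag_aut \<alpha>" by (rule diag_aut_diagonalizable) (use assms in auto)
  have n: "card (spec \<alpha>) = n" using eigenvalues_eq_spec[OF a] assms(5) by simp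
  have "eig \<alpha> 1 = {x. \<alpha> x = x}" by (simp add: eig_def)
  then have m: "dim (eig \<alpha> 1) = m" using assms(6) by simp
  have "derived_series solvable_radical ((m + 1) * 2 ^ n + m) = {0}"
    using derived_series_graded_bound[OF a, of solvable_radical] solvable_radical_greatest(1,2)[OF assms(2)]
      automorphism_solvable_radical[OF assms(3)] unfolding m n by blast
  then have "derived_length solvable_radical \<le> (m + 1) * 2 ^ n + m"
    unfolding derived_length_def by (rule Least_le)
  moreover have "quotient_dim solvable_radical \<le> 2 * m ^ 2 * n + 2 * m ^ 3 * n ^ 2"
    using quotient_dim_radical_bound[OF a] unfolding m n .
  \<comment> \<open>Since n \<le> n^2 \<le> n^3 for natural numbers, the two terms are at most twice
    (m n)^2 and twice (m n)^3.\<close>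
  moreover have "2 * m ^ 2 * n + 2 * m ^ 3 * n ^ 2 \<le> 16 * (m * n) ^ 3 + 4 * (m * n) ^ 2 + 224 * (m * n)"
  proof -
    have "n \<le> n ^ 2" "n ^ 2 \<le> n ^ 3" by (cases "n = 0"; simp add: power2_eq_square power3_eq_cube)+
    then have "m ^ 2 * n \<le> m ^ 2 * n ^ 2" "m ^ 3 * n ^ 2 \<le> m ^ 3 * n ^ 3" by simp_all
    then have "m ^ 2 * n \<le> (m * n) ^ 2" "m ^ 3 * n ^ 2 \<le> (m * n) ^ 3" by (simp_all only: power_mult_distrib)
    then show ?thesis by linarith
  qed
  ultimately show ?thesis by linarith
qed

end
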